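(* Consider the bifurcating autoregressive (BAR) model and assume that the distribution $\nu$ of the ancestor $X_1$ has finite moments of all orders. Let $\Pi$ be a uniform generation-preserving random permutation independent of $X$. Let $\mu$ be the unique stationary distribution of the induced Markov chain $(Y_r,r\in\mathbb N)$. Then: (i) for all $f\in C_{\mathrm{pol}}(\mathbb R)$, $\overline M_{\mathbb G_q}(f)$ (as $q\to\infty$), $\overline M_{\mathbb T_r}(f)$ (as $r\to\infty$) and $\overline M_n^\Pi(f)$ (as $n\to\infty$) converge to $(\mu,f)$ in $L^2$; (ii) for all $f\in C_{\mathrm{pol}}(\mathbb R^3)$, $\overline M_{\mathbb G_q}(f)$, $\overline M_{\mathbb T_r}(f)$ and $\overline M_n^\Pi(f)$ converge to $(\mu,Pf)$ in $L^2$; (iii) for all $f_1,\dots,f_d\in C_{\mathrm{pol}}(\mathbb R^3)$, $n^{-1/2}\big(M_n^\Pi(f)-M_n^\Pi(Pf)\big)$ converges in distribution, as $n\to\infty$, to $\mathcal N_d(0,\Sigma)$, where $f=(f_1,\dots,f_d)$ and $\Sigma_{ij}=(\mu,P(f_if_j))-(\mu,Pf_i\,Pf_j)$.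
   Context: Tree. $\mathbb T=\mathbb N^*=\{1,2,\dots\}$ is the binary tree (vertex $n$ has daughters $2n$, $2n+1$); $\mathbb G_q=\{2^q,\dots,2^{q+1}-1\}$; $\mathbb T_r=\bigcup_{q=0}^r\mathbb G_q$. BAR model. $X_1$ has distribution $\nu$ on $\mathbb R$ and for all $n\ge1$, $$X_{2n}=\alpha_0X_n+\beta_0+\varepsilon_{2n},\qquad X_{2n+1}=\alpha_1X_n+\beta_1+\varepsilon_{2n+1},$$ where $\alpha_0,\alpha_1\in(-1,1)$, $\beta_0,\beta_1\in\mathbb R$, and $((\varepsilon_{2n},\varepsilon_{2n+1}),n\ge1)$ is a sequence, independent of $X_1$, of i.i.d. centered bivariate Gaussian vectors with covariance matrix $\sigma^2\begin{pmatrix}1&\rho\\\rho&1\end{pmatrix}$, $\sigma^2>0$, $\rho\in(-1,1)$. $P(x,\cdot)$ denotes the law $\mathcal N_2\big((\alpha_0x+\beta_0,\alpha_1x+\beta_1),\sigma^2\begin{pmatrix}1&\rho\\\rho&1\end{pmatrix}\big)$, i.e. the conditional law of $(X_{2n},X_{2n+1})$ given $X_n=x$. Induced chain. $(Y_r,r\in\mathbb N)$ is the real Markov chain with $Y_0=X_1$ and $Y_{r+1}=X_{2n+\zeta_{r+1}}$ if $Y_r=X_n$, with $(\zeta_q)_{q\ge1}$ i.i.d. uniform on $\{0,1\}$, independent of $(X,\Pi)$. Its transition probability is $Q(x,\cdot)=\tfrac12\mathcal N(\alpha_0x+\beta_0,\sigma^2)+\tfrac12\mathcal N(\alpha_1x+\beta_1,\sigma^2)$;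 it has a unique stationary distribution. Function spaces. $C_{\mathrm{pol}}(\mathbb R^p)$ is the set of continuous functions $f:\mathbb R^p\to\mathbb R$ bounded in absolute value by $c(1+\|x\|^m)$ for some $c\ge0$, $m\in\mathbb N$. For $f\in C_{\mathrm{pol}}(\mathbb R^3)$, $Pf(x)=\int_{\mathbb R^2}f(x,y,z)P(x,dy\,dz)$. $(\mu,g)=\int g\,d\mu$. Random permutation. $\Pi$ is a random permutation of $\mathbb N^*$ leaving each $\mathbb G_q$ invariant, whose restrictions to the $\mathbb G_q$ are independent over $q$, each uniform among the $(2^q)!$ permutations of $\mathbb G_q$. Sums. $\Delta_i=(X_i,X_{2i},X_{2i+1})$. For finite $I\subset\mathbb T$: $\overline M_I(f)=|I|^{-1}\sum_{i\in I}f(X_i)$ if $f$ is defined on $\mathbb R$, and $|I|^{-1}\sum_{i\in I}f(\Delta_i)$ if $f$ is defined on $\mathbb R^3$; $M_n^\Pi(f)=\sum_{i=1}^nf(X_{\Pi(i)})$, resp. $\sum_{i=1}^nf(\Delta_{\Pi(i)})$; $\overline M_n^\Pi(f)=n^{-1}M_n^\Pi(f)$. Vector-valued $f$ are treated componentwise. *)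

theory Defs
  imports "HOL-Probability.Probability" "HOL-Combinatorics.Permutations"
begin

section \<open>Multivariate normal laws\<close>

definition std_normal_vec :: "(real ^ 'n) measure" where
  "std_normal_vec = density lborel (\<lambda>z. ennreal (\<Prod>i\<in>UNIV. std_normal_density (z $ i)))"

text \<open>The law of \<open>m + A Z\<close>, where \<open>Z\<close> is standard normal and \<open>A A\<^sup>T = S\<close>, possibly degenerate.
  A square root \<open>A\<close> exists exactly when \<open>S\<close> is symmetric positive semidefinite, and the law then
  does not depend on the choice of \<open>A\<close>; for other \<open>S\<close> the definition is meaningless.\<close>

definition multi_normal :: "real ^ 'n \<Rightarrow> real ^ 'n ^ 'n \<Rightarrow> (real ^ 'n) measure" where
  "multi_normal m S =
     (let A = (SOME A :: real ^ 'n ^ 'n. A ** transpose A = S)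
      in distr std_normal_vec borel (\<lambda>z. m + A *v z))"

section \<open>Modes of convergence and test functions\<close>

definition converges_in_L2 ::
    "'w measure \<Rightarrow> (nat \<Rightarrow> 'w \<Rightarrow> real) \<Rightarrow> ('w \<Rightarrow> real) \<Rightarrow> bool" where
  "converges_in_L2 M Z W \<longleftrightarrow>
     W \<in> borel_measurable M \<and> integrable M (\<lambda>\<omega>. (W \<omega>)\<^sup>2) \<and>
     (\<forall>n. Z n \<in> borel_measurable M \<and> integrable M (\<lambda>\<omega>. (Z n \<omega>)\<^sup>2)) \<and>
     (\<lambda>n. \<integral>\<omega>. (Z n \<omega> - W \<omega>)\<^sup>2 \<partial>M) \<longlonglongrightarrow> 0"

definition converges_in_distribution ::
    "'w measure \<Rightarrow> (nat \<Rightarrow> 'w \<Rightarrow> 'a::topological_space) \<Rightarrow> 'a measure \<Rightarrow> bool" where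
  "converges_in_distribution M Z N \<longleftrightarrow>
     (\<forall>n. Z n \<in> borel_measurable M) \<and>
     (\<forall>g :: 'a \<Rightarrow> real. continuous_on UNIV g \<and> bounded (range g) \<longrightarrow>
        (\<lambda>n. \<integral>\<omega>. g (Z n \<omega>) \<partial>M) \<longlonglongrightarrow> (\<integral>x. g x \<partial>N))"

definition C_pol :: "('a::real_normed_vector \<Rightarrow> real) set" where
  "C_pol = {f. continuous_on UNIV f \<and>
     (\<exists>c\<ge>0. \<exists>m::nat. \<forall>x. \<bar>f x\<bar> \<le> c * (1 + norm x ^ m))}"

section \<open>Independence\<close>

text \<open>As \<open>indep_var\<close>, except that the two variables may take values of different types.\<close>

definition (in prob_space) indep_rv ::
    "'b measure \<Rightarrow> ('a \<Rightarrow> 'b) \<Rightarrow> 'c measure \<Rightarrow> ('a \<Rightarrow> 'c) \<Rightarrow> bool" where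
  "indep_rv N Y N' Y' \<longleftrightarrow>
     random_variable N Y \<and> random_variable N' Y' \<and>
     indep_set {Y -` B \<inter> space M | B. B \<in> sets N} {Y' -` B \<inter> space M | B. B \<in> sets N'}"

section \<open>The binary tree\<close>

definition generation :: "nat \<Rightarrow> nat set" where
  "generation q = {2 ^ q ..< 2 ^ (q + 1)}"

definition subtree :: "nat \<Rightarrow> nat set" where
  "subtree r = (\<Union>q\<le>r. generation q)"

section \<open>The bifurcating autoregressive model\<close>

definition noise_cov :: "real \<Rightarrow> real \<Rightarrow> real ^ 2 ^ 2" where
  "noise_cov \<sigma> \<rho> = \<sigma>\<^sup>2 *\<^sub>R vector [vector [1, \<rho>], vector [\<rho>, 1]]"

locale bar_model = prob_space M
  for M :: "'w measure" +
  fixes \<alpha>\<^sub>0 \<alpha>\<^sub>1 \<beta>\<^sub>0 \<beta>\<^sub>1 \<sigma> \<rho> :: real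
    and \<nu> :: "real measure"
    and X \<epsilon> :: "nat \<Rightarrow> 'w \<Rightarrow> real"
  assumes alpha_bounds: "\<alpha>\<^sub>0 \<in> {-1<..<1}" "\<alpha>\<^sub>1 \<in> {-1<..<1}"
    and sigma_pos: "\<sigma> > 0"
    and rho_bounds: "\<rho> \<in> {-1<..<1}"
    and ancestor_measurable: "X 1 \<in> borel_measurable M"
    and ancestor_law: "distr M borel (X 1) = \<nu>"
    and recursion_even:
      "\<And>n \<omega>. n \<ge> 1 \<Longrightarrow> \<omega> \<in> space M \<Longrightarrow> X (2 * n) \<omega> = \<alpha>\<^sub>0 * X n \<omega> + \<beta>\<^sub>0 + \<epsilon> (2 * n) \<omega>"
    and recursion_odd:
      "\<And>n \<omega>. n \<ge> 1 \<Longrightarrow> \<omega> \<in> space M \<Longrightarrow> X (2 * n + 1) \<omega> = \<alpha>\<^sub>1 * X n \<omega> + \<beta>\<^sub>1 + \<epsilon> (2 * n + 1) \<omega>"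
    and noise_indep:
      "indep_vars (\<lambda>_. borel) (\<lambda>n \<omega>. vector [\<epsilon> (2 * n) \<omega>, \<epsilon> (2 * n + 1) \<omega>] :: real ^ 2) {1..}"
    and noise_law:
      "\<And>n. n \<ge> 1 \<Longrightarrow>
         distr M borel (\<lambda>\<omega>. vector [\<epsilon> (2 * n) \<omega>, \<epsilon> (2 * n + 1) \<omega>]) = multi_normal 0 (noise_cov \<sigma> \<rho>)"
    and noise_indep_ancestor:
      "indep_rv borel (X 1)
         (\<Pi>\<^sub>M n\<in>{1..}. borel) (\<lambda>\<omega>. \<lambda>n\<in>{1..}. vector [\<epsilon> (2 * n) \<omega>, \<epsilon> (2 * n + 1) \<omega>] :: real ^ 2)"

text \<open>\<open>bar_P\<close> is the conditional law of the two daughters given the mother's value; \<open>bar_Q\<close> is the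
  transition probability of the chain that moves to a uniformly chosen daughter at each step.\<close>

definition bar_P ::
    "real \<Rightarrow> real \<Rightarrow> real \<Rightarrow> real \<Rightarrow> real \<Rightarrow> real \<Rightarrow> real \<Rightarrow> (real ^ 2) measure" where
  "bar_P \<alpha>\<^sub>0 \<alpha>\<^sub>1 \<beta>\<^sub>0 \<beta>\<^sub>1 \<sigma> \<rho> x =
     multi_normal (vector [\<alpha>\<^sub>0 * x + \<beta>\<^sub>0, \<alpha>\<^sub>1 * x + \<beta>\<^sub>1]) (noise_cov \<sigma> \<rho>)"

definition apply_P ::
    "(real \<Rightarrow> (real ^ 2) measure) \<Rightarrow> (real \<times> real \<times> real \<Rightarrow> real) \<Rightarrow> real \<Rightarrow> real" where
  "apply_P P f x = (\<integral>w. f (x, w $ 1, w $ 2) \<partial>P x)"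

definition bar_Q ::
    "real \<Rightarrow> real \<Rightarrow> real \<Rightarrow> real \<Rightarrow> real \<Rightarrow> real \<Rightarrow> real measure" where
  "bar_Q \<alpha>\<^sub>0 \<alpha>\<^sub>1 \<beta>\<^sub>0 \<beta>\<^sub>1 \<sigma> x =
     density lborel (\<lambda>y. ennreal (1 / 2 * normal_density (\<alpha>\<^sub>0 * x + \<beta>\<^sub>0) \<sigma> y
                                 + 1 / 2 * normal_density (\<alpha>\<^sub>1 * x + \<beta>\<^sub>1) \<sigma> y))"

definition stationary_distribution :: "(real \<Rightarrow> real measure) \<Rightarrow> real measure \<Rightarrow> bool" where
  "stationary_distribution Q \<mu> \<longleftrightarrow>
     prob_space \<mu> \<and> sets \<mu> = sets borel \<and>
     (\<forall>B\<in>sets borel. emeasure \<mu> B = (\<integral>\<^sup>+ x. emeasure (Q x) B \<partial>\<mu>))"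

section \<open>The random permutation\<close>

text \<open>\<open>restrict_id p A\<close> agrees with \<open>p\<close> on \<open>A\<close> and is the identity elsewhere, so the restriction of
  the permutation to a generation is an element of the finite set
  \<open>{p. p permutes generation q}\<close>.\<close>

locale generation_permutation = prob_space M
  for M :: "'w measure" +
  fixes \<pi> :: "'w \<Rightarrow> nat \<Rightarrow> nat"
  assumes permutation: "\<And>\<omega>. \<omega> \<in> space M \<Longrightarrow> bij_betw (\<pi> \<omega>) {1..} {1..}"
    and generation_invariant: "\<And>\<omega> q. \<omega> \<in> space M \<Longrightarrow> \<pi> \<omega> ` generation q = generation q"
    and generations_indep:
      "indep_vars (\<lambda>_. count_space UNIV) (\<lambda>q \<omega>. restrict_id (\<pi> \<omega>) (generation q)) UNIV"
    and uniform_on_generation: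
      "\<And>q. distr M (count_space UNIV) (\<lambda>\<omega>. restrict_id (\<pi> \<omega>) (generation q)) =
            measure_pmf (pmf_of_set {p. p permutes generation q})"

section \<open>Empirical sums\<close>

text \<open>The sums below are over a family \<open>V\<close> indexed by the vertices of the tree: \<open>V = X\<close> for
  functions on \<open>\<real>\<close>, and \<open>V = family_triple X\<close> for functions on \<open>\<real>\<^sup>3\<close>.\<close>

definition family_triple :: "(nat \<Rightarrow> 'w \<Rightarrow> real) \<Rightarrow> nat \<Rightarrow> 'w \<Rightarrow> real \<times> real \<times> real" where
  "family_triple X i \<omega> = (X i \<omega>, X (2 * i) \<omega>, X (2 * i + 1) \<omega>)"

definition mean_over ::
    "(nat \<Rightarrow> 'w \<Rightarrow> 'a) \<Rightarrow> nat set \<Rightarrow> ('a \<Rightarrow> real) \<Rightarrow> 'w \<Rightarrow> real" where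
  "mean_over V I f \<omega> = (\<Sum>i\<in>I. f (V i \<omega>)) / real (card I)"

definition perm_sum ::
    "(nat \<Rightarrow> 'w \<Rightarrow> 'a) \<Rightarrow> ('w \<Rightarrow> nat \<Rightarrow> nat) \<Rightarrow> nat \<Rightarrow> ('a \<Rightarrow> real) \<Rightarrow> 'w \<Rightarrow> real" where
  "perm_sum V \<pi> n f \<omega> = (\<Sum>i=1..n. f (V (\<pi> \<omega> i) \<omega>))"

definition perm_mean ::
    "(nat \<Rightarrow> 'w \<Rightarrow> 'a) \<Rightarrow> ('w \<Rightarrow> nat \<Rightarrow> nat) \<Rightarrow> nat \<Rightarrow> ('a \<Rightarrow> real) \<Rightarrow> 'w \<Rightarrow> real" where
  "perm_mean V \<pi> n f \<omega> = perm_sum V \<pi> n f \<omega> / real n"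

end

theory Submission
  imports Defs
begin

text \<open>
  Write the model with noise pairs \<open>W n\<close>, which are independent of everything that precedes vertex
  \<open>n\<close> in the breadth-first order. Summands \<open>D (X i, W i)\<close> that are centered given \<open>X i\<close> are then
  martingale differences along any increasing enumeration of vertices.

  Law of large numbers: the transition operator \<open>Q\<close> contracts Lipschitz constants, and the mean
  over generation \<open>q + 1\<close> of \<open>f\<close> is the mean over generation \<open>q\<close> of \<open>Q f\<close> plus an orthogonal
  remainder of variance \<open>O (2\<^sup>-\<^sup>q)\<close>. Hence the \<open>L\<^sup>2\<close> error for a Lipschitz function decays
  geometrically; functions of polynomial growth follow by approximation in a weighted norm. Randomly
  permuted means are reduced to means over generations by exchangeability.

  Central limit theorem: the permutation being independent of the tree, it is enough to bound
  the characteristic function of a sum over a fixed set of vertices by the \<open>L\<^sup>1\<close> distance of its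
  conditional variance to the limit, uniformly over sets of size \<open>n\<close>; the conditional variance
  converges by the law of large numbers. Weak convergence in \<open>\<real>\<^sup>d\<close> follows from pointwise
  convergence of characteristic functions by Gaussian smoothing.
\<close>

section \<open>Multivariate normal laws\<close>

text \<open>The permutation ignores ancestry, so the permuted summands form no martingale in the
  order of visit. The sums depend only on the set of the first \<open>n\<close> visited vertices,
  and each possible set can be summed in increasing order. A single set need not obey the law of
  large numbers (all its vertices in the last generation could be even); hence the bound for a fixed
  set keeps the error of the conditional variance, and only its average over all sets is shown to
  vanish. Values within one generation are correlated through common ancestors. Passing from
  generation to generation avoids computing these correlations: only the fresh noise must be
  orthogonal, the rest sits in the mean of \<open>Q f\<close>, whose Lipschitz constant is smaller
  because two starting points driven by the same noise approach each other. Approximation in a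
  weighted norm costs moments, uniformly over the vertices and also for \<mu>. Of \<mu> only
  invariance is known, so its moments come from a truncated drift inequality. The limiting
  covariance may be degenerate and has no closed square root; normal laws are therefore handled
  through characteristic functions.\<close>

lemma psd_diagonal_zero:
  fixes S :: "real ^ 'n ^ 'n"
  assumes sym: "transpose S = S" and psd: "\<And>u. 0 \<le> u \<bullet> (S *v u)" and "S $ k $ k = 0"
  shows "S $ k $ j = 0"
proof (rule ccontr)
  assume nz: "S $ k $ j \<noteq> 0"
  have symm: "S $ a $ b = S $ b $ a" for a b
    using sym by (metis transpose_def vec_lambda_beta)
  \<comment> \<open>With a zero diagonal entry the quadratic form at
    \<open>t *\<^sub>R axis k 1 + axis j 1\<close> is affine in \<open>t\<close> with slope
    \<open>2 * S $ k $ j\<close>; this \<open>t\<close> makes it equal to -1.\<close>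
  define t where "t = - (S $ j $ j + 1) / (2 * S $ k $ j)"
  have "0 \<le> (t *\<^sub>R axis k 1 + axis j 1) \<bullet> (S *v (t *\<^sub>R axis k 1 + axis j 1))"
    by (rule psd)
  also have "\<dots> = t\<^sup>2 * S $ k $ k + 2 * t * S $ k $ j + S $ j $ j"
    using symm[of j k]
    by (simp add: matrix_vector_right_distrib matrix_vector_mult_scaleR inner_add_left inner_add_right
        matrix_vector_mult_basis column_def inner_axis' power2_eq_square algebra_simps)
  also have "\<dots> = -1"
    using assms(3) nz by (simp add: t_def field_simps)
  finally show False by simp
qed

text \<open>Symmetric Gaussian elimination, with \<open>I\<close> the set of rows that may still be
  nonzero. A pivot \<open>k\<close> with positive diagonal entry is removed by subtracting a
  rank-one matrix, and the Schur complement is again positive semidefinite with row \<open>k\<close>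
  equal to zero. The condition on the columns of \<open>A\<close> keeps column \<open>k\<close> free
  for the rank-one part.\<close>

lemma psd_factorization_supported:
  fixes S :: "real ^ 'n ^ 'n"
  assumes "finite I" "transpose S = S" "\<And>u. 0 \<le> u \<bullet> (S *v u)"
    and "\<And>i j. i \<notin> I \<Longrightarrow> S $ i $ j = 0"
  shows "\<exists>A :: real ^ 'n ^ 'n. A ** transpose A = S \<and> (\<forall>i j. j \<notin> I \<longrightarrow> A $ i $ j = 0)"
  using assms
proof (induction I arbitrary: S rule: finite_induct)
  case empty
  then have "S = 0" by (simp add: vec_eq_iff)
  then show ?case
    by (intro exI[of _ 0]) (simp add: vec_eq_iff matrix_matrix_mult_def)
next
  case (insert k I)
  note sym = insert.prems(1) and psd = insert.prems(2) and supp = insert.prems(3)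
  have symm: "S $ a $ b = S $ b $ a" for a b
    using sym by (metis transpose_def vec_lambda_beta)
  show ?case
  proof (cases "S $ k $ k = 0")
    case True
    have "S $ i $ j = 0" if "i \<notin> I" for i j
      using psd_diagonal_zero[OF sym psd True] supp that by (cases "i = k") auto
    from insert.IH[OF sym psd this] show ?thesis by blast
  next
    case False
    have "0 \<le> axis k 1 \<bullet> (S *v axis k 1)" by (rule psd)
    then have pos: "S $ k $ k > 0"
      using False by (simp add: matrix_vector_mult_basis column_def inner_axis')
    define v :: "real ^ 'n" where "v = (\<chi> i. S $ i $ k / sqrt (S $ k $ k))"
    define S' where "S' = (\<chi> i j. S $ i $ j - v $ i * v $ j)"
    have S'_mult: "S' *v u = S *v u - (v \<bullet> u) *\<^sub>R v" for u
      by (simp add: S'_def vec_eq_iff matrix_vector_mult_def inner_vec_def algebra_simps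
          sum_subtractf sum_distrib_left)
    have sym': "transpose S' = S'"
      using symm by (simp add: S'_def transpose_def vec_eq_iff mult.commute)
    have psd': "0 \<le> u \<bullet> (S' *v u)" for u
    proof -
      \<comment> \<open>Completing the square: this \<open>c\<close> minimises the form along the
        line \<open>u - c *\<^sub>R axis k 1\<close>, and the minimum is the value of the Schur
        complement at \<open>u\<close>.\<close>
      define c where "c = (S *v u) $ k / S $ k $ k"
      have uS: "u \<bullet> (S *v axis k 1) = (S *v u) $ k"
        using symm by (simp add: matrix_vector_mult_basis column_def inner_vec_def)
          (simp add: matrix_vector_mult_def mult.commute)
      have vu: "v \<bullet> u = (S *v u) $ k / sqrt (S $ k $ k)"
        using symm by (simp add: v_def inner_vec_def matrix_vector_mult_def sum_divide_distrib)
      have "0 \<le> (u - c *\<^sub>R axis k 1) \<bullet> (S *v (u - c *\<^sub>R axis k 1))"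
        by (rule psd)
      also have "\<dots> = u \<bullet> (S *v u) - c * (u \<bullet> (S *v axis k 1)) - c * (S *v u) $ k + c\<^sup>2 * S $ k $ k"
        by (simp add: matrix_vector_mult_diff_distrib matrix_vector_mult_scaleR inner_diff_left
            inner_diff_right inner_axis' matrix_vector_mult_basis[of S k] column_def power2_eq_square algebra_simps)
      also have "\<dots> = u \<bullet> (S *v u) - ((S *v u) $ k)\<^sup>2 / S $ k $ k"
        using pos unfolding uS by (simp add: c_def field_simps power2_eq_square)
      also have "\<dots> = u \<bullet> (S' *v u)"
        using pos unfolding S'_mult inner_diff_right
        by (simp add: inner_commute[of u v] vu power2_eq_square flip: real_sqrt_mult)
      finally show ?thesis .
    qed
    have vk: "v $ k * v $ j = S $ k $ j" for j
      using pos symm[of j k] by (simp add: v_def flip: real_sqrt_mult)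
    have supp': "S' $ i $ j = 0" if "i \<notin> I" for i j
    proof (cases "i = k")
      case True
      then show ?thesis using vk by (simp add: S'_def)
    next
      case False
      then have "S $ i $ a = 0" for a using supp that by blast
      then show ?thesis by (simp add: S'_def v_def)
    qed
    obtain A where A: "A ** transpose A = S'" "\<And>i j. j \<notin> I \<Longrightarrow> A $ i $ j = 0"
      using insert.IH[OF sym' psd' supp'] by blast
    \<comment> \<open>Column \<open>k\<close> of \<open>A\<close> vanishes since \<open>k\<close>
      lies outside \<open>I\<close>, so putting \<open>v\<close> there adds exactly the rank-one
      matrix of \<open>v\<close> to \<open>A ** transpose A\<close>.\<close>
    define B where "B = (\<chi> i j. if j = k then v $ i else A $ i $ j)"
    have "(B ** transpose B) $ i $ j = S $ i $ j" for i j
    proof -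
      have "(B ** transpose B) $ i $ j = (\<Sum>l\<in>UNIV. (if l = k then v $ i * v $ j else 0) + A $ i $ l * A $ j $ l)"
        using A(2)[OF insert.hyps(2)]
        by (auto simp: matrix_matrix_mult_def transpose_def B_def intro!: sum.cong)
      also have "\<dots> = v $ i * v $ j + (A ** transpose A) $ i $ j"
        by (simp add: sum.distrib matrix_matrix_mult_def transpose_def)
      finally show ?thesis by (simp add: A(1) S'_def)
    qed
    then have "B ** transpose B = S" by (simp add: vec_eq_iff)
    moreover have "B $ i $ j = 0" if "j \<notin> insert k I" for i j
      using that A(2) by (simp add: B_def)
    ultimately show ?thesis by blast
  qed
qed

lemma psd_factorization:
  fixes S :: "real ^ 'n ^ 'n"
  assumes "transpose S = S" "\<And>u. 0 \<le> u \<bullet> (S *v u)"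
  shows "\<exists>A :: real ^ 'n ^ 'n. A ** transpose A = S"
  using psd_factorization_supported[of UNIV S] assms by auto

text \<open>Lebesgue measure on \<open>real ^ 'n\<close> is the image of a product measure indexed
  by \<open>Basis\<close>. The map sending \<open>i\<close> to \<open>axis i 1\<close> identifies
  coordinates with basis vectors and reduces both claims to product measures.\<close>

lemma
  fixes f :: "'n::finite \<Rightarrow> real \<Rightarrow> 'a::{real_normed_field,banach,second_countable_topology}"
  assumes int: "\<And>i. integrable lborel (f i)"
  shows integral_lborel_vec_prod:
      "(\<integral>z. (\<Prod>i\<in>UNIV. f i (z $ i)) \<partial>(lborel :: (real ^ 'n) measure)) = (\<Prod>i\<in>UNIV. \<integral>x. f i x \<partial>lborel)"
    and integrable_lborel_vec_prod:
      "integrable (lborel :: (real ^ 'n) measure) (\<lambda>z. \<Prod>i\<in>UNIV. f i (z $ i))"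
proof -
  let ?b = "\<lambda>i::'n. axis i (1::real)"
  interpret product_sigma_finite "\<lambda>_::real ^ 'n. lborel :: real measure" ..
  have inj: "inj ?b" by (auto intro!: injI simp: axis_eq_axis)
  have B: "(Basis :: (real ^ 'n) set) = range ?b" by (auto simp: Basis_vec_def)
  define g where "g b = f (inv ?b b)" for b
  have gb: "g (?b i) = f i" for i using inv_f_f[OF inj, of i] by (simp add: g_def)
  have [measurable]: "f i \<in> borel_measurable borel" for i
    using int[of i] by (auto dest: borel_measurable_integrable)
  have eq: "(\<Prod>i\<in>UNIV. f i ((\<Sum>b\<in>Basis. x b *\<^sub>R b) $ i)) = (\<Prod>b\<in>Basis. g b (x b))" for x
  proof -
    have "(\<Sum>b\<in>Basis. x b *\<^sub>R b) $ i = x (?b i)" for i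
    proof -
      have "(\<Sum>b\<in>Basis. x b *\<^sub>R b) $ i = (\<Sum>b\<in>Basis. x b *\<^sub>R b) \<bullet> ?b i"
        by (simp add: inner_axis)
      also have "\<dots> = x (?b i)" by (rule inner_sum_left_Basis) (simp add: B)
      finally show ?thesis .
    qed
    then show ?thesis
      unfolding B by (subst prod.reindex[OF inj]) (simp add: gb)
  qed
  have gi: "integrable lborel (g b)" for b using int by (simp add: g_def)
  have [measurable]: "(\<lambda>f. \<Sum>b\<in>Basis. f b *\<^sub>R b) \<in> (\<Pi>\<^sub>M b\<in>(Basis :: (real ^ 'n) set). lborel) \<rightarrow>\<^sub>M borel"
    by measurable
  have "(\<integral>z. (\<Prod>i\<in>UNIV. f i (z $ i)) \<partial>(lborel :: (real ^ 'n) measure)) =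
     (\<integral>x. (\<Prod>b\<in>Basis. g b (x b)) \<partial>(\<Pi>\<^sub>M b\<in>(Basis :: (real ^ 'n) set). lborel))"
    by (subst lborel_eq, subst integral_distr) (measurable, simp only: eq)
  also have "\<dots> = (\<Prod>b\<in>Basis. \<integral>x. g b x \<partial>lborel)"
    by (rule product_integral_prod) (use gi in auto)
  also have "\<dots> = (\<Prod>i\<in>UNIV. \<integral>x. f i x \<partial>lborel)"
    unfolding B by (subst prod.reindex[OF inj]) (simp add: gb)
  finally show "(\<integral>z. (\<Prod>i\<in>UNIV. f i (z $ i)) \<partial>(lborel :: (real ^ 'n) measure)) = (\<Prod>i\<in>UNIV. \<integral>x. f i x \<partial>lborel)" .
  have "integrable (\<Pi>\<^sub>M b\<in>(Basis :: (real ^ 'n) set). lborel) (\<lambda>x. \<Prod>b\<in>Basis. g b (x b))"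
    by (rule product_integrable_prod) (use gi in auto)
  then show "integrable (lborel :: (real ^ 'n) measure) (\<lambda>z. \<Prod>i\<in>UNIV. f i (z $ i))"
    by (subst lborel_eq, subst integrable_distr_eq) (measurable, simp only: eq)
qed

section \<open>The standard normal density and the characteristic functions of normal
  vectors\<close>

definition std_normal_vec_density :: "real ^ 'n \<Rightarrow> real" where
  "std_normal_vec_density z = (\<Prod>i\<in>UNIV. std_normal_density (z $ i))"

lemma std_normal_vec_density_nonneg: "0 \<le> std_normal_vec_density z"
  by (simp add: std_normal_vec_density_def prod_nonneg)

lemma std_normal_vec_density_measurable [measurable]:
  "std_normal_vec_density \<in> borel_measurable borel"
  unfolding std_normal_vec_density_def by measurable

lemma std_normal_vec_eq: "std_normal_vec = density lborel std_normal_vec_density"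
  by (simp add: std_normal_vec_def std_normal_vec_density_def)

lemma sets_std_normal_vec [measurable_cong, simp]: "sets std_normal_vec = sets borel"
  by (simp add: std_normal_vec_def)

lemma space_std_normal_vec [simp]: "space std_normal_vec = UNIV"
  by (simp add: std_normal_vec_def)

lemma prob_space_std_normal_vec: "prob_space (std_normal_vec :: (real ^ 'n) measure)"
proof
  have "emeasure (std_normal_vec :: (real ^ 'n) measure) (space std_normal_vec)
      = (\<integral>\<^sup>+ z. ennreal (std_normal_vec_density (z :: real ^ 'n)) \<partial>lborel)"
    by (simp add: std_normal_vec_eq emeasure_density)
  also have "\<dots> = ennreal (\<integral>z. std_normal_vec_density (z :: real ^ 'n) \<partial>lborel)"
    unfolding std_normal_vec_density_def
    by (intro nn_integral_eq_integral integrable_lborel_vec_prod) (auto intro!: prod_nonneg)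
  also have "\<dots> = 1"
    unfolding std_normal_vec_density_def
    by (subst integral_lborel_vec_prod) auto
  finally show "emeasure (std_normal_vec :: (real ^ 'n) measure) (space std_normal_vec) = 1" .
qed

lemma cis_measurable [measurable]: "cis \<in> borel_measurable borel"
  by (intro borel_measurable_continuous_onI continuous_intros)

lemma integral_cis_std_normal_vec:
  fixes u :: "real ^ 'n"
  shows "(\<integral>z. cis (u \<bullet> z) \<partial>std_normal_vec) = of_real (exp (- (u \<bullet> u) / 2))"
proof -
  have cis_sum: "cis (sum g I) = (\<Prod>i\<in>I. cis (g i))" if "finite I" for g :: "'n \<Rightarrow> real" and I
    using that by (induction I) (auto simp flip: cis_mult)
  have "(\<integral>z. cis (u \<bullet> z) \<partial>std_normal_vec) = (\<integral>z. std_normal_vec_density z *\<^sub>R cis (u \<bullet> z) \<partial>lborel)"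
    unfolding std_normal_vec_eq
    by (subst integral_density) (auto simp: std_normal_vec_density_nonneg)
  also have "\<dots> = (\<integral>z. (\<Prod>i\<in>UNIV. std_normal_density (z $ i) *\<^sub>R cis (u $ i * z $ i)) \<partial>lborel)"
    by (simp add: std_normal_vec_density_def inner_vec_def cis_sum prod.distrib scaleR_conv_of_real)
  also have "\<dots> = (\<Prod>i\<in>UNIV. \<integral>x. std_normal_density x *\<^sub>R cis (u $ i * x) \<partial>lborel)"
  proof (rule integral_lborel_vec_prod)
    show "integrable lborel (\<lambda>x. std_normal_density x *\<^sub>R cis (u $ i * x))" for i
      by (rule Bochner_Integration.integrable_bound[OF integrable_normal_density[of 1 0]]) auto
  qed
  also have "\<dots> = (\<Prod>i\<in>UNIV. char std_normal_distribution (u $ i))"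
    by (simp add: char_def integral_density cis_conv_exp mult.assoc)
  also have "\<dots> = of_real (\<Prod>i\<in>UNIV. exp (- (u $ i)\<^sup>2 / 2))"
    by (simp add: char_std_normal_distribution)
  also have "(\<Prod>i\<in>UNIV. exp (- (u $ i)\<^sup>2 / 2)) = exp (- (u \<bullet> u) / 2)"
    by (simp add: exp_sum[symmetric] inner_vec_def sum_negf sum_divide_distrib power2_eq_square)
  finally show ?thesis .
qed

lemma sets_multi_normal [measurable_cong, simp]: "sets (multi_normal m S) = sets borel"
  by (simp add: multi_normal_def Let_def)

lemma space_multi_normal [simp]: "space (multi_normal m S) = UNIV"
  by (simp add: multi_normal_def Let_def)

lemma matrix_vector_mult_measurable [measurable]: "(*v) (A :: real ^ 'n ^ 'm) \<in> borel_measurable borel"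
  by (intro borel_measurable_continuous_onI matrix_vector_mult_linear_continuous_on)

lemma prob_space_multi_normal: "prob_space (multi_normal m S :: (real ^ 'n) measure)"
  unfolding multi_normal_def Let_def
  by (rule prob_space.prob_space_distr[OF prob_space_std_normal_vec]) measurable

text \<open>The square root enters only through the squared length of
  \<open>transpose A *v u\<close>, which is \<open>u \<bullet> (S *v u)\<close>; so the choice made
  by \<open>SOME\<close> leaves no trace.\<close>

lemma integral_cis_multi_normal:
  fixes S :: "real ^ 'n ^ 'n"
  assumes "transpose S = S" "\<And>u. 0 \<le> u \<bullet> (S *v u)"
  shows "(\<integral>x. cis (u \<bullet> x) \<partial>multi_normal m S) = cis (u \<bullet> m) * of_real (exp (- (u \<bullet> (S *v u)) / 2))"
proof -
  define A where "A = (SOME A :: real ^ 'n ^ 'n. A ** transpose A = S)"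
  have A: "A ** transpose A = S"
    unfolding A_def using psd_factorization[OF assms] by (rule someI_ex)
  have uA: "u \<bullet> (A *v z) = (transpose A *v u) \<bullet> z" for z
    by (metis dot_lmul_matrix vector_transpose_matrix transpose_transpose)
  have "(\<integral>x. cis (u \<bullet> x) \<partial>multi_normal m S) = (\<integral>z. cis (u \<bullet> (m + A *v z)) \<partial>std_normal_vec)"
    unfolding multi_normal_def Let_def A_def[symmetric] by (subst integral_distr) auto
  also have "\<dots> = cis (u \<bullet> m) * (\<integral>z. cis ((transpose A *v u) \<bullet> z) \<partial>std_normal_vec)"
    by (simp add: inner_add_right uA flip: cis_mult)
  also have "(transpose A *v u) \<bullet> (transpose A *v u) = u \<bullet> (S *v u)"
    using uA[of "transpose A *v u"] by (simp only: matrix_vector_mul_assoc A)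
  then have "(\<integral>z. cis ((transpose A *v u) \<bullet> z) \<partial>std_normal_vec) = of_real (exp (- (u \<bullet> (S *v u)) / 2))"
    by (simp add: integral_cis_std_normal_vec)
  finally show ?thesis .
qed

section \<open>Gaussian smoothing and the continuity theorem for characteristic functions\<close>

lemma uniformly_continuous_compact_support:
  fixes g :: "'a::euclidean_space \<Rightarrow> real"
  assumes cont: "continuous_on UNIV g" and supp: "\<And>x. norm x > R \<Longrightarrow> g x = 0"
  shows "uniformly_continuous_on UNIV g"
  unfolding uniformly_continuous_on_def
proof (intro allI impI)
  fix e :: real assume e: "e > 0"
  have "uniformly_continuous_on (cball 0 (R + 1)) g"
    by (intro compact_uniformly_continuous continuous_on_subset[OF cont]) auto
  then obtain d where d: "d > 0"
      "\<And>x y. norm x \<le> R + 1 \<Longrightarrow> norm y \<le> R + 1 \<Longrightarrow> dist y x < d \<Longrightarrow> dist (g y) (g x) < e"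
    using e unfolding uniformly_continuous_on_def by (force simp: dist_norm)
  \<comment> \<open>Two points at distance below 1 lie either both in the ball of radius
    \<open>R + 1\<close>, which is compact, or both outside the ball of radius \<open>R\<close>,
    where \<open>g\<close> vanishes.\<close>
  have "dist (g y) (g x) < e" if "dist y x < min d 1" for x y
  proof -
    have n: "norm x \<le> norm y + dist y x" "norm y \<le> norm x + dist y x"
      unfolding dist_norm by norm+
    show ?thesis
    proof (cases "norm x \<le> R + 1 \<and> norm y \<le> R + 1")
      case True
      then show ?thesis using d that by auto
    next
      case False
      then have "norm x > R" "norm y > R" using n that by auto
      then show ?thesis using supp e by simp
    qed
  qed
  then show "\<exists>d>0. \<forall>x\<in>UNIV. \<forall>y\<in>UNIV. dist y x < d \<longrightarrow> dist (g y) (g x) < e"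
    using d(1) by (intro exI[of _ "min d 1"]) auto
qed

lemma std_normal_vec_density_eq_exp:
  fixes u :: "real ^ 'n"
  shows "std_normal_vec_density u = (1 / sqrt (2 * pi)) ^ CARD('n) * exp (- (u \<bullet> u) / 2)"
  by (simp add: std_normal_vec_density_def std_normal_density_def prod.distrib prod_dividef
      exp_sum[symmetric] inner_vec_def sum_negf sum_divide_distrib power2_eq_square power_one_over)

text \<open>The Gaussian function is its own Fourier transform up to a constant; this writes the
  smoothing kernel as an average of characters.\<close>

lemma exp_eq_integral_cos:
  fixes u :: "real ^ 'n"
  shows "exp (- (u \<bullet> u) / 2) = (\<integral>z. cos (u \<bullet> z) \<partial>std_normal_vec)"
proof -
  interpret prob_space "std_normal_vec :: (real ^ 'n) measure" by (rule prob_space_std_normal_vec)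
  have "integrable std_normal_vec (\<lambda>z. cis (u \<bullet> z))"
    by (rule integrable_const_bound[where B=1]) auto
  then have "(\<integral>z. Re (cis (u \<bullet> z)) \<partial>std_normal_vec) = Re (\<integral>z. cis (u \<bullet> z) \<partial>std_normal_vec)"
    by (rule integral_Re)
  then show ?thesis by (simp add: integral_cis_std_normal_vec)
qed

lemma integral_std_normal_vec_affine:
  fixes g :: "real ^ 'n \<Rightarrow> real"
  assumes [measurable]: "g \<in> borel_measurable borel" and "h > 0"
  shows "(\<integral>z. g (s + h *\<^sub>R z) \<partial>std_normal_vec)
       = (\<integral>y. g y * (std_normal_vec_density ((1 / h) *\<^sub>R (y - s)) / h ^ CARD('n)) \<partial>lborel)"
proof -
  have "(\<integral>y. g y * (std_normal_vec_density ((1 / h) *\<^sub>R (y - s)) / h ^ CARD('n)) \<partial>lborel)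
     = (\<integral>z. std_normal_vec_density z * g (s + h *\<^sub>R z) \<partial>lborel)"
    using \<open>h > 0\<close>
    by (subst lborel_affine[of h s])
       (simp_all add: integral_density integral_distr mult.commute)
  also have "\<dots> = (\<integral>z. g (s + h *\<^sub>R z) \<partial>std_normal_vec)"
    unfolding std_normal_vec_eq
    by (subst integral_density) (auto simp: std_normal_vec_density_nonneg)
  finally show ?thesis by simp
qed

text \<open>After exchanging the integrals, \<open>L\<close> appears only through its characteristic
  function at \<open>- z / h\<close>. This is the place where convergence of characteristic
  functions enters.\<close>

lemma integral_gaussian_kernel_eq:
  fixes L :: "(real ^ 'n) measure"
  assumes "prob_space L" and [measurable_cong]: "sets L = sets borel"
  shows "(\<integral>s. exp (- (((1 / h) *\<^sub>R (y - s)) \<bullet> ((1 / h) *\<^sub>R (y - s))) / 2) \<partial>L)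
       = (\<integral>z. Re (cis ((1 / h) * (y \<bullet> z)) * (\<integral>s. cis ((- (1 / h) *\<^sub>R z) \<bullet> s) \<partial>L)) \<partial>std_normal_vec)"
proof -
  interpret L: prob_space L by fact
  interpret G: prob_space "std_normal_vec :: (real ^ 'n) measure" by (rule prob_space_std_normal_vec)
  interpret P: pair_prob_space L "std_normal_vec :: (real ^ 'n) measure" ..
  have "(\<integral>s. exp (- (((1 / h) *\<^sub>R (y - s)) \<bullet> ((1 / h) *\<^sub>R (y - s))) / 2) \<partial>L)
     = (\<integral>s. (\<integral>z. cos (((1 / h) *\<^sub>R (y - s)) \<bullet> z) \<partial>std_normal_vec) \<partial>L)"
    by (simp only: exp_eq_integral_cos)
  also have "\<dots> = (\<integral>z. (\<integral>s. cos (((1 / h) *\<^sub>R (y - s)) \<bullet> z) \<partial>L) \<partial>std_normal_vec)"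
    by (rule P.Fubini_integral[symmetric], rule P.integrable_const_bound[where B=1]) auto
  also have "\<dots> = (\<integral>z. Re (cis ((1 / h) * (y \<bullet> z)) * (\<integral>s. cis ((- (1 / h) *\<^sub>R z) \<bullet> s) \<partial>L)) \<partial>std_normal_vec)"
  proof (rule Bochner_Integration.integral_cong[OF refl])
    fix z :: "real ^ 'n"
    have i: "integrable L (\<lambda>s. cis ((1 / h) * (y \<bullet> z)) * cis ((- (1 / h) *\<^sub>R z) \<bullet> s))"
      by (rule L.integrable_const_bound[where B=1]) (auto simp: norm_mult)
    have "(\<integral>s. cos (((1 / h) *\<^sub>R (y - s)) \<bullet> z) \<partial>L)
       = (\<integral>s. Re (cis ((1 / h) * (y \<bullet> z)) * cis ((- (1 / h) *\<^sub>R z) \<bullet> s)) \<partial>L)"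
      by (simp add: cis_mult inner_diff_left inner_commute[of z] right_diff_distrib diff_divide_distrib)
    also have "\<dots> = Re (\<integral>s. cis ((1 / h) * (y \<bullet> z)) * cis ((- (1 / h) *\<^sub>R z) \<bullet> s) \<partial>L)"
      by (rule integral_Re[OF i])
    finally show "(\<integral>s. cos (((1 / h) *\<^sub>R (y - s)) \<bullet> z) \<partial>L)
       = Re (cis ((1 / h) * (y \<bullet> z)) * (\<integral>s. cis ((- (1 / h) *\<^sub>R z) \<bullet> s) \<partial>L))"
      by simp
  qed
  finally show ?thesis .
qed

lemma std_normal_vec_tail_small:
  assumes "e > 0"
  shows "\<exists>R>0. measure (std_normal_vec :: (real ^ 'n) measure) {z. norm z \<ge> R} < e"
proof -
  interpret G: prob_space "std_normal_vec :: (real ^ 'n) measure" by (rule prob_space_std_normal_vec)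
  have "(\<lambda>n. G.prob {z. norm z \<ge> real n}) \<longlonglongrightarrow> G.prob (\<Inter>n. {z. norm z \<ge> real n})"
    by (rule G.finite_Lim_measure_decseq) (auto simp: decseq_def)
  moreover have "(\<Inter>n. {z :: real ^ 'n. norm z \<ge> real n}) = {}"
    by (simp add: set_eq_iff not_le reals_Archimedean2)
  ultimately have "(\<lambda>n. G.prob {z. norm z \<ge> real n}) \<longlonglongrightarrow> 0" by simp
  then have "\<forall>\<^sub>F n in sequentially. G.prob {z. norm z \<ge> real n} < e"
    using assms by (rule order_tendstoD)
  then have "\<forall>\<^sub>F n in sequentially. G.prob {z. norm z \<ge> real n} < e \<and> n > 0"
    using eventually_gt_at_top by (rule eventually_conj)
  then obtain n where "G.prob {z. norm z \<ge> real n} < e" "n > 0"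
    by (auto simp: eventually_sequentially)
  then show ?thesis by (intro exI[of _ "real n"]) auto
qed

text \<open>Smoothing with a small Gaussian makes the integral of \<open>g\<close> an explicit functional of the
  characteristic function.\<close>

lemma integral_tendsto_compact_support:
  fixes L :: "nat \<Rightarrow> (real ^ 'n) measure" and N :: "(real ^ 'n) measure"
    and g :: "real ^ 'n \<Rightarrow> real"
  assumes L: "\<And>n. prob_space (L n)" "\<And>n. sets (L n) = sets borel"
    and N: "prob_space N" "sets N = sets borel"
    and char: "\<And>u. (\<lambda>n. \<integral>x. cis (u \<bullet> x) \<partial>L n) \<longlonglongrightarrow> (\<integral>x. cis (u \<bullet> x) \<partial>N)"
    and cont: "continuous_on UNIV g" and supp: "\<And>x. norm x > R \<Longrightarrow> g x = 0"
    and bound: "\<And>x. \<bar>g x\<bar> \<le> B"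
  shows "(\<lambda>n. \<integral>x. g x \<partial>L n) \<longlonglongrightarrow> (\<integral>x. g x \<partial>N)"
proof -
  note [measurable_cong] = L(2) N(2)
  interpret G: prob_space "std_normal_vec :: (real ^ 'n) measure" by (rule prob_space_std_normal_vec)
  have gm[measurable]: "g \<in> borel_measurable borel"
    by (rule borel_measurable_continuous_onI[OF cont])
  have B: "0 \<le> B" using bound[of 0] by linarith
  \<comment> \<open>The integral of \<open>g\<close> against \<open>K\<close> convolved with a
    centered normal law of standard deviation \<open>h\<close> in each coordinate.\<close>
  define Sm where "Sm h K = (\<integral>s. (\<integral>z. g (s + h *\<^sub>R z) \<partial>std_normal_vec) \<partial>K)" for h and K :: "(real ^ 'n) measure"
  define c where "c = (1 / sqrt (2 * pi)) ^ CARD('n)"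
  have c: "c > 0" by (simp add: c_def)
  \<comment> \<open>Up to the factor \<open>c / h ^ CARD('n)\<close> this is the Lebesgue density of
    the smoothed law at \<open>y\<close>.\<close>
  define k where "k h K y = (\<integral>s. exp (- (((1 / h) *\<^sub>R (y - s)) \<bullet> ((1 / h) *\<^sub>R (y - s))) / 2) \<partial>K)"
    for h :: real and K :: "(real ^ 'n) measure" and y
  have k_bound: "\<bar>k h K y\<bar> \<le> 1" if "prob_space K" "sets K = sets borel" for h K y
  proof -
    interpret K: prob_space K by fact
    note [measurable_cong] = that(2)
    have "norm (k h K y) \<le> (\<integral>s. 1 \<partial>K)"
      unfolding k_def
      by (rule Bochner_Integration.integral_norm_bound_integral)
         (auto intro!: K.integrable_const_bound[where B=1])
    then show ?thesis by (simp add: K.prob_space)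
  qed
  have k_tendsto: "(\<lambda>n. k h (L n) y) \<longlonglongrightarrow> k h N y" for h y
    unfolding k_def integral_gaussian_kernel_eq[OF L] integral_gaussian_kernel_eq[OF N]
  proof (rule integral_dominated_convergence[where w="\<lambda>_. 1"])
    have cm: "(\<lambda>z. \<integral>s. cis ((- (1 / h) *\<^sub>R z) \<bullet> s) \<partial>K) \<in> borel_measurable borel"
      if "prob_space K" "sets K = sets borel" for K :: "(real ^ 'n) measure"
    proof -
      interpret K: prob_space K by fact
      note [measurable_cong] = that(2)
      show ?thesis by measurable
    qed
    note [measurable] = cm[OF L] cm[OF N]
    show "(\<lambda>z. Re (cis (1 / h * (y \<bullet> z)) * (\<integral>s. cis ((- (1 / h) *\<^sub>R z) \<bullet> s) \<partial>N)))
         \<in> borel_measurable std_normal_vec" by measurable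
    show "(\<lambda>z. Re (cis (1 / h * (y \<bullet> z)) * (\<integral>s. cis ((- (1 / h) *\<^sub>R z) \<bullet> s) \<partial>L n)))
         \<in> borel_measurable std_normal_vec" for n by measurable
    show "AE z in std_normal_vec. (\<lambda>n. Re (cis (1 / h * (y \<bullet> z)) * (\<integral>s. cis ((- (1 / h) *\<^sub>R z) \<bullet> s) \<partial>L n)))
        \<longlonglongrightarrow> Re (cis (1 / h * (y \<bullet> z)) * (\<integral>s. cis ((- (1 / h) *\<^sub>R z) \<bullet> s) \<partial>N))"
      by (intro AE_I2 tendsto_intros char)
    show "AE z in std_normal_vec. norm (Re (cis (1 / h * (y \<bullet> z)) * (\<integral>s. cis ((- (1 / h) *\<^sub>R z) \<bullet> s) \<partial>L n))) \<le> 1" for n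
    proof (rule AE_I2)
      fix z :: "real ^ 'n"
      interpret Ln: prob_space "L n" by fact
      have "norm (\<integral>s. cis ((- (1 / h) *\<^sub>R z) \<bullet> s) \<partial>L n) \<le> (\<integral>s. 1 \<partial>L n)"
        by (rule Bochner_Integration.integral_norm_bound_integral)
           (auto intro!: Ln.integrable_const_bound[where B=1])
      then have "cmod (cis (1 / h * (y \<bullet> z)) * (\<integral>s. cis ((- (1 / h) *\<^sub>R z) \<bullet> s) \<partial>L n)) \<le> 1"
        by (simp add: norm_mult Ln.prob_space)
      then show "norm (Re (cis (1 / h * (y \<bullet> z)) * (\<integral>s. cis ((- (1 / h) *\<^sub>R z) \<bullet> s) \<partial>L n))) \<le> 1"
        unfolding real_norm_def by (rule order_trans[OF abs_Re_le_cmod])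
    qed
  qed auto
  have Sm_eq: "Sm h K = (\<integral>y. g y * (c / h ^ CARD('n) * k h K y) \<partial>lborel)"
    if "h > 0" "prob_space K" "sets K = sets borel" for h K
  proof -
    interpret K: prob_space K by fact
    note [measurable_cong] = that(3)
    interpret P: pair_sigma_finite K "lborel :: (real ^ 'n) measure" ..
    let ?f = "\<lambda>s y. g y * (c / h ^ CARD('n) * exp (- (((1 / h) *\<^sub>R (y - s)) \<bullet> ((1 / h) *\<^sub>R (y - s))) / 2))"
    have "Sm h K = (\<integral>s. (\<integral>y. ?f s y \<partial>lborel) \<partial>K)"
      unfolding Sm_def
      by (subst integral_std_normal_vec_affine[OF gm \<open>h > 0\<close>])
         (simp add: std_normal_vec_density_eq_exp c_def)
    also have "\<dots> = (\<integral>y. (\<integral>s. ?f s y \<partial>K) \<partial>lborel)"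
    \<comment> \<open>Lebesgue measure being infinite, integrability rests on the compact support of
      \<open>g\<close>: the integrand is dominated by a constant on
      \<open>UNIV \<times> cball 0 R\<close>, a set of finite measure.\<close>
    proof (rule P.Fubini_integral[symmetric])
      have "emeasure (K \<Otimes>\<^sub>M lborel) (UNIV \<times> cball (0 :: real ^ 'n) R) = emeasure K UNIV * emeasure lborel (cball (0 :: real ^ 'n) R)"
        by (rule lborel.emeasure_pair_measure_Times) (use that(3) in \<open>auto simp: sets_eq_imp_space_eq[OF that(3)]\<close>)
      also have "\<dots> < \<infinity>"
        using emeasure_lborel_cball_finite[of "0 :: real ^ 'n" R]
        by (simp add: K.emeasure_eq_measure ennreal_mult_less_top)
      finally have "integrable (K \<Otimes>\<^sub>M lborel) (\<lambda>x. indicator (UNIV \<times> cball (0 :: real ^ 'n) R) x * (B * (c / h ^ CARD('n))))"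
        by (intro integrable_mult_left integrable_real_indicator) auto
      then show "integrable (K \<Otimes>\<^sub>M lborel) (\<lambda>(s, y). ?f s y)"
      proof (rule Bochner_Integration.integrable_bound)
        show "AE x in K \<Otimes>\<^sub>M lborel. norm (case x of (s, y) \<Rightarrow> ?f s y)
            \<le> norm (indicator (UNIV \<times> cball (0 :: real ^ 'n) R) x * (B * (c / h ^ CARD('n))))"
        proof (rule AE_I2, clarify)
          fix s y :: "real ^ 'n"
          let ?E = "exp (- (((1 / h) *\<^sub>R (y - s)) \<bullet> ((1 / h) *\<^sub>R (y - s))) / 2)"
          have "\<bar>g y\<bar> \<le> indicator (cball 0 R) y * B"
            using supp[of y] bound[of y] B by (auto simp: indicator_def not_le)
          moreover have "?E \<le> 1" by simp
          ultimately have "\<bar>g y\<bar> * (c / h ^ CARD('n) * ?E) \<le> (indicator (cball 0 R) y * B) * (c / h ^ CARD('n) * 1)"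
            using c \<open>h > 0\<close> B by (intro mult_mono) auto
          then show "norm (?f s y) \<le> norm (indicator (UNIV \<times> cball (0 :: real ^ 'n) R) (s, y) * (B * (c / h ^ CARD('n))))"
            using c \<open>h > 0\<close> B by (simp add: abs_mult mult.assoc indicator_times)
        qed
      qed measurable
    qed
    also have "\<dots> = (\<integral>y. g y * (c / h ^ CARD('n) * k h K y) \<partial>lborel)"
      by (simp add: k_def)
    finally show ?thesis .
  qed
  have Sm_tendsto: "(\<lambda>n. Sm h (L n)) \<longlonglongrightarrow> Sm h N" if h: "h > 0" for h
    unfolding Sm_eq[OF h L] Sm_eq[OF h N]
  proof (rule integral_dominated_convergence[where w="\<lambda>y. indicator (cball 0 R) y * (B * (c / h ^ CARD('n)))"])
    have km: "k h K \<in> borel_measurable borel"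
      if "prob_space K" "sets K = sets borel" for K
    proof -
      interpret K: prob_space K by fact
      note [measurable_cong] = that(2)
      show ?thesis unfolding k_def by measurable
    qed
    note [measurable] = km[OF L] km[OF N]
    show "(\<lambda>y. g y * (c / h ^ CARD('n) * k h N y)) \<in> borel_measurable lborel" by measurable
    show "(\<lambda>y. g y * (c / h ^ CARD('n) * k h (L n) y)) \<in> borel_measurable lborel" for n by measurable
    show "AE y in lborel. (\<lambda>n. g y * (c / h ^ CARD('n) * k h (L n) y)) \<longlonglongrightarrow> g y * (c / h ^ CARD('n) * k h N y)"
      by (intro AE_I2 tendsto_intros k_tendsto)
    show "AE y in lborel. norm (g y * (c / h ^ CARD('n) * k h (L n) y))
        \<le> indicator (cball 0 R) y * (B * (c / h ^ CARD('n)))" for n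
    proof (rule AE_I2)
      fix y
      have "\<bar>g y\<bar> \<le> indicator (cball 0 R) y * B"
        using supp[of y] bound[of y] B by (auto simp: indicator_def not_le)
      then have "\<bar>g y\<bar> * (c / h ^ CARD('n) * \<bar>k h (L n) y\<bar>) \<le> (indicator (cball 0 R) y * B) * (c / h ^ CARD('n) * 1)"
        using k_bound[OF L, of h n y] c h B by (intro mult_mono) auto
      then show "norm (g y * (c / h ^ CARD('n) * k h (L n) y)) \<le> indicator (cball 0 R) y * (B * (c / h ^ CARD('n)))"
        using c h by (simp add: abs_mult mult.assoc)
    qed
    show "integrable lborel (\<lambda>y :: real ^ 'n. indicator (cball 0 R) y * (B * (c / h ^ CARD('n))))"
      by (intro integrable_mult_left integrable_real_indicator) (use emeasure_lborel_cball_finite[of "0 :: real ^ 'n" R] in \<open>auto simp: less_top\<close>)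
  qed
  \<comment> \<open>The width \<open>h\<close> must serve all laws \<open>K\<close> at once, the
    sequence as well as its limit. The error is therefore bounded pointwise in the starting point
    \<open>s\<close>, before integrating against \<open>K\<close>.\<close>
  have Sm_close: "\<exists>h>0. \<forall>K. prob_space K \<longrightarrow> sets K = sets borel \<longrightarrow> \<bar>Sm h K - (\<integral>x. g x \<partial>K)\<bar> \<le> e"
    if e: "e > 0" for e
  proof -
    obtain d where d: "d > 0" "\<And>x y. dist y x < d \<Longrightarrow> dist (g y) (g x) < e / 2"
      using uniformly_continuous_compact_support[OF cont supp] e
      unfolding uniformly_continuous_on_def by (metis UNIV_I half_gt_zero)
    \<comment> \<open>The summand 1 in the denominator covers the case \<open>B = 0\<close>.\<close>
    obtain r where r: "r > 0" "G.prob {z. norm z \<ge> r} < e / (4 * B + 1)"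
      using std_normal_vec_tail_small[of "e / (4 * B + 1)"] e B by auto
    have tail: "2 * B * G.prob {z. norm z \<ge> r} \<le> e / 2"
    proof -
      have "(4 * B + 1) * G.prob {z. norm z \<ge> r} \<le> e" using r(2) B by (simp add: field_simps)
      moreover have "4 * B * G.prob {z. norm z \<ge> r} \<le> (4 * B + 1) * G.prob {z. norm z \<ge> r}"
        by (intro mult_right_mono) auto
      ultimately show ?thesis by linarith
    qed
    \<comment> \<open>For \<open>norm z < r\<close> the shift \<open>h *\<^sub>R z\<close> is then
      shorter than \<open>d\<close>, so uniform continuity applies; larger \<open>z\<close> have
      small probability.\<close>
    define h where "h = d / r"
    have h: "h > 0" using d r by (simp add: h_def)
    have gi: "integrable std_normal_vec (\<lambda>z. g (s + h *\<^sub>R z))" for s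
      by (rule G.integrable_const_bound[where B=B]) (auto simp: bound)
    have close: "\<bar>(\<integral>z. g (s + h *\<^sub>R z) \<partial>std_normal_vec) - g s\<bar> \<le> e" for s
    proof -
      have "(\<integral>z. g (s + h *\<^sub>R z) \<partial>std_normal_vec) - g s = (\<integral>z. g (s + h *\<^sub>R z) - g s \<partial>std_normal_vec)"
        using gi by (simp add: G.prob_space[simplified])
      also have "norm \<dots> \<le> (\<integral>z. e / 2 + indicator {z. norm z \<ge> r} z * (2 * B) \<partial>(std_normal_vec :: (real ^ 'n) measure))"
      proof (rule Bochner_Integration.integral_norm_bound_integral)
        show "integrable std_normal_vec (\<lambda>z. g (s + h *\<^sub>R z) - g s)" using gi by simp
        show "integrable std_normal_vec (\<lambda>z :: real ^ 'n. e / 2 + indicator {z. norm z \<ge> r} z * (2 * B))"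
          by (intro Bochner_Integration.integrable_add integrable_mult_left integrable_real_indicator)
             (auto simp: G.emeasure_eq_measure)
        fix z :: "real ^ 'n"
        show "norm (g (s + h *\<^sub>R z) - g s) \<le> e / 2 + indicator {z. norm z \<ge> r} z * (2 * B)"
        proof (cases "norm z \<ge> r")
          case True
          then show ?thesis using bound[of "s + h *\<^sub>R z"] bound[of s] e by (auto simp: indicator_def)
        next
          case False
          then have "dist (s + h *\<^sub>R z) s < d" using r d by (simp add: dist_norm h_def field_simps)
          from d(2)[OF this] show ?thesis using False by (simp add: dist_norm)
        qed
      qed
      also have "\<dots> = e / 2 + G.prob {z. norm z \<ge> r} * (2 * B)"
        by (subst Bochner_Integration.integral_add)
           (auto simp: G.prob_space[simplified] G.emeasure_eq_measure intro!: integrable_mult_left integrable_real_indicator)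
      also have "\<dots> \<le> e" using tail by (simp add: mult.commute)
      finally show ?thesis by simp
    qed
    have "\<bar>Sm h K - (\<integral>x. g x \<partial>K)\<bar> \<le> e" if K: "prob_space K" "sets K = sets borel" for K
    proof -
      interpret K: prob_space K by fact
      note [measurable_cong] = K(2)
      have i1: "integrable K g" by (rule K.integrable_const_bound[where B=B]) (auto simp: bound)
      have b: "norm (\<integral>z. g (s + h *\<^sub>R z) \<partial>std_normal_vec) \<le> B + e" for s
        using close[of s] bound[of s] by auto
      have i2: "integrable K (\<lambda>s. \<integral>z. g (s + h *\<^sub>R z) \<partial>std_normal_vec)"
        by (rule K.integrable_const_bound[where B="B + e"]) (use b in auto)
      have "Sm h K - (\<integral>x. g x \<partial>K) = (\<integral>s. (\<integral>z. g (s + h *\<^sub>R z) \<partial>std_normal_vec) - g s \<partial>K)"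
        unfolding Sm_def using i1 i2 by simp
      also have "norm \<dots> \<le> (\<integral>s. e \<partial>K)"
        by (rule Bochner_Integration.integral_norm_bound_integral) (use i1 i2 close in auto)
      finally show ?thesis by (simp add: K.prob_space)
    qed
    then show ?thesis using h by blast
  qed
  show ?thesis
  proof (rule LIMSEQ_I)
    fix e :: real assume e: "e > 0"
    then obtain h where h: "h > 0"
      and cl: "\<And>K. prob_space K \<Longrightarrow> sets K = sets borel \<Longrightarrow> \<bar>Sm h K - (\<integral>x. g x \<partial>K)\<bar> \<le> e / 4"
      using Sm_close[of "e / 4"] by auto
    obtain n0 where n0: "\<And>n. n \<ge> n0 \<Longrightarrow> norm (Sm h (L n) - Sm h N) < e / 2"
      using LIMSEQ_D[OF Sm_tendsto[OF h], of "e / 2"] e by auto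
    have "norm ((\<integral>x. g x \<partial>L n) - (\<integral>x. g x \<partial>N)) < e" if "n \<ge> n0" for n
      using n0[OF that] cl[OF L, of n] cl[OF N] unfolding real_norm_def by linarith
    then show "\<exists>no. \<forall>n\<ge>no. norm ((\<integral>x. g x \<partial>L n) - (\<integral>x. g x \<partial>N)) < e" by blast
  qed
qed

text \<open>Tightness comes for free. A continuous cutoff carrying almost all the mass of
  \<open>N\<close> has compact support, so its integrals against \<open>L n\<close> converge to a
  value near 1. Replacing \<open>g\<close> by \<open>g\<close> times the cutoff then costs at most
  \<open>B\<close> times the missing mass, for \<open>N\<close> and for all late
  \<open>L n\<close>.\<close>

theorem levy_continuity_vec:
  fixes L :: "nat \<Rightarrow> (real ^ 'n) measure" and N :: "(real ^ 'n) measure"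
    and g :: "real ^ 'n \<Rightarrow> real"
  assumes L: "\<And>n. prob_space (L n)" "\<And>n. sets (L n) = sets borel"
    and N: "prob_space N" "sets N = sets borel"
    and char: "\<And>u. (\<lambda>n. \<integral>x. cis (u \<bullet> x) \<partial>L n) \<longlonglongrightarrow> (\<integral>x. cis (u \<bullet> x) \<partial>N)"
    and cont: "continuous_on UNIV g" and bounded: "bounded (range g)"
  shows "(\<lambda>n. \<integral>x. g x \<partial>L n) \<longlonglongrightarrow> (\<integral>x. g x \<partial>N)"
proof (rule LIMSEQ_I)
  fix e :: real assume e: "e > 0"
  note [measurable_cong] = L(2) N(2)
  interpret N: prob_space N by fact
  have gm[measurable]: "g \<in> borel_measurable borel"
    by (rule borel_measurable_continuous_onI[OF cont])
  obtain B where B: "B > 0" "\<And>x. \<bar>g x\<bar> \<le> B"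
    using bounded unfolding bounded_pos by auto
  define \<kappa> where "\<kappa> r x = max 0 (min 1 (r + 1 - norm x))" for r and x :: "real ^ 'n"
  have \<kappa>_cont: "continuous_on UNIV (\<kappa> r)" for r
    unfolding \<kappa>_def by (intro continuous_intros)
  have [measurable]: "\<kappa> r \<in> borel_measurable borel" for r
    by (rule borel_measurable_continuous_onI[OF \<kappa>_cont])
  have \<kappa>_range: "0 \<le> \<kappa> r x" "\<kappa> r x \<le> 1" for r x by (auto simp: \<kappa>_def)
  have \<kappa>_supp: "\<kappa> r x = 0" if "norm x > r + 1" for r x using that by (simp add: \<kappa>_def)
  have "(\<lambda>k. \<integral>x. \<kappa> (real k) x \<partial>N) \<longlonglongrightarrow> (\<integral>x. 1 \<partial>N)"
  proof (rule integral_dominated_convergence[where w="\<lambda>_. 1"])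
    show "AE x in N. (\<lambda>k. \<kappa> (real k) x) \<longlonglongrightarrow> 1"
    proof (rule AE_I2, rule tendsto_eventually)
      fix x :: "real ^ 'n"
      obtain k0 where "norm x \<le> real k0" using real_arch_simple by blast
      then show "\<forall>\<^sub>F k in sequentially. \<kappa> (real k) x = 1"
        by (intro eventually_sequentiallyI[of k0]) (simp add: \<kappa>_def)
    qed
  qed (use \<kappa>_range in auto)
  then have "(\<lambda>k. \<integral>x. \<kappa> (real k) x \<partial>N) \<longlonglongrightarrow> 1" by (simp add: N.prob_space)
  moreover have "1 - e / (4 * B) < 1" using e B by simp
  ultimately have "\<forall>\<^sub>F k in sequentially. 1 - e / (4 * B) < (\<integral>x. \<kappa> (real k) x \<partial>N)"
    by (rule order_tendstoD)
  then obtain k :: nat where k: "1 - e / (4 * B) < (\<integral>x. \<kappa> (real k) x \<partial>N)"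
    by (auto simp: eventually_sequentially)
  define \<eta> where "\<eta> = \<kappa> (real k)"
  have [measurable]: "\<eta> \<in> borel_measurable borel" by (simp add: \<eta>_def)
  have \<eta>: "0 \<le> \<eta> x" "\<eta> x \<le> 1" for x using \<kappa>_range by (auto simp: \<eta>_def)
  have t1: "(\<lambda>n. \<integral>x. \<eta> x \<partial>L n) \<longlonglongrightarrow> (\<integral>x. \<eta> x \<partial>N)"
    by (rule integral_tendsto_compact_support[OF L N char, where B=1 and R="real k + 1"])
       (use \<eta> \<kappa>_supp[of "real k"] \<kappa>_cont in \<open>auto simp: \<eta>_def\<close>)
  have t2: "(\<lambda>n. \<integral>x. g x * \<eta> x \<partial>L n) \<longlonglongrightarrow> (\<integral>x. g x * \<eta> x \<partial>N)"
  proof (rule integral_tendsto_compact_support[OF L N char, where B=B and R="real k + 1"])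
    show "continuous_on UNIV (\<lambda>x. g x * \<eta> x)"
      unfolding \<eta>_def by (intro continuous_intros cont \<kappa>_cont)
    show "\<bar>g x * \<eta> x\<bar> \<le> B" for x
      using mult_mono[OF B(2)[of x] \<eta>(2)[of x]] \<eta>[of x] B(1) by (simp add: abs_mult)
  qed (use \<kappa>_supp in \<open>auto simp: \<eta>_def\<close>)
  have cut: "\<bar>(\<integral>x. g x \<partial>K) - (\<integral>x. g x * \<eta> x \<partial>K)\<bar> \<le> B * (1 - (\<integral>x. \<eta> x \<partial>K))"
    if "prob_space K" "sets K = sets borel" for K
  proof -
    interpret K: prob_space K by fact
    note [measurable_cong] = that(2)
    have b: "\<bar>g x * \<eta> x\<bar> \<le> B" for x
      using mult_mono[OF B(2)[of x] \<eta>(2)[of x]] \<eta>[of x] B(1) by (simp add: abs_mult)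
    have i: "integrable K g" "integrable K (\<lambda>x. g x * \<eta> x)" "integrable K \<eta>"
      using B b \<eta> by (auto intro!: K.integrable_const_bound[where B="max B 1"] simp: le_max_iff_disj)
    have "(\<integral>x. g x \<partial>K) - (\<integral>x. g x * \<eta> x \<partial>K) = (\<integral>x. g x - g x * \<eta> x \<partial>K)"
      using i by simp
    also have "norm \<dots> \<le> (\<integral>x. B * (1 - \<eta> x) \<partial>K)"
    proof (rule Bochner_Integration.integral_norm_bound_integral)
      fix x :: "real ^ 'n"
      have "norm (g x - g x * \<eta> x) = \<bar>g x\<bar> * (1 - \<eta> x)"
        using \<eta>[of x] by (simp add: abs_mult flip: right_diff_distrib[of "g x" 1, simplified])
      also have "\<dots> \<le> B * (1 - \<eta> x)" using B \<eta>[of x] by (intro mult_right_mono) auto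
      finally show "norm (g x - g x * \<eta> x) \<le> B * (1 - \<eta> x)" .
    qed (use i in auto)
    also have "\<dots> = B * (1 - (\<integral>x. \<eta> x \<partial>K))"
      using i by (simp add: K.prob_space)
    finally show ?thesis by simp
  qed
  have kN: "1 - (\<integral>x. \<eta> x \<partial>N) < e / (4 * B)" using k by (simp add: \<eta>_def)
  have "\<forall>\<^sub>F n in sequentially. 1 - e / (4 * B) < (\<integral>x. \<eta> x \<partial>L n)"
    using t1 k unfolding \<eta>_def by (rule order_tendstoD)
  moreover have "\<forall>\<^sub>F n in sequentially. dist (\<integral>x. g x * \<eta> x \<partial>L n) (\<integral>x. g x * \<eta> x \<partial>N) < e / 2"
    using t2 e by (intro tendstoD) auto
  ultimately have "\<forall>\<^sub>F n in sequentially. norm ((\<integral>x. g x \<partial>L n) - (\<integral>x. g x \<partial>N)) < e"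
  proof eventually_elim
    case (elim n)
    have "B * (1 - (\<integral>x. \<eta> x \<partial>L n)) < e / 4" "B * (1 - (\<integral>x. \<eta> x \<partial>N)) < e / 4"
      using elim(1) kN B(1) by (simp_all add: field_simps)
    with cut[OF L, of n] cut[OF N] elim(2) show ?case
      unfolding dist_real_def real_norm_def by linarith
  qed
  then show "\<exists>no. \<forall>n\<ge>no. norm ((\<integral>x. g x \<partial>L n) - (\<integral>x. g x \<partial>N)) < e"
    by (simp add: eventually_sequentially)
qed

section \<open>Functions of polynomial growth\<close>

lemma power_le_one_add_power:
  fixes x :: real
  assumes "0 \<le> x" "m \<le> p"
  shows "x ^ m \<le> 1 + x ^ p"
proof (cases "x \<le> 1")
  case True
  then have "x ^ m \<le> 1" using assms by (simp add: power_le_one)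
  then show ?thesis using assms by (simp add: add_increasing2)
next
  case False
  then have "x ^ m \<le> x ^ p" using assms by (intro power_increasing) auto
  then show ?thesis by simp
qed

lemma one_add_power_le:
  fixes x :: real
  assumes "0 \<le> x"
  shows "(1 + x) ^ m \<le> 2 ^ m * (1 + x ^ m)"
proof -
  have "(1 + x) ^ m \<le> (2 * max 1 x) ^ m" using assms by (intro power_mono) auto
  also have "\<dots> = 2 ^ m * max 1 x ^ m" by (simp add: power_mult_distrib)
  also have "max 1 x ^ m \<le> 1 + x ^ m" using assms by (auto simp: max_def)
  finally show ?thesis by simp
qed

lemma C_polI:
  assumes "continuous_on UNIV f" "c \<ge> 0" "\<And>x. \<bar>f x\<bar> \<le> c * (1 + norm x ^ m)"
  shows "f \<in> C_pol"
  using assms unfolding C_pol_def by blast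

lemma C_polE:
  assumes "f \<in> C_pol"
  obtains c m where "c \<ge> 0" "\<And>x. \<bar>f x\<bar> \<le> c * (1 + norm x ^ m)"
  using assms unfolding C_pol_def by blast

lemma C_pol_continuous: "f \<in> C_pol \<Longrightarrow> continuous_on UNIV f"
  unfolding C_pol_def by blast

lemma C_pol_measurable: "f \<in> C_pol \<Longrightarrow> f \<in> borel_measurable borel"
  by (rule borel_measurable_continuous_onI[OF C_pol_continuous])

lemma C_pol_add:
  fixes f g :: "'a::real_normed_vector \<Rightarrow> real"
  assumes "f \<in> C_pol" "g \<in> C_pol"
  shows "(\<lambda>x. f x + g x) \<in> C_pol"
proof -
  from assms(1) obtain c m where c: "c \<ge> 0" "\<And>x. \<bar>f x\<bar> \<le> c * (1 + norm x ^ m)" by (rule C_polE) blast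
  from assms(2) obtain d p where d: "d \<ge> 0" "\<And>x. \<bar>g x\<bar> \<le> d * (1 + norm x ^ p)" by (rule C_polE) blast
  show ?thesis
  proof (rule C_polI)
    show "continuous_on UNIV (\<lambda>x. f x + g x)"
      using assms by (intro continuous_intros C_pol_continuous)
    fix x :: 'a
    have le: "1 + norm x ^ k \<le> 2 * (1 + norm x ^ q)" if "k \<le> q" for k q
      using power_le_one_add_power[OF norm_ge_zero that, of x] zero_le_power[OF norm_ge_zero, of x q]
      by argo
    have "\<bar>f x\<bar> \<le> c * (2 * (1 + norm x ^ max m p))"
      using c(1) by (intro order_trans[OF c(2)] mult_left_mono le) auto
    moreover have "\<bar>g x\<bar> \<le> d * (2 * (1 + norm x ^ max m p))"
      using d(1) by (intro order_trans[OF d(2)] mult_left_mono le) auto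
    ultimately show "\<bar>f x + g x\<bar> \<le> (2 * (c + d)) * (1 + norm x ^ max m p)"
      by (simp add: algebra_simps)
  qed (use c d in auto)
qed

lemma C_pol_mult:
  fixes f g :: "'a::real_normed_vector \<Rightarrow> real"
  assumes "f \<in> C_pol" "g \<in> C_pol"
  shows "(\<lambda>x. f x * g x) \<in> C_pol"
proof -
  from assms(1) obtain c m where c: "c \<ge> 0" "\<And>x. \<bar>f x\<bar> \<le> c * (1 + norm x ^ m)" by (rule C_polE) blast
  from assms(2) obtain d p where d: "d \<ge> 0" "\<And>x. \<bar>g x\<bar> \<le> d * (1 + norm x ^ p)" by (rule C_polE) blast
  show ?thesis
  proof (rule C_polI)
    show "continuous_on UNIV (\<lambda>x. f x * g x)"
      using assms by (intro continuous_intros C_pol_continuous)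
    fix x :: 'a
    let ?n = "norm x"
    have "\<bar>f x * g x\<bar> \<le> (c * (1 + ?n ^ m)) * (d * (1 + ?n ^ p))"
      unfolding abs_mult using c d by (intro mult_mono) auto
    also have "\<dots> = (c * d) * (1 + ?n ^ m + ?n ^ p + ?n ^ (m + p))"
      by (simp add: algebra_simps power_add)
    also have "\<dots> \<le> (c * d) * (3 * (1 + ?n ^ (m + p)))"
      using power_le_one_add_power[of ?n m "m + p"] power_le_one_add_power[of ?n p "m + p"] c(1) d(1)
      by (intro mult_left_mono) auto
    finally show "\<bar>f x * g x\<bar> \<le> (3 * c * d) * (1 + ?n ^ (m + p))" by (simp add: algebra_simps)
  qed (use c d in auto)
qed

lemma C_pol_const: "(\<lambda>_. k) \<in> C_pol"
  by (rule C_polI[of _ "\<bar>k\<bar>" 0]) (auto simp: algebra_simps)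

lemma C_pol_cmult: "f \<in> C_pol \<Longrightarrow> (\<lambda>x. k * f x) \<in> C_pol"
  by (intro C_pol_mult C_pol_const)

lemma C_pol_diff:
  assumes "f \<in> C_pol" "g \<in> C_pol"
  shows "(\<lambda>x. f x - g x) \<in> C_pol"
  using C_pol_add[OF assms(1) C_pol_cmult[OF assms(2), of "-1"]] by simp

lemma C_pol_sum:
  assumes "\<And>i. i \<in> I \<Longrightarrow> f i \<in> C_pol"
  shows "(\<lambda>x. \<Sum>i\<in>I. f i x) \<in> C_pol"
  using assms by (induction I rule: infinite_finite_induct) (auto intro: C_pol_const C_pol_add)

lemma C_pol_power: "f \<in> C_pol \<Longrightarrow> (\<lambda>x. f x ^ k) \<in> C_pol"
  by (induction k) (auto intro: C_pol_const C_pol_mult)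

lemma C_pol_abs: "f \<in> C_pol \<Longrightarrow> (\<lambda>x. \<bar>f x\<bar>) \<in> C_pol"
  unfolding C_pol_def by (auto intro!: continuous_intros)

lemma C_pol_norm: "norm \<in> C_pol"
  by (rule C_polI[of _ 1 1]) (auto intro!: continuous_intros)

lemma C_pol_comp:
  fixes f :: "'a::real_normed_vector \<Rightarrow> real" and g :: "'b::real_normed_vector \<Rightarrow> 'a"
  assumes f: "f \<in> C_pol" and g: "continuous_on UNIV g" "\<And>x. norm (g x) \<le> K * (1 + norm x)"
  shows "(\<lambda>x. f (g x)) \<in> C_pol"
proof -
  from f obtain c m where c: "c \<ge> 0" "\<And>x. \<bar>f x\<bar> \<le> c * (1 + norm x ^ m)" by (rule C_polE) blast
  have K: "K \<ge> 0" using order_trans[OF norm_ge_zero g(2)[of 0]] by simp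
  show ?thesis
  proof (rule C_polI)
    show "continuous_on UNIV (\<lambda>x. f (g x))"
      by (rule continuous_on_compose2[OF C_pol_continuous[OF f] g(1)]) auto
    fix x
    have "norm (g x) ^ m \<le> (K * (1 + norm x)) ^ m"
      by (intro power_mono g) auto
    also have "\<dots> \<le> K ^ m * (2 ^ m * (1 + norm x ^ m))"
      unfolding power_mult_distrib using K by (intro mult_left_mono one_add_power_le) auto
    finally have "\<bar>f (g x)\<bar> \<le> c * (1 + K ^ m * (2 ^ m * (1 + norm x ^ m)))"
      using c(1) by (intro order_trans[OF c(2)] mult_left_mono) auto
    also have "\<dots> \<le> c * ((1 + K ^ m * 2 ^ m) * (1 + norm x ^ m))"
      using c(1) by (intro mult_left_mono) (auto simp: algebra_simps)
    finally show "\<bar>f (g x)\<bar> \<le> (c * (1 + K ^ m * 2 ^ m)) * (1 + norm x ^ m)"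
      by (simp add: mult.assoc)
  qed (use c K in auto)
qed

lemma C_pol_bounded_linear_comp:
  assumes "f \<in> C_pol" "bounded_linear g"
  shows "(\<lambda>x. f (g x)) \<in> C_pol"
proof -
  interpret g: bounded_linear g by fact
  obtain K where K: "K > 0" "\<And>x. norm (g x) \<le> norm x * K" using g.pos_bounded by blast
  have "norm (g x) \<le> K * (1 + norm x)" for x
    using K(2)[of x] K(1) by (simp add: algebra_simps)
  then show ?thesis
    by (intro C_pol_comp[OF assms(1)] linear_continuous_on assms(2))
qed

section \<open>Moments of normal vectors\<close>

lemma integrable_power_std_normal_vec:
  "integrable (std_normal_vec :: (real ^ 'n) measure) (\<lambda>z. norm z ^ m)"
proof -
  have 1: "integrable lborel (\<lambda>x. std_normal_density x * (1 + \<bar>x\<bar>) ^ m)"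
  proof (rule Bochner_Integration.integrable_bound)
    show "integrable lborel (\<lambda>x. 2 ^ m * (std_normal_density x * \<bar>x - 0\<bar> ^ 0 + std_normal_density x * \<bar>x - 0\<bar> ^ m))"
      by (intro integrable_mult_right Bochner_Integration.integrable_add integrable_normal_moment_abs) auto
    show "AE x in lborel. norm (std_normal_density x * (1 + \<bar>x\<bar>) ^ m)
        \<le> norm (2 ^ m * (std_normal_density x * \<bar>x - 0\<bar> ^ 0 + std_normal_density x * \<bar>x - 0\<bar> ^ m))"
    proof (rule AE_I2)
      fix x :: real
      have "std_normal_density x * (1 + \<bar>x\<bar>) ^ m \<le> std_normal_density x * (2 ^ m * (1 + \<bar>x\<bar> ^ m))"
        by (intro mult_left_mono one_add_power_le) auto
      then show "norm (std_normal_density x * (1 + \<bar>x\<bar>) ^ m)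
        \<le> norm (2 ^ m * (std_normal_density x * \<bar>x - 0\<bar> ^ 0 + std_normal_density x * \<bar>x - 0\<bar> ^ m))"
        by (simp add: algebra_simps)
    qed
  qed measurable
  \<comment> \<open>Bounds \<open>norm z\<close> by a product over the coordinates, so that the
    density times a power of the norm is dominated by a product of one-dimensional integrable
    functions.\<close>
  have prod_ge: "1 + (\<Sum>i\<in>I. \<bar>z $ i\<bar>) \<le> (\<Prod>i\<in>I. 1 + \<bar>z $ i\<bar>)" if "finite I" for z :: "real ^ 'n" and I
    using that
  proof (induction I)
    case (insert i I)
    have "1 + (\<Sum>i\<in>insert i I. \<bar>z $ i\<bar>) \<le> (1 + \<bar>z $ i\<bar>) * (1 + (\<Sum>i\<in>I. \<bar>z $ i\<bar>))"
      using insert by (simp add: algebra_simps sum_nonneg)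
    also have "\<dots> \<le> (1 + \<bar>z $ i\<bar>) * (\<Prod>i\<in>I. 1 + \<bar>z $ i\<bar>)"
      by (intro mult_left_mono insert.IH) auto
    finally show ?case using insert by simp
  qed simp
  have "integrable lborel (\<lambda>z :: real ^ 'n. std_normal_vec_density z * norm z ^ m)"
  proof (rule Bochner_Integration.integrable_bound)
    show "integrable lborel (\<lambda>z :: real ^ 'n. \<Prod>i\<in>UNIV. std_normal_density (z $ i) * (1 + \<bar>z $ i\<bar>) ^ m)"
      by (rule integrable_lborel_vec_prod[OF 1])
    show "AE z :: real ^ 'n in lborel. norm (std_normal_vec_density z * norm z ^ m)
      \<le> norm (\<Prod>i\<in>UNIV. std_normal_density (z $ i) * (1 + \<bar>z $ i\<bar>) ^ m)"
    proof (rule AE_I2)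
      fix z :: "real ^ 'n"
      have "norm z \<le> (\<Prod>i\<in>UNIV. 1 + \<bar>z $ i\<bar>)"
        using norm_le_l1_cart[of z] prod_ge[of UNIV z] by simp
      then have "std_normal_vec_density z * norm z ^ m \<le> std_normal_vec_density z * (\<Prod>i\<in>UNIV. 1 + \<bar>z $ i\<bar>) ^ m"
        by (intro mult_left_mono power_mono std_normal_vec_density_nonneg) auto
      then show "norm (std_normal_vec_density z * norm z ^ m)
        \<le> norm (\<Prod>i\<in>UNIV. std_normal_density (z $ i) * (1 + \<bar>z $ i\<bar>) ^ m)"
        by (simp add: prod.distrib std_normal_vec_density_nonneg abs_mult prod_power_distrib prod_nonneg
            flip: std_normal_vec_density_def)
    qed
  qed measurable
  then show ?thesis
    unfolding std_normal_vec_eq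
    by (subst integrable_density) (auto simp: std_normal_vec_density_nonneg)
qed

lemma integrable_C_pol:
  assumes "finite_measure N" "sets N = sets borel" "\<And>m. integrable N (\<lambda>x. norm x ^ m)" "f \<in> C_pol"
  shows "integrable N f"
proof -
  interpret finite_measure N by fact
  note [measurable_cong] = assms(2)
  from assms(4) obtain c m where c: "c \<ge> 0" "\<And>x. \<bar>f x\<bar> \<le> c * (1 + norm x ^ m)" by (rule C_polE) blast
  have "integrable N (\<lambda>x. c * (1 + norm x ^ m))"
    by (intro integrable_mult_right Bochner_Integration.integrable_add assms(3) integrable_const)
  moreover have "f \<in> borel_measurable N"
    using C_pol_measurable[OF assms(4)] by (simp add: measurable_def sets_eq_imp_space_eq[OF assms(2)] assms(2))
  moreover have "norm (f x) \<le> norm (c * (1 + norm x ^ m))" for x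
    using c(2)[of x] c(1) by (simp add: abs_mult)
  ultimately show ?thesis
    by (intro Bochner_Integration.integrable_bound[of N "\<lambda>x. c * (1 + norm x ^ m)" f]) auto
qed

lemma integrable_C_pol_multi_normal:
  assumes f: "f \<in> C_pol"
  shows "integrable (multi_normal m S) f"
proof -
  note [measurable] = C_pol_measurable[OF f]
  interpret prob_space "std_normal_vec :: (real ^ 'a) measure" by (rule prob_space_std_normal_vec)
  define A where "A = (SOME A :: real ^ 'a ^ 'a. A ** transpose A = S)"
  have bl: "bounded_linear ((*v) A)" by (rule matrix_vector_mul_bounded_linear)
  then interpret A: bounded_linear "(*v) A" .
  obtain K where K: "K > 0" "\<And>x. norm (A *v x) \<le> norm x * K" using A.pos_bounded by blast
  have "norm (m + A *v x) \<le> (norm m + K) * (1 + norm x)" for x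
  proof -
    have "norm (m + A *v x) \<le> norm m + norm x * K"
      using K(2)[of x] norm_triangle_ineq[of m "A *v x"] by linarith
    also have "\<dots> \<le> (norm m + K) * (1 + norm x)" using K(1) by (simp add: algebra_simps)
    finally show ?thesis .
  qed
  then have "(\<lambda>x. f (m + A *v x)) \<in> C_pol"
    by (intro C_pol_comp[OF f] continuous_intros linear_continuous_on bl)
  then have "integrable std_normal_vec (\<lambda>x. f (m + A *v x))"
    by (rule integrable_C_pol[OF finite_measure_axioms sets_std_normal_vec integrable_power_std_normal_vec])
  then show ?thesis
    unfolding multi_normal_def Let_def A_def[symmetric]
    by (subst integrable_distr_eq) auto
qed

section \<open>One-dimensional marginals of the noise\<close>

lemma char_normal:
  assumes "\<sigma> > 0"
  shows "char (density lborel (normal_density 0 \<sigma>)) t = of_real (exp (- (\<sigma> * t)\<^sup>2 / 2))"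
proof -
  interpret prob_space std_normal_distribution by (rule prob_space_normal_density) simp
  have "distributed std_normal_distribution lborel (\<lambda>x. x) std_normal_density"
    by (simp add: distributed_def distr_id2)
  then have "distributed std_normal_distribution lborel (\<lambda>x. 0 + \<sigma> * x) (normal_density (0 + \<sigma> * 0) (\<bar>\<sigma>\<bar> * 1))"
    using assms by (intro normal_density_affine) auto
  then have "distr std_normal_distribution lborel (\<lambda>x. \<sigma> * x) = density lborel (normal_density 0 \<sigma>)"
    using assms by (simp add: distributed_def)
  moreover have "distr std_normal_distribution lborel (\<lambda>x. \<sigma> * x) = distr std_normal_distribution borel (\<lambda>x. \<sigma> * x)"
    by (rule distr_cong) auto
  ultimately have "char (density lborel (normal_density 0 \<sigma>)) t
      = char (distr std_normal_distribution borel (\<lambda>x. \<sigma> * x)) t" by simp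
  also have "\<dots> = char std_normal_distribution (\<sigma> * t)"
    by (simp add: char_def integral_distr mult.assoc mult.left_commute)
  finally have "char (density lborel (normal_density 0 \<sigma>)) t = char std_normal_distribution (\<sigma> * t)" .
  then show ?thesis by (simp add: char_std_normal_distribution)
qed

lemma multi_normal_marginal:
  fixes S :: "real ^ 'n ^ 'n"
  assumes S: "transpose S = S" "\<And>u. 0 \<le> u \<bullet> (S *v u)" and "\<sigma> > 0" "S $ i $ i = \<sigma>\<^sup>2"
  shows "distr (multi_normal 0 S) borel (\<lambda>w. w $ i) = density lborel (normal_density 0 \<sigma>)"
proof (rule Levy_uniqueness)
  interpret prob_space "multi_normal 0 S" by (rule prob_space_multi_normal)
  show "real_distribution (distr (multi_normal 0 S) borel (\<lambda>w. w $ i))"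
    by (rule real_distribution_distr) measurable
  show "real_distribution (density lborel (normal_density 0 \<sigma>))"
    using \<open>\<sigma> > 0\<close> by (auto simp: real_distribution_def real_distribution_axioms_def intro: prob_space_normal_density)
  show "char (distr (multi_normal 0 S) borel (\<lambda>w. w $ i)) = char (density lborel (normal_density 0 \<sigma>))"
  proof
    fix t
    have "char (distr (multi_normal 0 S) borel (\<lambda>w. w $ i)) t = (\<integral>w. cis (axis i t \<bullet> w) \<partial>multi_normal 0 S)"
      by (simp add: char_def integral_distr cis_conv_exp inner_axis')
    also have "\<dots> = of_real (exp (- (axis i t \<bullet> (S *v axis i t)) / 2))"
      by (simp add: integral_cis_multi_normal[OF S])
    also have "axis i t \<bullet> (S *v axis i t) = (\<sigma> * t)\<^sup>2"
    proof -
      have "axis i t = t *\<^sub>R axis i 1" by (simp add: vec_eq_iff axis_def)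
      then show ?thesis
        using assms(4) by (simp add: matrix_vector_mult_scaleR matrix_vector_mult_basis inner_axis' column_def power2_eq_square)
    qed
    finally show "char (distr (multi_normal 0 S) borel (\<lambda>w. w $ i)) t = char (density lborel (normal_density 0 \<sigma>)) t"
      by (simp add: char_normal[OF \<open>\<sigma> > 0\<close>])
  qed
qed

lemma noise_cov_psd:
  assumes "\<rho> \<in> {-1<..<1}"
  shows "transpose (noise_cov \<sigma> \<rho>) = noise_cov \<sigma> \<rho>" "0 \<le> u \<bullet> (noise_cov \<sigma> \<rho> *v u)"
proof -
  show "transpose (noise_cov \<sigma> \<rho>) = noise_cov \<sigma> \<rho>"
    by (simp add: noise_cov_def transpose_def vec_eq_iff forall_2)
  have "u \<bullet> (noise_cov \<sigma> \<rho> *v u) = \<sigma>\<^sup>2 * ((u $ 1 + \<rho> * u $ 2)\<^sup>2 + (1 - \<rho>\<^sup>2) * (u $ 2)\<^sup>2)"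
    by (simp add: noise_cov_def inner_vec_def matrix_vector_mult_def sum_2 power2_eq_square algebra_simps)
  moreover have "\<rho>\<^sup>2 \<le> 1" using assms by (simp add: abs_square_le_1 abs_le_iff)
  ultimately show "0 \<le> u \<bullet> (noise_cov \<sigma> \<rho> *v u)" by simp
qed

text \<open>Links the two descriptions of the model: \<open>bar_Q\<close> is given by
  one-dimensional normal densities, the noise pairs as images of a standard normal vector.\<close>

lemma noise_marginal:
  assumes "\<sigma> > 0" "\<rho> \<in> {-1<..<1}"
  shows "distr (multi_normal 0 (noise_cov \<sigma> \<rho>)) borel (\<lambda>w. w $ i) = density lborel (normal_density 0 \<sigma>)"
  by (rule multi_normal_marginal[OF noise_cov_psd[OF assms(2)] assms(1)])
     (use exhaust_2[of i] in \<open>auto simp: noise_cov_def\<close>)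

section \<open>Integrating out an independent variable\<close>

context prob_space
begin

text \<open>The identity map, viewed as a variable with values in \<open>F\<close>, carries exactly
  the information of \<open>F\<close>. Independence of \<open>Y\<close> from \<open>F\<close> thus
  becomes a product law for the pair, without naming variables that generate
  \<open>F\<close>.\<close>

lemma distr_pair_independent:
  assumes F: "subalgebra M F" and Y[measurable]: "Y \<in> measurable M N"
    and indep: "\<And>A B. A \<in> sets F \<Longrightarrow> B \<in> sets N \<Longrightarrow>
      prob (A \<inter> (Y -` B \<inter> space M)) = prob A * prob (Y -` B \<inter> space M)"
  shows "distr M (F \<Otimes>\<^sub>M N) (\<lambda>\<omega>. (\<omega>, Y \<omega>)) = restr_to_subalg M F \<Otimes>\<^sub>M distr M N Y"
proof (rule pair_measure_eqI[symmetric])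
  have [measurable]: "(\<lambda>\<omega>. \<omega>) \<in> measurable M F"
    using F by (auto simp: measurable_def subalgebra_def)
  interpret R: prob_space "restr_to_subalg M F" by (rule prob_space_restr_to_subalg[OF F prob_space_axioms])
  interpret N: prob_space "distr M N Y" by (rule prob_space_distr) measurable
  show "sigma_finite_measure (restr_to_subalg M F)" by (rule R.sigma_finite_measure_axioms)
  show "sigma_finite_measure (distr M N Y)" by (rule N.sigma_finite_measure_axioms)
  show "sets (restr_to_subalg M F \<Otimes>\<^sub>M distr M N Y) = sets (distr M (F \<Otimes>\<^sub>M N) (\<lambda>\<omega>. (\<omega>, Y \<omega>)))"
    by (simp add: sets_pair_measure_cong[OF sets_restr_to_subalg[OF F]])
  fix A B assume "A \<in> sets (restr_to_subalg M F)" "B \<in> sets (distr M N Y)"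
  then have AB[measurable]: "A \<in> sets F" "B \<in> sets N" by (auto simp: sets_restr_to_subalg[OF F])
  have AM: "A \<in> events" using AB F by (auto simp: subalgebra_def)
  have "emeasure (distr M (F \<Otimes>\<^sub>M N) (\<lambda>\<omega>. (\<omega>, Y \<omega>))) (A \<times> B) = emeasure M (A \<inter> (Y -` B \<inter> space M))"
    using sets.sets_into_space[OF AM] by (subst emeasure_distr) (auto intro!: arg_cong[where f="emeasure M"])
  also have "\<dots> = emeasure M A * emeasure M (Y -` B \<inter> space M)"
    using AM by (simp add: emeasure_eq_measure indep AB flip: ennreal_mult)
  finally show "emeasure (restr_to_subalg M F) A * emeasure (distr M N Y) B =
      emeasure (distr M (F \<Otimes>\<^sub>M N) (\<lambda>\<omega>. (\<omega>, Y \<omega>))) (A \<times> B)"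
    by (simp add: emeasure_restr_to_subalg[OF F] emeasure_distr AB)
qed

text \<open>Takes the place of conditional expectation given \<open>F\<close>: by Fubini for the
  product law, the \<open>F\<close>-measurable part is frozen while \<open>Y\<close> is integrated
  out.\<close>

lemma
  fixes G :: "'a \<times> 'b \<Rightarrow> 'c::{banach, second_countable_topology}"
  assumes F: "subalgebra M F" and Y[measurable]: "Y \<in> measurable M N"
    and indep: "\<And>A B. A \<in> sets F \<Longrightarrow> B \<in> sets N \<Longrightarrow>
      prob (A \<inter> (Y -` B \<inter> space M)) = prob A * prob (Y -` B \<inter> space M)"
    and G[measurable]: "G \<in> borel_measurable (F \<Otimes>\<^sub>M N)"
    and int: "integrable M (\<lambda>\<omega>. G (\<omega>, Y \<omega>))"
  shows integral_independent: "(\<integral>\<omega>. G (\<omega>, Y \<omega>) \<partial>M) = (\<integral>\<omega>. (\<integral>y. G (\<omega>, y) \<partial>distr M N Y) \<partial>M)"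
    and integrable_independent: "integrable M (\<lambda>\<omega>. \<integral>y. G (\<omega>, y) \<partial>distr M N Y)"
proof -
  have [measurable]: "(\<lambda>\<omega>. \<omega>) \<in> measurable M F"
    using F by (auto simp: measurable_def subalgebra_def)
  interpret R: prob_space "restr_to_subalg M F" by (rule prob_space_restr_to_subalg[OF F prob_space_axioms])
  interpret N: prob_space "distr M N Y" by (rule prob_space_distr) measurable
  interpret P: pair_prob_space "restr_to_subalg M F" "distr M N Y" ..
  note law = distr_pair_independent[OF F Y indep]
  have Gi: "integrable (restr_to_subalg M F \<Otimes>\<^sub>M distr M N Y) G"
    using int by (simp flip: law add: integrable_distr_eq)
  have m: "(\<lambda>\<omega>. \<integral>y. G (\<omega>, y) \<partial>distr M N Y) \<in> borel_measurable F"
    by measurable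
  have "(\<integral>\<omega>. G (\<omega>, Y \<omega>) \<partial>M) = (\<integral>x. G x \<partial>(restr_to_subalg M F \<Otimes>\<^sub>M distr M N Y))"
    by (simp flip: law add: integral_distr)
  also have "\<dots> = (\<integral>\<omega>. (\<integral>y. G (\<omega>, y) \<partial>distr M N Y) \<partial>restr_to_subalg M F)"
    by (rule P.integral_fst'[OF Gi, symmetric])
  also have "\<dots> = (\<integral>\<omega>. (\<integral>y. G (\<omega>, y) \<partial>distr M N Y) \<partial>M)"
    by (rule integral_subalgebra2[OF F m])
  finally show "(\<integral>\<omega>. G (\<omega>, Y \<omega>) \<partial>M) = (\<integral>\<omega>. (\<integral>y. G (\<omega>, y) \<partial>distr M N Y) \<partial>M)" .
  show "integrable M (\<lambda>\<omega>. \<integral>y. G (\<omega>, y) \<partial>distr M N Y)"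
    by (rule integrable_from_subalg[OF F P.integrable_fst'[OF Gi]])
qed

text \<open>The preceding rule for the two-valued variable that records whether \<open>E\<close>
  occurs. Values in a Banach space are allowed because both characteristic functions and real
  moments will be averaged over the permutation.\<close>

lemma integral_indicator_independent:
  fixes g :: "'a \<Rightarrow> 'c::{banach, second_countable_topology}"
  assumes F: "subalgebra M F" and E: "E \<in> events"
    and indep: "\<And>A. A \<in> sets F \<Longrightarrow> prob (A \<inter> E) = prob A * prob E"
    and g[measurable]: "g \<in> borel_measurable F" and int: "integrable M g"
  shows "(\<integral>\<omega>. indicator E \<omega> *\<^sub>R g \<omega> \<partial>M) = prob E *\<^sub>R (\<integral>\<omega>. g \<omega> \<partial>M)"
proof -
  let ?Y = "\<lambda>\<omega>. \<omega> \<in> E" and ?N = "count_space UNIV :: bool measure"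
  have Y[measurable]: "?Y \<in> measurable M ?N" using E by measurable
  \<comment> \<open>Independence is given for \<open>E\<close> alone; the other sets of truth values
    yield the empty set, the complement of \<open>E\<close> and the whole space.\<close>
  have ind: "prob (A \<inter> (?Y -` B \<inter> space M)) = prob A * prob (?Y -` B \<inter> space M)" if A: "A \<in> sets F" for A B
  proof -
    have AM: "A \<in> events" using A F by (auto simp: subalgebra_def)
    have "B \<in> Pow UNIV" by simp
    then consider "B = {}" | "B = {True}" | "B = {False}" | "B = UNIV"
      unfolding UNIV_bool Pow_insert Pow_empty by auto
    then show ?thesis
    proof cases
      case 2
      then have "?Y -` B \<inter> space M = E" using sets.sets_into_space[OF E] by auto
      then show ?thesis using indep[OF A] by simp
    next
      case 3
      then have "?Y -` B \<inter> space M = space M - E" "A \<inter> (space M - E) = A - E"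
        using sets.sets_into_space[OF AM] by auto
      then show ?thesis
        using AM E by (simp add: finite_measure_Diff' indep[OF A] prob_compl prob_space algebra_simps)
    next
      case 4
      then show ?thesis using sets.sets_into_space[OF AM] by (simp add: Int_absorb2 prob_space)
    qed simp
  qed
  have "(\<integral>\<omega>. indicator E \<omega> *\<^sub>R g \<omega> \<partial>M)
      = (\<integral>\<omega>. (\<lambda>p. (if snd p then 1 else 0) *\<^sub>R g (fst p)) (\<omega>, ?Y \<omega>) \<partial>M)"
    by (intro Bochner_Integration.integral_cong) (auto simp: indicator_def)
  also have "\<dots> = (\<integral>\<omega>. (\<integral>b. (\<lambda>p. (if snd p then 1 else 0) *\<^sub>R g (fst p)) (\<omega>, b) \<partial>distr M ?N ?Y) \<partial>M)"
  proof (rule integral_independent[OF F Y ind])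
    have "integrable M (\<lambda>\<omega>. indicator E \<omega> *\<^sub>R g \<omega>)"
      by (rule integrable_mult_indicator[OF E int])
    then show "integrable M (\<lambda>\<omega>. (\<lambda>p. (if snd p then 1 else 0) *\<^sub>R g (fst p)) (\<omega>, ?Y \<omega>))"
      by (simp add: indicator_def of_bool_def)
    have "(\<lambda>p. g (fst p)) \<in> borel_measurable (F \<Otimes>\<^sub>M ?N)"
      by (rule measurable_compose[OF measurable_fst g])
    moreover have "snd \<in> measurable (F \<Otimes>\<^sub>M ?N) ?N" by (rule measurable_snd)
    ultimately show "(\<lambda>p. (if snd p then 1 else 0) *\<^sub>R g (fst p)) \<in> borel_measurable (F \<Otimes>\<^sub>M ?N)"
      by (intro borel_measurable_scaleR measurable_If borel_measurable_const) auto
  qed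
  also have "\<dots> = (\<integral>\<omega>. (\<integral>\<omega>'. indicator E \<omega>' *\<^sub>R g \<omega> \<partial>M) \<partial>M)"
  proof (rule Bochner_Integration.integral_cong[OF refl])
    fix \<omega>
    have "(\<integral>b. (\<lambda>p. (if snd p then 1 else 0) *\<^sub>R g (fst p)) (\<omega>, b) \<partial>distr M ?N ?Y)
      = (\<integral>\<omega>'. (if \<omega>' \<in> E then 1 else 0) *\<^sub>R g \<omega> \<partial>M)"
      by (subst integral_distr) auto
    also have "\<dots> = (\<integral>\<omega>'. indicator E \<omega>' *\<^sub>R g \<omega> \<partial>M)"
      by (intro Bochner_Integration.integral_cong) (auto simp: indicator_def)
    finally show "(\<integral>b. (\<lambda>p. (if snd p then 1 else 0) *\<^sub>R g (fst p)) (\<omega>, b) \<partial>distr M ?N ?Y)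
      = (\<integral>\<omega>'. indicator E \<omega>' *\<^sub>R g \<omega> \<partial>M)" .
  qed
  also have "\<dots> = prob E *\<^sub>R (\<integral>\<omega>. g \<omega> \<partial>M)"
  proof -
    have "(\<integral>\<omega>'. indicator E \<omega>' *\<^sub>R c \<partial>M) = prob E *\<^sub>R c" for c :: 'c
      using E sets.sets_into_space[OF E]
      by (subst integral_scaleR_left) (auto simp: Int_absorb2 emeasure_eq_measure intro!: integrable_real_indicator)
    then show ?thesis by simp
  qed
  finally show ?thesis .
qed

end

section \<open>The filtration of the BAR model\<close>

lemma Int_stable_preimages: "Int_stable {f -` B \<inter> S | B. B \<in> sets N}"
proof (rule Int_stableI, clarify)
  fix B C assume "B \<in> sets N" "C \<in> sets N"
  then show "\<exists>D. (f -` B \<inter> S) \<inter> (f -` C \<inter> S) = f -` D \<inter> S \<and> D \<in> sets N"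
    by (intro exI[of _ "B \<inter> C"]) auto
qed

lemma borel_measurable_vec_nth [measurable (raw)]:
  fixes f :: "'a \<Rightarrow> real ^ 'n"
  assumes "f \<in> borel_measurable N"
  shows "(\<lambda>x. f x $ i) \<in> borel_measurable N"
proof -
  have "(\<lambda>v :: real ^ 'n. v $ i) \<in> borel_measurable borel"
    by (intro borel_measurable_continuous_onI continuous_intros)
  from measurable_compose[OF assms this] show ?thesis .
qed

context bar_model
begin

definition W :: "nat \<Rightarrow> 'w \<Rightarrow> real ^ 2" where
  "W n \<omega> = vector [\<epsilon> (2 * n) \<omega>, \<epsilon> (2 * n + 1) \<omega>]"

definition \<nu>0 :: "(real ^ 2) measure" where
  "\<nu>0 = multi_normal 0 (noise_cov \<sigma> \<rho>)"

text \<open>Index 0 stands for the ancestor and index \<open>i\<close> from 1 on for the noise pair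
  at vertex \<open>i\<close>, so that all sources of randomness of the tree form one independent
  sequence.\<close>

definition gens :: "nat \<Rightarrow> 'w set set" where
  "gens i = (if i = 0 then {X 1 -` B \<inter> space M | B. B \<in> sets borel}
             else {W i -` B \<inter> space M | B. B \<in> sets borel})"

text \<open>The noise of vertex \<open>k\<close> is excluded: for \<open>k\<close> at least 1,
  \<open>past k\<close> determines \<open>X k\<close>, and indeed all values below vertex
  \<open>2 * k\<close>, but it is independent of \<open>W k\<close>.\<close>

definition past :: "nat \<Rightarrow> 'w measure" where
  "past k = sigma (space M) (\<Union>i<k. gens i)"

lemma W_measurable [measurable]: "n \<ge> 1 \<Longrightarrow> W n \<in> borel_measurable M"
  using noise_indep unfolding indep_vars_def W_def[abs_def] by auto

lemma distr_W: "n \<ge> 1 \<Longrightarrow> distr M borel (W n) = \<nu>0"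
  using noise_law unfolding W_def[abs_def] \<nu>0_def by simp

text \<open>The model states two facts, independence among the noise pairs and independence of the
  ancestor from the whole noise sequence. For a finite index set containing 0 together with other
  indices, the events at these other indices form a cylinder event of the noise sequence; the second
  fact splits off the ancestor and the first handles the rest.\<close>

lemma indep_sets_gens: "indep_sets gens UNIV"
proof (rule indep_setsI)
  show g: "gens i \<subseteq> events" for i
    using ancestor_measurable W_measurable by (auto simp: gens_def intro: measurable_sets)
  have gW: "indep_sets gens {1..}"
    using noise_indep unfolding indep_vars_def2 W_def[symmetric]
    by (auto elim!: indep_sets_mono_sets simp: gens_def W_def[abs_def])
  fix A J assume J: "J \<noteq> {}" "finite J" and A: "\<forall>j\<in>J. A j \<in> gens j"
  show "prob (\<Inter>j\<in>J. A j) = (\<Prod>j\<in>J. prob (A j))"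
  proof (cases "0 \<in> J \<and> J \<noteq> {0}")
    case False
    then have "J = {0} \<or> J \<subseteq> {1..}" using J by (auto simp: Suc_le_eq intro: gr0I)
    then show ?thesis using indep_setsD[OF gW _ J(1,2) A] by auto
  next
    case True
    define K where "K = J - {0}"
    have K: "J = insert 0 K" "0 \<notin> K" "K \<noteq> {}" "finite K" "K \<subseteq> {1..}"
      using True J by (auto simp: K_def Suc_le_eq intro: gr0I)
    obtain B where B: "\<And>j. j \<in> K \<Longrightarrow> B j \<in> sets borel \<and> A j = W j -` B j \<inter> space M"
    proof -
      have "\<forall>j\<in>K. \<exists>B. B \<in> sets borel \<and> A j = W j -` B \<inter> space M"
      proof
        fix j assume j: "j \<in> K"
        then have "j \<noteq> 0" using K(2) by metis
        moreover have "A j \<in> gens j" using A K(1) j by blast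
        ultimately show "\<exists>B. B \<in> sets borel \<and> A j = W j -` B \<inter> space M"
          by (auto simp: gens_def)
      qed
      from bchoice[OF this] show ?thesis using that by blast
    qed
    let ?H = "\<lambda>\<omega>. \<lambda>n\<in>{1..}. W n \<omega>"
    define C where "C = (\<Inter>j\<in>K. (\<lambda>x. x j) -` B j \<inter> space (\<Pi>\<^sub>M n\<in>{1..}. borel :: (real ^ 2) measure))"
    have C: "C \<in> sets (\<Pi>\<^sub>M n\<in>{1..}. borel :: (real ^ 2) measure)"
      unfolding C_def using K B by (intro sets.finite_INT measurable_sets[OF measurable_component_singleton]) auto
    have K1: "1 \<le> j" if "j \<in> K" for j using K(5) that by auto
    have "?H -` C \<inter> space M = (\<Inter>j\<in>K. (\<lambda>\<omega>. ?H \<omega> j) -` B j \<inter> space M)"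
      using K(3) by (auto simp: C_def space_PiM)
    also have "\<dots> = (\<Inter>j\<in>K. A j)"
      using K1 B by (intro arg_cong[where f=Inter] image_cong refl) auto
    finally have eq: "?H -` C \<inter> space M = (\<Inter>j\<in>K. A j)" .
    have ind: "indep_set {X 1 -` B \<inter> space M | B. B \<in> sets borel}
        {?H -` B \<inter> space M | B. B \<in> sets (\<Pi>\<^sub>M n\<in>{1..}. borel)}"
      using noise_indep_ancestor unfolding indep_rv_def W_def[symmetric] by simp
    have "prob (A 0 \<inter> (\<Inter>j\<in>K. A j)) = prob (A 0) * prob (\<Inter>j\<in>K. A j)"
      by (rule indep_setD[OF ind]) (use A K C eq in \<open>auto simp: gens_def\<close>)
    also have "prob (\<Inter>j\<in>K. A j) = (\<Prod>j\<in>K. prob (A j))"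
      using indep_setsD[OF gW K(5,3,4)] A K by auto
    finally show ?thesis using K by simp
  qed
qed

lemma gens_subset: "gens i \<subseteq> Pow (space M)"
  by (auto simp: gens_def)

lemma space_past [simp]: "space (past k) = space M"
  by (simp add: past_def space_measure_of_conv)

lemma sets_past: "sets (past k) = sigma_sets (space M) (\<Union>i<k. gens i)"
  unfolding past_def using gens_subset by (subst sets_measure_of) auto

lemma subalgebra_past: "subalgebra M (past k)"
  unfolding subalgebra_def sets_past
  using indep_sets_gens by (auto simp: indep_sets_def intro!: sets.sigma_sets_subset)

lemma past_mono: "j \<le> k \<Longrightarrow> sets (past j) \<subseteq> sets (past k)"
  unfolding sets_past by (intro sigma_sets_mono' UN_mono) auto

lemma measurable_past_mono: "j \<le> k \<Longrightarrow> f \<in> measurable (past j) N \<Longrightarrow> f \<in> measurable (past k) N"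
  using past_mono[of j k] by (auto simp: measurable_def)

lemma measurable_from_past: "f \<in> measurable (past k) N \<Longrightarrow> f \<in> measurable M N"
  by (rule measurable_from_subalg[OF subalgebra_past])

lemma past_indep:
  assumes "k \<ge> 1" "A \<in> sets (past k)" "B \<in> sets borel"
  shows "prob (A \<inter> (W k -` B \<inter> space M)) = prob A * prob (W k -` B \<inter> space M)"
proof -
  have "indep_sets (\<lambda>j. sigma_sets (space M) (\<Union>i\<in>(case j of True \<Rightarrow> {..<k} | False \<Rightarrow> {k}). gens i)) UNIV"
  proof (rule indep_sets_collect_sigma)
    show "indep_sets gens (\<Union>j. case j of True \<Rightarrow> {..<k} | False \<Rightarrow> {k})"
      by (rule indep_sets_mono_index[OF _ indep_sets_gens]) simp
    show "Int_stable (gens i)" for i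
      by (simp add: gens_def Int_stable_preimages)
    show "disjoint_family (case_bool {..<k} {k})"
      by (auto simp: disjoint_family_on_def split: bool.splits)
  qed
  from indep_setsD[OF this, of UNIV "case_bool A (W k -` B \<inter> space M)"]
  show ?thesis
    using assms by (auto simp: UNIV_bool sets_past gens_def ac_simps intro!: sigma_sets.Basic)
qed

lemma W_past: "1 \<le> j \<Longrightarrow> j < k \<Longrightarrow> W j \<in> borel_measurable (past k)"
proof (rule measurableI)
  fix B :: "(real ^ 2) set" assume "1 \<le> j" "j < k" "B \<in> sets borel"
  then have "W j -` B \<inter> space M \<in> gens j" by (auto simp: gens_def)
  with \<open>j < k\<close> show "W j -` B \<inter> space (past k) \<in> sets (past k)"
    by (auto simp: sets_past)
qed auto

text \<open>The mother \<open>n div 2\<close> of a vertex \<open>n > 1\<close> below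
  \<open>2 * k\<close> lies below \<open>k\<close>, so both her value and her noise pair are
  available.\<close>

lemma X_past: "1 \<le> n \<Longrightarrow> n < 2 * k \<Longrightarrow> X n \<in> borel_measurable (past k)"
proof (induction n rule: less_induct)
  case (less n)
  show ?case
  proof (cases "n = 1")
    case True
    have "X 1 \<in> borel_measurable (past k)"
      using less.prems by (intro measurableI) (auto simp: sets_past gens_def intro!: sigma_sets.Basic bexI[of _ 0])
    then show ?thesis using True by simp
  next
    case False
    define m where "m = n div 2"
    have m: "1 \<le> m" "m < n" "m < k" using less.prems False by (auto simp: m_def)
    have [measurable]: "X m \<in> borel_measurable (past k)"
      using less.IH[of m] m by auto
    have [measurable]: "W m \<in> borel_measurable (past k)" using m by (intro W_past)
    have n: "n = 2 * m \<or> n = 2 * m + 1" by (auto simp: m_def)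
    then show ?thesis
    proof
      assume "n = 2 * m"
      have "(\<lambda>\<omega>. \<alpha>\<^sub>0 * X m \<omega> + \<beta>\<^sub>0 + W m \<omega> $ 1) \<in> borel_measurable (past k)" by measurable
      then show ?thesis
        by (rule measurable_cong[THEN iffD1, rotated])
           (use m recursion_even[of m] \<open>n = 2 * m\<close> in \<open>simp add: W_def\<close>)
    next
      assume "n = 2 * m + 1"
      have "(\<lambda>\<omega>. \<alpha>\<^sub>1 * X m \<omega> + \<beta>\<^sub>1 + W m \<omega> $ 2) \<in> borel_measurable (past k)" by measurable
      then show ?thesis
        by (rule measurable_cong[THEN iffD1, rotated])
           (use m recursion_odd[of m] \<open>n = 2 * m + 1\<close> in \<open>simp add: W_def\<close>)
    qed
  qed
qed

lemma X_measurable: "1 \<le> n \<Longrightarrow> X n \<in> borel_measurable M"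
  using X_past[of n n] measurable_from_past by simp

lemma
  fixes G :: "'w \<times> (real ^ 2) \<Rightarrow> 'c::{banach, second_countable_topology}"
  assumes "k \<ge> 1" "G \<in> borel_measurable (past k \<Otimes>\<^sub>M borel)" "integrable M (\<lambda>\<omega>. G (\<omega>, W k \<omega>))"
  shows integral_W: "(\<integral>\<omega>. G (\<omega>, W k \<omega>) \<partial>M) = (\<integral>\<omega>. (\<integral>w. G (\<omega>, w) \<partial>\<nu>0) \<partial>M)"
    and integrable_W: "integrable M (\<lambda>\<omega>. \<integral>w. G (\<omega>, w) \<partial>\<nu>0)"
  unfolding distr_W[OF assms(1), symmetric]
  by (rule integral_independent[OF subalgebra_past W_measurable[OF assms(1)] past_indep[OF assms(1)] assms(2,3)],
      assumption+,
      rule integrable_independent[OF subalgebra_past W_measurable[OF assms(1)] past_indep[OF assms(1)] assms(2,3)])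

end

section \<open>Moments\<close>

text \<open>Convexity, with \<open>a * x + y\<close> read as a combination of \<open>x\<close> and
  \<open>y / (1 - a)\<close>. The factor of \<open>x ^ m\<close> is the same \<open>a < 1\<close>
  for every \<open>m\<close>, which makes all moment recursions contractive.\<close>

lemma power_convex_combination:
  fixes a x y :: real
  assumes "0 \<le> a" "a < 1" "0 \<le> x" "0 \<le> y"
  shows "(a * x + y) ^ m \<le> a * x ^ m + (1 - a) * (y / (1 - a)) ^ m"
proof -
  have conv: "convex_on {0::real..} (\<lambda>x. x ^ m)"
    using convex_power_odd[of m] convex_on_subset[OF convex_power_even[of m], of "{0..}"]
    by (cases "even m") auto
  have "((1 - (1 - a)) *\<^sub>R x + (1 - a) *\<^sub>R (y / (1 - a))) ^ m
      \<le> (1 - (1 - a)) * x ^ m + (1 - a) * (y / (1 - a)) ^ m"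
    using convex_onD[OF conv, of "1 - a" x "y / (1 - a)"] assms by simp
  then show ?thesis using assms by simp
qed

locale bar_model_moments = bar_model +
  assumes ancestor_moments: "\<And>k::nat. integrable \<nu> (\<lambda>x. \<bar>x\<bar> ^ k)"
begin

definition contr :: real where "contr = max \<bar>\<alpha>\<^sub>0\<bar> \<bar>\<alpha>\<^sub>1\<bar>"

definition drift :: real where "drift = max \<bar>\<beta>\<^sub>0\<bar> \<bar>\<beta>\<^sub>1\<bar>"

lemma contr_bounds: "0 \<le> contr" "contr < 1"
  using alpha_bounds by (auto simp: contr_def)

lemma drift_nonneg: "0 \<le> drift"
  by (simp add: drift_def)

lemma sets_\<nu>0 [measurable_cong, simp]: "sets \<nu>0 = sets borel"
  by (simp add: \<nu>0_def)

lemma space_\<nu>0 [simp]: "space \<nu>0 = UNIV"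
  by (simp add: \<nu>0_def)

lemma prob_space_\<nu>0: "prob_space \<nu>0"
  unfolding \<nu>0_def by (rule prob_space_multi_normal)

sublocale \<nu>0: prob_space \<nu>0
  by (rule prob_space_\<nu>0)

lemma integrable_\<nu>0: "f \<in> C_pol \<Longrightarrow> integrable \<nu>0 f"
  unfolding \<nu>0_def by (rule integrable_C_pol_multi_normal)

definition daughter :: "bool \<Rightarrow> real \<Rightarrow> real ^ 2 \<Rightarrow> real" where
  "daughter b x w = (if b then \<alpha>\<^sub>1 * x + \<beta>\<^sub>1 + w $ 2 else \<alpha>\<^sub>0 * x + \<beta>\<^sub>0 + w $ 1)"

lemma X_daughter:
  assumes "n \<ge> 1" "\<omega> \<in> space M"
  shows "X (2 * n) \<omega> = daughter False (X n \<omega>) (W n \<omega>)"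
    "X (2 * n + 1) \<omega> = daughter True (X n \<omega>) (W n \<omega>)"
  using recursion_even[OF assms] recursion_odd[OF assms] by (simp_all add: daughter_def W_def)

lemma abs_daughter_le: "\<bar>daughter b x w\<bar> \<le> contr * \<bar>x\<bar> + (drift + norm w)"
proof -
  have tri: "\<bar>a + b + c\<bar> \<le> p + (q + r)" if "\<bar>a\<bar> \<le> p" "\<bar>b\<bar> \<le> q" "\<bar>c\<bar> \<le> r" for a b c p q r :: real
    using that by linarith
  have \<alpha>: "\<bar>\<alpha>\<^sub>0 * x\<bar> \<le> contr * \<bar>x\<bar>" "\<bar>\<alpha>\<^sub>1 * x\<bar> \<le> contr * \<bar>x\<bar>"
    unfolding abs_mult by (intro mult_right_mono; simp add: contr_def)+
  have \<beta>: "\<bar>\<beta>\<^sub>0\<bar> \<le> drift" "\<bar>\<beta>\<^sub>1\<bar> \<le> drift" by (simp_all add: drift_def)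
  show ?thesis
    using tri[OF \<alpha>(1) \<beta>(1) component_le_norm_cart] tri[OF \<alpha>(2) \<beta>(2) component_le_norm_cart]
    by (cases b) (simp_all only: daughter_def if_True if_False)
qed

lemma daughter_power_le:
  "\<bar>daughter b x w\<bar> ^ m \<le> contr * \<bar>x\<bar> ^ m + (1 - contr) * ((drift + norm w) / (1 - contr)) ^ m"
proof -
  have "\<bar>daughter b x w\<bar> ^ m \<le> (contr * \<bar>x\<bar> + (drift + norm w)) ^ m"
    by (intro power_mono abs_daughter_le) auto
  also have "\<dots> \<le> contr * \<bar>x\<bar> ^ m + (1 - contr) * ((drift + norm w) / (1 - contr)) ^ m"
    using contr_bounds drift_nonneg by (intro power_convex_combination) auto
  finally show ?thesis .
qed

text \<open>The additive constant of the moment recursion: passing to a daughter multiplies the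
  \<open>m\<close>-th absolute moment by at most \<open>contr\<close> and adds at most this.\<close>

definition noise_moment :: "nat \<Rightarrow> real" where
  "noise_moment m = (\<integral>w. (1 - contr) * ((drift + norm w) / (1 - contr)) ^ m \<partial>\<nu>0)"

lemma integrable_noise_moment:
  "integrable \<nu>0 (\<lambda>w. (1 - contr) * ((drift + norm w) / (1 - contr)) ^ m)"
  unfolding divide_inverse
  by (intro integrable_\<nu>0 C_pol_cmult C_pol_power C_pol_mult C_pol_add C_pol_const C_pol_norm)

lemma noise_moment_nonneg: "0 \<le> noise_moment m"
  unfolding noise_moment_def using contr_bounds drift_nonneg
  by (intro Bochner_Integration.integral_nonneg) auto

lemma integral_W_eq:
  assumes "n \<ge> 1" "f \<in> borel_measurable borel"
  shows "(\<integral>\<omega>. f (W n \<omega>) \<partial>M) = (\<integral>w. f w \<partial>\<nu>0 :: real)"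
    "integrable \<nu>0 f \<Longrightarrow> integrable M (\<lambda>\<omega>. f (W n \<omega>))"
  using assms by (simp_all add: distr_W[OF assms(1), symmetric] integral_distr integrable_distr_eq)

lemma X_moments:
  "\<exists>K. \<forall>n\<ge>1. integrable M (\<lambda>\<omega>. \<bar>X n \<omega>\<bar> ^ m) \<and> (\<integral>\<omega>. \<bar>X n \<omega>\<bar> ^ m \<partial>M) \<le> K"
proof -
  \<comment> \<open>At least the moment of the ancestor and at least the fixed point of the affine
    recursion, so that the recursion never leads above \<open>K\<close>.\<close>
  define K where "K = max (\<integral>\<omega>. \<bar>X 1 \<omega>\<bar> ^ m \<partial>M) (noise_moment m / (1 - contr))"
  have K: "contr * K + noise_moment m \<le> K"
  proof -
    have "noise_moment m / (1 - contr) \<le> K" by (simp add: K_def)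
    then show ?thesis using contr_bounds by (simp add: field_simps)
  qed
  have "integrable M (\<lambda>\<omega>. \<bar>X n \<omega>\<bar> ^ m) \<and> (\<integral>\<omega>. \<bar>X n \<omega>\<bar> ^ m \<partial>M) \<le> K" if "n \<ge> 1" for n
    using that
  proof (induction n rule: less_induct)
    case (less n)
    note [measurable] = X_measurable
    show ?case
    proof (cases "n = 1")
      case True
      have "integrable (distr M borel (X 1)) (\<lambda>x. \<bar>x\<bar> ^ m)"
        unfolding ancestor_law by (rule ancestor_moments)
      then have "integrable M (\<lambda>\<omega>. \<bar>X 1 \<omega>\<bar> ^ m)"
        using ancestor_measurable by (subst (asm) integrable_distr_eq) auto
      then show ?thesis using True by (simp add: K_def)
    next
      case False
      define p where "p = n div 2"
      have p: "1 \<le> p" "p < n" using less.prems False by (auto simp: p_def)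
      have n: "n = 2 * p \<or> n = 2 * p + 1" by (auto simp: p_def)
      let ?g = "\<lambda>w :: real ^ 2. (1 - contr) * ((drift + norm w) / (1 - contr)) ^ m"
      have IH: "integrable M (\<lambda>\<omega>. \<bar>X p \<omega>\<bar> ^ m)" "(\<integral>\<omega>. \<bar>X p \<omega>\<bar> ^ m \<partial>M) \<le> K"
        using less.IH[OF p(2,1)] by auto
      have gi: "integrable M (\<lambda>\<omega>. ?g (W p \<omega>))"
        by (rule integral_W_eq(2)[OF p(1) _ integrable_noise_moment]) measurable
      have ge: "(\<integral>\<omega>. ?g (W p \<omega>) \<partial>M) = noise_moment m"
        unfolding noise_moment_def by (rule integral_W_eq(1)[OF p(1)]) measurable
      have le: "\<bar>X n \<omega>\<bar> ^ m \<le> contr * \<bar>X p \<omega>\<bar> ^ m + ?g (W p \<omega>)" if "\<omega> \<in> space M" for \<omega>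
        using n X_daughter[OF p(1) that] daughter_power_le[of _ "X p \<omega>" "W p \<omega>" m] by auto
      have bi: "integrable M (\<lambda>\<omega>. contr * \<bar>X p \<omega>\<bar> ^ m + ?g (W p \<omega>))"
        using IH gi by (intro Bochner_Integration.integrable_add integrable_mult_right) auto
      have [measurable]: "X n \<in> borel_measurable M" using X_measurable less.prems by auto
      have i: "integrable M (\<lambda>\<omega>. \<bar>X n \<omega>\<bar> ^ m)"
        by (rule Bochner_Integration.integrable_bound[OF bi])
           (use le in \<open>auto intro!: AE_I2 order_trans[OF _ abs_ge_self]\<close>)
      have "(\<integral>\<omega>. \<bar>X n \<omega>\<bar> ^ m \<partial>M) \<le> (\<integral>\<omega>. contr * \<bar>X p \<omega>\<bar> ^ m + ?g (W p \<omega>) \<partial>M)"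
        by (rule integral_mono[OF i bi le])
      also have "\<dots> = contr * (\<integral>\<omega>. \<bar>X p \<omega>\<bar> ^ m \<partial>M) + noise_moment m"
        using IH gi ge by (subst Bochner_Integration.integral_add) auto
      also have "\<dots> \<le> contr * K + noise_moment m"
        using IH contr_bounds by (intro add_right_mono mult_left_mono) auto
      finally show ?thesis using i K by simp
    qed
  qed
  then show ?thesis by blast
qed

lemma C_pol_pair_bound:
  fixes f :: "real \<times> (real ^ 2) \<Rightarrow> real"
  assumes "f \<in> C_pol"
  obtains c m where "c \<ge> 0" "\<And>x w. \<bar>f (x, w)\<bar> \<le> c * (1 + \<bar>x\<bar> ^ m + norm w ^ m)"
proof -
  from assms obtain c m where c: "c \<ge> 0" "\<And>x. \<bar>f x\<bar> \<le> c * (1 + norm x ^ m)" by (rule C_polE) blast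
  have "\<bar>f (x, w)\<bar> \<le> (c * 2 ^ m) * (1 + \<bar>x\<bar> ^ m + norm w ^ m)" for x w
  proof -
    have "norm (x, w) ^ m \<le> (2 * max \<bar>x\<bar> (norm w)) ^ m"
      using norm_Pair_le[of x w] by (intro power_mono) auto
    also have "\<dots> = 2 ^ m * max \<bar>x\<bar> (norm w) ^ m" by (simp add: power_mult_distrib)
    also have "\<dots> \<le> 2 ^ m * (\<bar>x\<bar> ^ m + norm w ^ m)"
      by (intro mult_left_mono) (auto simp: max_def)
    finally have "1 + norm (x, w) ^ m \<le> 2 ^ m + 2 ^ m * (\<bar>x\<bar> ^ m + norm w ^ m)"
      by (intro add_mono) auto
    then have "1 + norm (x, w) ^ m \<le> 2 ^ m * (1 + \<bar>x\<bar> ^ m + norm w ^ m)"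
      by (simp add: algebra_simps)
    then have "c * (1 + norm (x, w) ^ m) \<le> c * (2 ^ m * (1 + \<bar>x\<bar> ^ m + norm w ^ m))"
      using c(1) by (intro mult_left_mono)
    with c(2)[of "(x, w)"] show ?thesis by (simp add: mult.assoc)
  qed
  then show ?thesis using that[of "c * 2 ^ m" m] c(1) by simp
qed

lemma C_pol_pair_measurable:
  fixes f :: "real \<times> (real ^ 2) \<Rightarrow> real"
  assumes "f \<in> C_pol" "g \<in> borel_measurable N" "h \<in> borel_measurable N"
  shows "(\<lambda>\<omega>. f (g \<omega>, h \<omega>)) \<in> borel_measurable N"
  by (rule measurable_compose[OF borel_measurable_Pair[OF assms(2,3)] C_pol_measurable[OF assms(1)]])

lemma C_pol_XW_bound:
  fixes f :: "real \<times> (real ^ 2) \<Rightarrow> real"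
  assumes f: "f \<in> C_pol"
  shows "\<exists>K. \<forall>n\<ge>1. integrable M (\<lambda>\<omega>. f (X n \<omega>, W n \<omega>)) \<and> (\<integral>\<omega>. \<bar>f (X n \<omega>, W n \<omega>)\<bar> \<partial>M) \<le> K"
proof -
  from f obtain c m where c: "c \<ge> 0" "\<And>x w. \<bar>f (x, w)\<bar> \<le> c * (1 + \<bar>x\<bar> ^ m + norm w ^ m)"
    by (rule C_pol_pair_bound) blast
  obtain K where K: "\<And>n. n \<ge> 1 \<Longrightarrow> integrable M (\<lambda>\<omega>. \<bar>X n \<omega>\<bar> ^ m)"
      "\<And>n. n \<ge> 1 \<Longrightarrow> (\<integral>\<omega>. \<bar>X n \<omega>\<bar> ^ m \<partial>M) \<le> K"
    using X_moments[of m] by blast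
  let ?b = "\<lambda>n \<omega>. c * (1 + \<bar>X n \<omega>\<bar> ^ m + norm (W n \<omega>) ^ m)"
  have "integrable M (\<lambda>\<omega>. f (X n \<omega>, W n \<omega>)) \<and>
      (\<integral>\<omega>. \<bar>f (X n \<omega>, W n \<omega>)\<bar> \<partial>M) \<le> c * (1 + K + (\<integral>w. norm w ^ m \<partial>\<nu>0))" if n: "n \<ge> 1" for n
  proof -
    have Wi: "integrable M (\<lambda>\<omega>. norm (W n \<omega>) ^ m)"
      by (rule integral_W_eq(2)[OF n]) (auto intro!: integrable_\<nu>0 C_pol_power C_pol_norm)
    have We: "(\<integral>\<omega>. norm (W n \<omega>) ^ m \<partial>M) = (\<integral>w. norm w ^ m \<partial>\<nu>0)"
      by (rule integral_W_eq(1)[OF n]) measurable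
    have bi: "integrable M (?b n)"
      using K(1)[OF n] Wi by (intro integrable_mult_right Bochner_Integration.integrable_add) auto
    have fm: "(\<lambda>\<omega>. f (X n \<omega>, W n \<omega>)) \<in> borel_measurable M"
      by (rule C_pol_pair_measurable[OF f X_measurable[OF n] W_measurable[OF n]])
    have fi: "integrable M (\<lambda>\<omega>. f (X n \<omega>, W n \<omega>))"
      by (rule Bochner_Integration.integrable_bound[OF bi fm])
         (use c(2) in \<open>auto intro!: AE_I2 order_trans[OF _ abs_ge_self]\<close>)
    then have "(\<integral>\<omega>. \<bar>f (X n \<omega>, W n \<omega>)\<bar> \<partial>M) \<le> (\<integral>\<omega>. ?b n \<omega> \<partial>M)"
      by (intro integral_mono bi integrable_abs c(2))
    also have "\<dots> = c * (1 + (\<integral>\<omega>. \<bar>X n \<omega>\<bar> ^ m \<partial>M) + (\<integral>w. norm w ^ m \<partial>\<nu>0))"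
      using K(1)[OF n] Wi by (simp add: We prob_space)
    also have "\<dots> \<le> c * (1 + K + (\<integral>w. norm w ^ m \<partial>\<nu>0))"
      using K(2)[OF n] c(1) by (intro mult_left_mono) auto
    finally show ?thesis using fi by simp
  qed
  then show ?thesis by blast
qed

lemma integrable_XW:
  fixes f :: "real \<times> (real ^ 2) \<Rightarrow> real"
  shows "f \<in> C_pol \<Longrightarrow> n \<ge> 1 \<Longrightarrow> integrable M (\<lambda>\<omega>. f (X n \<omega>, W n \<omega>))"
  using C_pol_XW_bound[of f] by blast

lemma C_pol_fst: "f \<in> C_pol \<Longrightarrow> (\<lambda>p. f (fst p)) \<in> C_pol"
  by (rule C_pol_bounded_linear_comp[OF _ bounded_linear_fst])

lemma C_pol_X_bound:
  fixes f :: "real \<Rightarrow> real"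
  assumes f: "f \<in> C_pol"
  shows "\<exists>K. \<forall>n\<ge>1. integrable M (\<lambda>\<omega>. f (X n \<omega>)) \<and> (\<integral>\<omega>. \<bar>f (X n \<omega>)\<bar> \<partial>M) \<le> K"
  using C_pol_XW_bound[OF C_pol_fst[OF f]] by simp

lemma integrable_X:
  fixes f :: "real \<Rightarrow> real"
  shows "f \<in> C_pol \<Longrightarrow> n \<ge> 1 \<Longrightarrow> integrable M (\<lambda>\<omega>. f (X n \<omega>))"
  using C_pol_X_bound[of f] by blast

lemma C_pol_section:
  fixes f :: "real \<times> (real ^ 2) \<Rightarrow> real"
  assumes f: "f \<in> C_pol"
  shows "(\<lambda>w. f (x, w)) \<in> C_pol"
proof (rule C_pol_comp[OF f])
  show "continuous_on UNIV (\<lambda>w :: real ^ 2. (x, w))" by (intro continuous_intros)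
  show "norm (x, w) \<le> (1 + \<bar>x\<bar>) * (1 + norm w)" for w :: "real ^ 2"
    by (rule order_trans[OF norm_Pair_le]) (simp add: algebra_simps)
qed

text \<open>Continuity is tested along convergent sequences; these are bounded, so the growth bound
  provides one dominating function for the whole sequence.\<close>

lemma C_pol_integral_\<nu>0:
  fixes f :: "real \<times> (real ^ 2) \<Rightarrow> real"
  assumes f: "f \<in> C_pol"
  shows "(\<lambda>x. \<integral>w. f (x, w) \<partial>\<nu>0) \<in> C_pol"
proof -
  from f obtain c m where c: "c \<ge> 0" "\<And>x w. \<bar>f (x, w)\<bar> \<le> c * (1 + \<bar>x\<bar> ^ m + norm w ^ m)"
    by (rule C_pol_pair_bound) blast
  have ni: "integrable \<nu>0 (\<lambda>w. norm w ^ m)" by (intro integrable_\<nu>0 C_pol_power C_pol_norm)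
  have fi: "integrable \<nu>0 (\<lambda>w. f (x, w))" for x
    by (rule integrable_\<nu>0[OF C_pol_section[OF f]])
  show ?thesis
  proof (rule C_polI)
    let ?m = "\<integral>w. norm w ^ m \<partial>\<nu>0"
    have m0: "0 \<le> ?m" by simp
    then show "0 \<le> c * (1 + ?m)" using c by simp
    fix x
    have "norm (\<integral>w. f (x, w) \<partial>\<nu>0) \<le> (\<integral>w. c * (1 + \<bar>x\<bar> ^ m + norm w ^ m) \<partial>\<nu>0)"
      by (rule Bochner_Integration.integral_norm_bound_integral[OF fi])
         (use c ni in \<open>auto intro!: integrable_mult_right Bochner_Integration.integrable_add\<close>)
    also have "\<dots> = c * (1 + \<bar>x\<bar> ^ m + ?m)"
      using ni \<nu>0.prob_space by simp
    also have "\<dots> \<le> c * ((1 + ?m) * (1 + \<bar>x\<bar> ^ m))"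
      using c m0 by (intro mult_left_mono) (auto simp: algebra_simps)
    finally show "\<bar>\<integral>w. f (x, w) \<partial>\<nu>0\<bar> \<le> c * (1 + ?m) * (1 + norm x ^ m)" by (simp add: mult.assoc)
  next
    show "continuous_on UNIV (\<lambda>x. \<integral>w. f (x, w) \<partial>\<nu>0)"
    proof (rule continuous_on_sequentiallyI)
      fix u :: "nat \<Rightarrow> real" and x assume u: "u \<longlonglongrightarrow> x"
      then obtain B where B: "\<And>n. \<bar>u n\<bar> \<le> B"
        using convergent_imp_Bseq[OF convergentI[OF u]] by (auto simp: Bseq_def)
      show "(\<lambda>n. \<integral>w. f (u n, w) \<partial>\<nu>0) \<longlonglongrightarrow> (\<integral>w. f (x, w) \<partial>\<nu>0)"
      proof (rule integral_dominated_convergence[where w="\<lambda>w. c * (1 + B ^ m + norm w ^ m)"])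
        show "AE w in \<nu>0. (\<lambda>n. f (u n, w)) \<longlonglongrightarrow> f (x, w)"
        proof (rule AE_I2)
          fix w :: "real ^ 2"
          have "isCont f (x, w)" using C_pol_continuous[OF f] by (simp add: continuous_on_eq_continuous_at)
          then show "(\<lambda>n. f (u n, w)) \<longlonglongrightarrow> f (x, w)"
            by (rule isCont_tendsto_compose) (intro tendsto_intros u)
        qed
        show "AE w in \<nu>0. norm (f (u n, w)) \<le> c * (1 + B ^ m + norm w ^ m)" for n
        proof (rule AE_I2)
          fix w :: "real ^ 2"
          have "c * (1 + \<bar>u n\<bar> ^ m + norm w ^ m) \<le> c * (1 + B ^ m + norm w ^ m)"
            using c B[of n] by (intro mult_left_mono add_left_mono add_right_mono power_mono) auto
          then show "norm (f (u n, w)) \<le> c * (1 + B ^ m + norm w ^ m)"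
            using c(2)[of "u n" w] by simp
        qed
        show "integrable \<nu>0 (\<lambda>w. c * (1 + B ^ m + norm w ^ m))"
          using ni by (intro integrable_mult_right Bochner_Integration.integrable_add) auto
      qed (use fi in \<open>auto dest: borel_measurable_integrable\<close>)
    qed
  qed
qed

end

section \<open>Sums of martingale differences along the tree\<close>

lemma exp_minus_quadratic_bound:
  fixes y :: real
  assumes "0 \<le> y"
  shows "\<bar>1 - y - exp (- y)\<bar> \<le> y\<^sup>2 / 2"
proof -
  have lower: "1 - y \<le> exp (- y)" using exp_ge_add_one_self[of "- y"] by simp
  have pos: "0 \<le> 1 - y + y\<^sup>2 / 2"
    using sum_power2_ge_zero[of "1 - y" 1] by (simp add: power2_eq_square algebra_simps)
  \<comment> \<open>The product equals \<open>1 + y ^ 4 / 4\<close>.\<close>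
  have "1 \<le> (1 - y + y\<^sup>2 / 2) * (1 + y + y\<^sup>2 / 2)"
    using assms by (simp add: algebra_simps power2_eq_square)
  also have "\<dots> \<le> (1 - y + y\<^sup>2 / 2) * exp y"
    using exp_lower_Taylor_quadratic[OF assms] pos by (intro mult_left_mono) auto
  finally have "exp (- y) \<le> 1 - y + y\<^sup>2 / 2"
    by (simp add: exp_minus field_simps)
  then show ?thesis using lower by (simp add: abs_if)
qed

lemma norm_integral_le:
  fixes f :: "'a \<Rightarrow> 'b::{banach, second_countable_topology}"
  assumes "integrable M f" "integrable M g" "\<And>x. x \<in> space M \<Longrightarrow> norm (f x) \<le> g x"
  shows "norm (\<integral>x. f x \<partial>M) \<le> (\<integral>x. g x \<partial>M)"
  using integral_norm_bound[of M f] integral_mono[OF integrable_norm[OF assms(1)] assms(2,3)] by linarith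

text \<open>Second-order Taylor expansion of \<open>cis\<close>, with a remainder of third order.
  Centering removes the linear term, and replacing \<open>1 - h / 2\<close> by
  \<open>exp (- h / 2)\<close> costs the term with denominator 8.\<close>

lemma (in prob_space) char_second_order:
  assumes [measurable]: "f \<in> borel_measurable M"
    and int: "integrable M f" "integrable M (\<lambda>x. (f x)\<^sup>2)" "integrable M (\<lambda>x. \<bar>f x\<bar> ^ 3)"
    and zero: "expectation f = 0"
  shows "cmod ((\<integral>x. cis (f x) \<partial>M) - of_real (exp (- expectation (\<lambda>x. (f x)\<^sup>2) / 2)))
     \<le> expectation (\<lambda>x. \<bar>f x\<bar> ^ 3) / 6 + (expectation (\<lambda>x. (f x)\<^sup>2))\<^sup>2 / 8"
proof -
  define h where "h = expectation (\<lambda>x. (f x)\<^sup>2)"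
  have h: "0 \<le> h" by (simp add: h_def)
  let ?T = "\<lambda>x. 1 + \<i> * of_real (f x) - of_real ((f x)\<^sup>2) / 2"
  have Ti: "integrable M ?T"
    using int by (intro Bochner_Integration.integrable_add Bochner_Integration.integrable_diff
        integrable_mult_right integrable_divide integrable_of_real integrable_const) auto
  have ci: "integrable M (\<lambda>x. cis (f x))"
    by (rule integrable_const_bound[where B=1]) auto
  have T_eq: "(\<integral>x. ?T x \<partial>M) = of_real (1 - h / 2)"
  proof -
    have i: "complex_integrable M (\<lambda>x. \<i> * of_real (f x))" "complex_integrable M (\<lambda>x. of_real ((f x)\<^sup>2) / 2)"
      using int by (auto intro!: integrable_mult_right integrable_divide integrable_of_real simp del: of_real_power)
    then have "(\<integral>x. ?T x \<partial>M) = 1 + \<i> * of_real (expectation f) - of_real h / 2"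
      by (simp add: h_def prob_space del: of_real_power)
    then show ?thesis by (simp add: zero)
  qed
  have "cmod ((\<integral>x. cis (f x) \<partial>M) - of_real (1 - h / 2)) = cmod (\<integral>x. cis (f x) - ?T x \<partial>M)"
    using ci Ti by (simp only: T_eq Bochner_Integration.integral_diff)
  also have "\<dots> \<le> (\<integral>x. \<bar>f x\<bar> ^ 3 / 6 \<partial>M)"
  proof (rule norm_integral_le)
    fix x
    have "(\<Sum>k\<le>2. (\<i> * of_real (f x)) ^ k / fact k) = ?T x"
      by (simp add: numeral_2_eq_2 power2_eq_square algebra_simps)
    then have "cmod (cis (f x) - ?T x) \<le> \<bar>f x\<bar> ^ Suc 2 / fact (Suc 2)"
      using iexp_approx1[of "f x" 2] by (simp only: cis_conv_exp)
    moreover have "fact (Suc 2) = (6 :: real)" by (simp add: numeral_2_eq_2)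
    ultimately show "cmod (cis (f x) - ?T x) \<le> \<bar>f x\<bar> ^ 3 / 6"
      by (simp only: eval_nat_numeral)
  qed (use ci Ti int in auto)
  also have "\<dots> = expectation (\<lambda>x. \<bar>f x\<bar> ^ 3) / 6" by simp
  finally have 1: "cmod ((\<integral>x. cis (f x) \<partial>M) - of_real (1 - h / 2)) \<le> expectation (\<lambda>x. \<bar>f x\<bar> ^ 3) / 6" .
  have "cmod (of_real (1 - h / 2) - of_real (exp (- h / 2))) = \<bar>1 - h / 2 - exp (- (h / 2))\<bar>"
    by (simp flip: of_real_diff)
  also have "\<dots> \<le> (h / 2)\<^sup>2 / 2" using h by (intro exp_minus_quadratic_bound) simp
  also have "\<dots> = h\<^sup>2 / 8" by (simp add: power2_eq_square)
  finally have 2: "cmod (of_real (1 - h / 2) - of_real (exp (- h / 2))) \<le> h\<^sup>2 / 8" .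
  show ?thesis
    using norm_triangle_le[OF add_mono[OF 1 2]] by (simp add: h_def exp_of_real)
qed

text \<open>Discounting the characteristic function of a martingale with conditional variance \<open>v\<close> by
  \<open>clip s v\<close> turns the deterministic target \<open>exp (- s / 2)\<close> into the value at \<open>v = 0\<close>; unlike the
  usual factor \<open>exp (v / 2)\<close> it is bounded, so that no stopping is needed.\<close>

definition clip :: "real \<Rightarrow> real \<Rightarrow> real" where
  "clip s v = exp (- max 0 (s - v) / 2)"

lemma clip_bounds: "0 \<le> clip s v" "clip s v \<le> 1"
  by (simp_all add: clip_def)

lemma clip_measurable [measurable]: "clip s \<in> borel_measurable borel"
  unfolding clip_def by measurable

lemma one_minus_clip_le: "1 - clip s v \<le> max 0 (s - v) / 2"
  using exp_ge_add_one_self[of "- max 0 (s - v) / 2"] by (simp add: clip_def)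

text \<open>While \<open>v + h\<close> stays below \<open>s\<close>, the factor
  \<open>exp (- h / 2)\<close> is exactly compensated by the growth of \<open>clip\<close>. Only the
  part of the step beyond \<open>s\<close> costs something, and this cost is the increment of
  \<open>max 0 (v - s) / 2\<close>, so that costs telescope over many steps.\<close>

lemma clip_step:
  assumes "0 \<le> h"
  shows "\<bar>exp (- h / 2) * clip s (v + h) - clip s v\<bar> \<le> (max 0 (v + h - s) - max 0 (v - s)) / 2"
proof -
  \<comment> \<open>The exponents of the two sides; their difference is half the increase of the
    overshoot beyond \<open>s\<close>.\<close>
  define p where "p = (h + max 0 (s - (v + h))) / 2"
  define q where "q = max 0 (s - v) / 2"
  have pq: "p - q = (max 0 (v + h - s) - max 0 (v - s)) / 2" "p - q \<ge> 0" "q \<ge> 0"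
    using assms by (auto simp: p_def q_def max_def field_simps)
  have "exp (- h / 2) * clip s (v + h) = exp (- p)"
    by (simp add: clip_def p_def exp_add[symmetric] add_divide_distrib)
  moreover have "clip s v = exp (- q)" by (simp add: clip_def q_def)
  moreover have "exp (- p) \<le> exp (- q)" using pq by simp
  moreover have "exp (- q) - exp (- p) = exp (- q) * (1 - exp (- (p - q)))"
    by (simp add: right_diff_distrib exp_add[symmetric])
  moreover have "exp (- q) * (1 - exp (- (p - q))) \<le> 1 * (p - q)"
  proof (rule mult_mono)
    show "1 - exp (- (p - q)) \<le> p - q" using exp_ge_add_one_self[of "- (p - q)"] by linarith
  qed (use pq in auto)
  ultimately show ?thesis using pq(1) by simp
qed

lemma integrable_mult_of_squares:
  fixes f g :: "'a \<Rightarrow> real"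
  assumes [measurable]: "f \<in> borel_measurable M" "g \<in> borel_measurable M"
    and "integrable M (\<lambda>\<omega>. (f \<omega>)\<^sup>2)" "integrable M (\<lambda>\<omega>. (g \<omega>)\<^sup>2)"
  shows "integrable M (\<lambda>\<omega>. f \<omega> * g \<omega>)"
proof (rule Bochner_Integration.integrable_bound[OF Bochner_Integration.integrable_add[OF assms(3,4)]])
  show "AE \<omega> in M. norm (f \<omega> * g \<omega>) \<le> norm ((f \<omega>)\<^sup>2 + (g \<omega>)\<^sup>2)"
  proof (rule AE_I2)
    fix \<omega>
    have "2 * (\<bar>f \<omega>\<bar> * \<bar>g \<omega>\<bar>) \<le> (f \<omega>)\<^sup>2 + (g \<omega>)\<^sup>2"
      using sum_squares_bound[of "\<bar>f \<omega>\<bar>" "\<bar>g \<omega>\<bar>"] by (simp add: mult.assoc)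
    moreover have "0 \<le> \<bar>f \<omega>\<bar> * \<bar>g \<omega>\<bar>" by simp
    ultimately have "\<bar>f \<omega>\<bar> * \<bar>g \<omega>\<bar> \<le> (f \<omega>)\<^sup>2 + (g \<omega>)\<^sup>2" by linarith
    then show "norm (f \<omega> * g \<omega>) \<le> norm ((f \<omega>)\<^sup>2 + (g \<omega>)\<^sup>2)" by (simp add: abs_mult)
  qed
qed measurable

section \<open>Orthogonality and characteristic functions of martingale sums\<close>

context bar_model_moments
begin

definition centered :: "(real \<times> (real ^ 2) \<Rightarrow> real) \<Rightarrow> bool" where
  "centered D \<longleftrightarrow> D \<in> C_pol \<and> (\<forall>x. (\<integral>w. D (x, w) \<partial>\<nu>0) = 0)"

lemma D_past:
  assumes "D \<in> C_pol" "1 \<le> j" "j < k"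
  shows "(\<lambda>\<omega>. D (X j \<omega>, W j \<omega>)) \<in> borel_measurable (past k)"
  by (rule C_pol_pair_measurable[OF assms(1) X_past W_past]) (use assms in auto)

lemma D_frozen_measurable:
  fixes D :: "real \<times> (real ^ 2) \<Rightarrow> real"
  assumes "D \<in> C_pol" "1 \<le> k"
  shows "(\<lambda>p. D (X k (fst p), snd p)) \<in> borel_measurable (past k \<Otimes>\<^sub>M borel)"
proof (rule C_pol_pair_measurable[OF assms(1)])
  show "(\<lambda>p. X k (fst p)) \<in> borel_measurable (past k \<Otimes>\<^sub>M borel)"
    by (rule measurable_compose[OF measurable_fst X_past]) (use assms in auto)
qed measurable

text \<open>At the largest index \<open>b\<close> everything added so far, including
  \<open>Y\<close>, is measurable with respect to \<open>past b\<close>. Integrating out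
  \<open>W b\<close> first makes the cross term vanish, which is why the induction adds maximal
  elements.\<close>

lemma second_moment_martingale_sum:
  assumes D: "centered D" and Y: "Y \<in> borel_measurable (past k)" "integrable M (\<lambda>\<omega>. (Y \<omega>)\<^sup>2)"
    and k: "1 \<le> k" and J: "finite J" "J \<subseteq> {k..}"
  shows "integrable M (\<lambda>\<omega>. (Y \<omega> + (\<Sum>j\<in>J. D (X j \<omega>, W j \<omega>)))\<^sup>2) \<and>
    (\<integral>\<omega>. (Y \<omega> + (\<Sum>j\<in>J. D (X j \<omega>, W j \<omega>)))\<^sup>2 \<partial>M)
      = (\<integral>\<omega>. (Y \<omega>)\<^sup>2 \<partial>M) + (\<Sum>j\<in>J. \<integral>\<omega>. (D (X j \<omega>, W j \<omega>))\<^sup>2 \<partial>M)"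
  using J
proof (induction J rule: finite_linorder_max_induct)
  case empty
  then show ?case using Y by simp
next
  case (insert b A)
  have DC: "D \<in> C_pol" using D by (simp add: centered_def)
  define S where "S \<omega> = Y \<omega> + (\<Sum>j\<in>A. D (X j \<omega>, W j \<omega>))" for \<omega>
  define d where "d \<omega> = D (X b \<omega>, W b \<omega>)" for \<omega>
  have b: "k \<le> b" "1 \<le> b" "b \<notin> A" using insert.prems insert.hyps k by auto
  have Sp: "S \<in> borel_measurable (past b)"
    unfolding S_def using insert.prems insert.hyps k
    by (intro borel_measurable_add borel_measurable_sum measurable_past_mono[OF b(1) Y(1)] D_past[OF DC]) auto
  then have [measurable]: "S \<in> borel_measurable M" by (rule measurable_from_past)
  have dm [measurable]: "d \<in> borel_measurable M"
    unfolding d_def by (rule C_pol_pair_measurable[OF DC X_measurable[OF b(2)] W_measurable[OF b(2)]])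
  have IH: "integrable M (\<lambda>\<omega>. (S \<omega>)\<^sup>2)"
      "(\<integral>\<omega>. (S \<omega>)\<^sup>2 \<partial>M) = (\<integral>\<omega>. (Y \<omega>)\<^sup>2 \<partial>M) + (\<Sum>j\<in>A. \<integral>\<omega>. (D (X j \<omega>, W j \<omega>))\<^sup>2 \<partial>M)"
    using insert.IH insert.prems by (auto simp: S_def)
  have di: "integrable M (\<lambda>\<omega>. (d \<omega>)\<^sup>2)"
    unfolding d_def by (rule integrable_XW[OF C_pol_power[OF DC] b(2)])
  have Sd: "integrable M (\<lambda>\<omega>. S \<omega> * d \<omega>)"
    by (rule integrable_mult_of_squares[OF _ _ IH(1) di]) measurable
  have "(\<integral>\<omega>. S \<omega> * d \<omega> \<partial>M) = (\<integral>\<omega>. (\<lambda>p. S (fst p) * D (X b (fst p), snd p)) (\<omega>, W b \<omega>) \<partial>M)"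
    by (simp add: d_def)
  also have "\<dots> = (\<integral>\<omega>. (\<integral>w. (\<lambda>p. S (fst p) * D (X b (fst p), snd p)) (\<omega>, w) \<partial>\<nu>0) \<partial>M)"
  proof (rule integral_W[OF b(2)])
    show "(\<lambda>p. S (fst p) * D (X b (fst p), snd p)) \<in> borel_measurable (past b \<Otimes>\<^sub>M borel)"
      by (intro borel_measurable_times D_frozen_measurable[OF DC b(2)] measurable_compose[OF measurable_fst Sp])
    show "integrable M (\<lambda>\<omega>. (\<lambda>p. S (fst p) * D (X b (fst p), snd p)) (\<omega>, W b \<omega>))"
      using Sd by (simp add: d_def)
  qed
  also have "\<dots> = 0" using D by (simp add: centered_def)
  finally have zero: "(\<integral>\<omega>. S \<omega> * d \<omega> \<partial>M) = 0" .
  have eq: "(Y \<omega> + (\<Sum>j\<in>insert b A. D (X j \<omega>, W j \<omega>)))\<^sup>2 = (S \<omega>)\<^sup>2 + 2 * (S \<omega> * d \<omega>) + (d \<omega>)\<^sup>2" for \<omega>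
    using b(3) insert.hyps(1) by (simp add: S_def d_def power2_eq_square algebra_simps)
  have "integrable M (\<lambda>\<omega>. (S \<omega>)\<^sup>2 + 2 * (S \<omega> * d \<omega>) + (d \<omega>)\<^sup>2)"
    using IH(1) Sd di by auto
  moreover have "(\<integral>\<omega>. (S \<omega>)\<^sup>2 + 2 * (S \<omega> * d \<omega>) + (d \<omega>)\<^sup>2 \<partial>M) = (\<integral>\<omega>. (S \<omega>)\<^sup>2 \<partial>M) + (\<integral>\<omega>. (d \<omega>)\<^sup>2 \<partial>M)"
    using IH(1) Sd di by (simp add: zero)
  ultimately show ?case
    unfolding eq using IH(2) b(3) insert.hyps(1) by (simp add: d_def)
qed

definition cond_var :: "(real \<times> (real ^ 2) \<Rightarrow> real) \<Rightarrow> real \<Rightarrow> real" where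
  "cond_var D x = (\<integral>w. (D (x, w))\<^sup>2 \<partial>\<nu>0)"

definition cond_abs3 :: "(real \<times> (real ^ 2) \<Rightarrow> real) \<Rightarrow> real \<Rightarrow> real" where
  "cond_abs3 D x = (\<integral>w. \<bar>D (x, w)\<bar> ^ 3 \<partial>\<nu>0)"

lemma C_pol_cond_var: "D \<in> C_pol \<Longrightarrow> cond_var D \<in> C_pol"
  unfolding cond_var_def by (intro C_pol_integral_\<nu>0 C_pol_power)

lemma C_pol_cond_abs3: "D \<in> C_pol \<Longrightarrow> cond_abs3 D \<in> C_pol"
  unfolding cond_abs3_def by (intro C_pol_integral_\<nu>0 C_pol_power C_pol_abs)

lemma cond_var_nonneg: "0 \<le> cond_var D x"
  by (simp add: cond_var_def)

text \<open>Adding the largest index \<open>b\<close> multiplies the integrand by a conditional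
  characteristic function close to \<open>exp (- h / 2)\<close>, the error being of third order,
  while the argument of \<open>clip\<close> grows by \<open>h\<close>. By \<open>clip_step\<close>
  the two changes cancel up to an increment of the overshoot; the increments telescope to the first
  term of the bound.\<close>

lemma char_martingale_sum_clipped:
  assumes D: "centered D" and s: "0 \<le> s" and J: "finite J" "J \<subseteq> {1..}"
  shows "cmod ((\<integral>\<omega>. cis (\<Sum>j\<in>J. D (X j \<omega>, W j \<omega>)) * of_real (clip s (\<Sum>j\<in>J. cond_var D (X j \<omega>))) \<partial>M) - of_real (exp (- s / 2)))
    \<le> (\<integral>\<omega>. max 0 ((\<Sum>j\<in>J. cond_var D (X j \<omega>)) - s) / 2 \<partial>M)
      + (\<Sum>j\<in>J. \<integral>\<omega>. cond_abs3 D (X j \<omega>) / 6 + (cond_var D (X j \<omega>))\<^sup>2 / 8 \<partial>M)"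
  using J
proof (induction J rule: finite_linorder_max_induct)
  case empty
  then show ?case using s by (simp add: clip_def prob_space exp_of_real[symmetric] max_absorb1)
next
  case (insert b A)
  have DC: "D \<in> C_pol" using D by (simp add: centered_def)
  define S where "S \<omega> = (\<Sum>j\<in>A. D (X j \<omega>, W j \<omega>))" for \<omega>
  define V where "V \<omega> = (\<Sum>j\<in>A. cond_var D (X j \<omega>))" for \<omega>
  define h where "h \<omega> = cond_var D (X b \<omega>)" for \<omega>
  define \<kappa> where "\<kappa> \<omega> = cond_abs3 D (X b \<omega>)" for \<omega>
  define c where "c \<omega> = (\<integral>w. cis (D (X b \<omega>, w)) \<partial>\<nu>0)" for \<omega>
  define \<delta> where "\<delta> \<omega> = \<kappa> \<omega> / 6 + (h \<omega>)\<^sup>2 / 8" for \<omega>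
  have b: "1 \<le> b" "b \<notin> A" "\<And>j. j \<in> A \<Longrightarrow> 1 \<le> j \<and> j < b" using insert.prems insert.hyps by auto
  have b2: "j < 2 * b" if "j \<in> A" for j using b(3)[OF that] by linarith
  have Sp: "S \<in> borel_measurable (past b)"
    unfolding S_def using b by (intro borel_measurable_sum D_past[OF DC]) auto
  note hm = C_pol_measurable[OF C_pol_cond_var[OF DC]]
  have Vp: "V \<in> borel_measurable (past b)"
    unfolding V_def using b b2
    by (intro borel_measurable_sum measurable_compose[OF X_past hm]) auto
  have hp: "h \<in> borel_measurable (past b)"
    unfolding h_def using b by (intro measurable_compose[OF X_past hm]) auto
  note [measurable] = Sp[THEN measurable_from_past] Vp[THEN measurable_from_past] hp[THEN measurable_from_past]
  have [measurable]: "(\<lambda>\<omega>. D (X b \<omega>, W b \<omega>)) \<in> borel_measurable M"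
    by (rule C_pol_pair_measurable[OF DC X_measurable[OF b(1)] W_measurable[OF b(1)]])
  have h0: "0 \<le> h \<omega>" for \<omega> by (simp add: h_def cond_var_nonneg)
  have Vi: "integrable M V" unfolding V_def
    using b by (intro Bochner_Integration.integrable_sum integrable_X C_pol_cond_var DC) auto
  have hi: "integrable M h" unfolding h_def by (intro integrable_X C_pol_cond_var DC b)
  have \<delta>i: "integrable M \<delta>" unfolding \<delta>_def \<kappa>_def h_def divide_inverse
    by (intro integrable_X[OF _ b(1)] C_pol_add C_pol_mult C_pol_const C_pol_power C_pol_cond_var C_pol_cond_abs3 DC)
  \<comment> \<open>The conditional variance \<open>h\<close> at \<open>b\<close> depends on
    \<open>X b\<close> only and hence on the past, so the fresh noise enters this integrand through
    \<open>D\<close> alone.\<close>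
  let ?G = "\<lambda>p. cis (S (fst p) + D (X b (fst p), snd p)) * of_real (clip s (V (fst p) + h (fst p))) :: complex"
  have Gm: "?G \<in> borel_measurable (past b \<Otimes>\<^sub>M borel)"
  proof -
    note [measurable] = D_frozen_measurable[OF DC b(1)] measurable_compose[OF measurable_fst Sp]
      measurable_compose[OF measurable_fst Vp] measurable_compose[OF measurable_fst hp]
    show ?thesis by measurable
  qed
  have Gi: "integrable M (\<lambda>\<omega>. ?G (\<omega>, W b \<omega>))"
    by (rule integrable_const_bound[where B=1]) (use clip_bounds in \<open>auto simp: norm_mult\<close>)
  have Geq: "(\<integral>w. ?G (\<omega>, w) \<partial>\<nu>0) = cis (S \<omega>) * (of_real (clip s (V \<omega> + h \<omega>)) * c \<omega>)" for \<omega>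
    by (simp add: c_def ac_simps flip: cis_mult)
  have Ti: "integrable M (\<lambda>\<omega>. cis (S \<omega>) * of_real (clip s (V \<omega>)))"
    by (rule integrable_const_bound[where B=1]) (use clip_bounds in \<open>auto simp: norm_mult\<close>)
  have cGi: "integrable M (\<lambda>\<omega>. cis (S \<omega>) * (of_real (clip s (V \<omega> + h \<omega>)) * c \<omega>))"
    using integrable_W[OF b(1) Gm Gi] unfolding Geq .
  have pointwise: "cmod (cis (S \<omega>) * (of_real (clip s (V \<omega> + h \<omega>)) * c \<omega>) - cis (S \<omega>) * of_real (clip s (V \<omega>)))
      \<le> \<delta> \<omega> + (max 0 (V \<omega> + h \<omega> - s) - max 0 (V \<omega> - s)) / 2" for \<omega>
  proof -
    let ?p = "clip s (V \<omega> + h \<omega>)" and ?e = "exp (- h \<omega> / 2)"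
    have sec: "(\<lambda>w. D (X b \<omega>, w)) \<in> C_pol" by (rule C_pol_section[OF DC])
    have c\<delta>: "cmod (c \<omega> - of_real ?e) \<le> \<delta> \<omega>"
      unfolding c_def \<delta>_def h_def \<kappa>_def cond_var_def cond_abs3_def
      using \<nu>0.char_second_order[of "\<lambda>w. D (X b \<omega>, w)"] D C_pol_measurable[OF sec]
        integrable_\<nu>0[OF sec] integrable_\<nu>0[OF C_pol_power[OF sec, of 2]]
        integrable_\<nu>0[OF C_pol_power[OF C_pol_abs[OF sec], of 3]]
      by (simp add: centered_def)
    have "cis (S \<omega>) * (of_real ?p * c \<omega>) - cis (S \<omega>) * of_real (clip s (V \<omega>))
        = cis (S \<omega>) * (of_real ?p * (c \<omega> - of_real ?e) + of_real (?e * ?p - clip s (V \<omega>)))"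
      by (simp add: algebra_simps)
    then have "cmod (cis (S \<omega>) * (of_real ?p * c \<omega>) - cis (S \<omega>) * of_real (clip s (V \<omega>)))
        = cmod (of_real ?p * (c \<omega> - of_real ?e) + of_real (?e * ?p - clip s (V \<omega>)))"
      by (simp add: norm_mult)
    also have "\<dots> \<le> ?p * cmod (c \<omega> - of_real ?e) + \<bar>?e * ?p - clip s (V \<omega>)\<bar>"
      using clip_bounds(1)[of s "V \<omega> + h \<omega>"]
      by (intro order_trans[OF norm_triangle_ineq]) (simp add: norm_mult del: of_real_diff of_real_mult)
    also have "\<dots> \<le> 1 * \<delta> \<omega> + (max 0 (V \<omega> + h \<omega> - s) - max 0 (V \<omega> - s)) / 2"
      using c\<delta> clip_bounds[of s "V \<omega> + h \<omega>"]
      by (intro add_mono mult_mono clip_step h0) auto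
    finally show ?thesis by simp
  qed
  have mi: "integrable M (\<lambda>\<omega>. max 0 (V \<omega> + h \<omega> - s) / 2)" "integrable M (\<lambda>\<omega>. max 0 (V \<omega> - s) / 2)"
    using Vi hi by (auto intro!: integrable_max)
  have "cmod ((\<integral>\<omega>. ?G (\<omega>, W b \<omega>) \<partial>M) - (\<integral>\<omega>. cis (S \<omega>) * of_real (clip s (V \<omega>)) \<partial>M))
      = cmod (\<integral>\<omega>. cis (S \<omega>) * (of_real (clip s (V \<omega> + h \<omega>)) * c \<omega>) - cis (S \<omega>) * of_real (clip s (V \<omega>)) \<partial>M)"
    using cGi Ti by (simp only: integral_W[OF b(1) Gm Gi] Geq Bochner_Integration.integral_diff)
  also have "\<dots> \<le> (\<integral>\<omega>. \<delta> \<omega> + (max 0 (V \<omega> + h \<omega> - s) / 2 - max 0 (V \<omega> - s) / 2) \<partial>M)"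
    by (rule norm_integral_le)
       (use cGi Ti \<delta>i mi pointwise in \<open>auto simp: diff_divide_distrib\<close>)
  also have "\<dots> = (\<integral>\<omega>. \<delta> \<omega> \<partial>M) + ((\<integral>\<omega>. max 0 (V \<omega> + h \<omega> - s) / 2 \<partial>M) - (\<integral>\<omega>. max 0 (V \<omega> - s) / 2 \<partial>M))"
    using \<delta>i mi by (simp only: Bochner_Integration.integral_add Bochner_Integration.integral_diff Bochner_Integration.integrable_diff)
  finally have step: "cmod ((\<integral>\<omega>. ?G (\<omega>, W b \<omega>) \<partial>M) - (\<integral>\<omega>. cis (S \<omega>) * of_real (clip s (V \<omega>)) \<partial>M))
      \<le> (\<integral>\<omega>. \<delta> \<omega> \<partial>M) + ((\<integral>\<omega>. max 0 (V \<omega> + h \<omega> - s) / 2 \<partial>M) - (\<integral>\<omega>. max 0 (V \<omega> - s) / 2 \<partial>M))" .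
  have IH: "cmod ((\<integral>\<omega>. cis (S \<omega>) * of_real (clip s (V \<omega>)) \<partial>M) - of_real (exp (- s / 2)))
    \<le> (\<integral>\<omega>. max 0 (V \<omega> - s) / 2 \<partial>M) + (\<Sum>j\<in>A. \<integral>\<omega>. cond_abs3 D (X j \<omega>) / 6 + (cond_var D (X j \<omega>))\<^sup>2 / 8 \<partial>M)"
    using insert.IH insert.prems unfolding S_def V_def by simp
  have sums: "(\<Sum>j\<in>insert b A. D (X j \<omega>, W j \<omega>)) = S \<omega> + D (X b \<omega>, W b \<omega>)"
      "(\<Sum>j\<in>insert b A. cond_var D (X j \<omega>)) = V \<omega> + h \<omega>" for \<omega>
    using b(2) insert.hyps(1) by (simp_all add: S_def V_def h_def)
  have sum3: "(\<Sum>j\<in>insert b A. \<integral>\<omega>. cond_abs3 D (X j \<omega>) / 6 + (cond_var D (X j \<omega>))\<^sup>2 / 8 \<partial>M)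
      = (\<integral>\<omega>. \<delta> \<omega> \<partial>M) + (\<Sum>j\<in>A. \<integral>\<omega>. cond_abs3 D (X j \<omega>) / 6 + (cond_var D (X j \<omega>))\<^sup>2 / 8 \<partial>M)"
    using b(2) insert.hyps(1) by (simp add: \<delta>_def \<kappa>_def h_def)
  show ?case
    unfolding sums sum3 using norm_triangle_le[OF add_mono[OF step IH]] by simp
qed

text \<open>Removing the discount costs half the expected shortfall of the conditional variance
  below \<open>s\<close>. Together with the expected overshoot above \<open>s\<close> this gives
  half the \<open>L\<^sup>1\<close> distance.\<close>

lemma char_martingale_sum:
  assumes D: "centered D" and s: "0 \<le> s" and J: "finite J" "J \<subseteq> {1..}"
  shows "cmod ((\<integral>\<omega>. cis (\<Sum>j\<in>J. D (X j \<omega>, W j \<omega>)) \<partial>M) - of_real (exp (- s / 2)))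
    \<le> (\<integral>\<omega>. \<bar>(\<Sum>j\<in>J. cond_var D (X j \<omega>)) - s\<bar> \<partial>M) / 2
      + (\<Sum>j\<in>J. \<integral>\<omega>. cond_abs3 D (X j \<omega>) / 6 + (cond_var D (X j \<omega>))\<^sup>2 / 8 \<partial>M)"
proof -
  have DC: "D \<in> C_pol" using D by (simp add: centered_def)
  define S where "S \<omega> = (\<Sum>j\<in>J. D (X j \<omega>, W j \<omega>))" for \<omega>
  define V where "V \<omega> = (\<Sum>j\<in>J. cond_var D (X j \<omega>))" for \<omega>
  have [measurable]: "S \<in> borel_measurable M"
    unfolding S_def using J
    by (intro borel_measurable_sum C_pol_pair_measurable[OF DC X_measurable W_measurable]) auto
  have Vi: "integrable M V" unfolding V_def
    using J by (intro Bochner_Integration.integrable_sum integrable_X C_pol_cond_var DC) auto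
  have [measurable]: "V \<in> borel_measurable M" using Vi by auto
  have mi: "integrable M (\<lambda>\<omega>. max 0 (s - V \<omega>) / 2)" "integrable M (\<lambda>\<omega>. max 0 (V \<omega> - s) / 2)"
    using Vi by (auto intro!: integrable_max)
  have i1: "integrable M (\<lambda>\<omega>. cis (S \<omega>))"
    by (rule integrable_const_bound[where B=1]) auto
  have i2: "integrable M (\<lambda>\<omega>. cis (S \<omega>) * of_real (clip s (V \<omega>)))"
    by (rule integrable_const_bound[where B=1]) (use clip_bounds in \<open>auto simp: norm_mult\<close>)
  have "cmod ((\<integral>\<omega>. cis (S \<omega>) \<partial>M) - (\<integral>\<omega>. cis (S \<omega>) * of_real (clip s (V \<omega>)) \<partial>M))
      = cmod (\<integral>\<omega>. cis (S \<omega>) - cis (S \<omega>) * of_real (clip s (V \<omega>)) \<partial>M)"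
    using i1 i2 by simp
  also have "\<dots> \<le> (\<integral>\<omega>. max 0 (s - V \<omega>) / 2 \<partial>M)"
  proof (rule norm_integral_le)
    fix \<omega>
    have "cis (S \<omega>) - cis (S \<omega>) * of_real (clip s (V \<omega>)) = cis (S \<omega>) * of_real (1 - clip s (V \<omega>))"
      by (simp add: algebra_simps)
    then have "cmod (cis (S \<omega>) - cis (S \<omega>) * of_real (clip s (V \<omega>))) = \<bar>1 - clip s (V \<omega>)\<bar>"
      by (simp add: norm_mult del: of_real_diff)
    also have "\<dots> \<le> max 0 (s - V \<omega>) / 2"
      using one_minus_clip_le[of s "V \<omega>"] clip_bounds[of s "V \<omega>"] by simp
    finally show "cmod (cis (S \<omega>) - cis (S \<omega>) * of_real (clip s (V \<omega>))) \<le> max 0 (s - V \<omega>) / 2" .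
  qed (use i1 i2 mi in auto)
  finally have 1: "cmod ((\<integral>\<omega>. cis (S \<omega>) \<partial>M) - (\<integral>\<omega>. cis (S \<omega>) * of_real (clip s (V \<omega>)) \<partial>M))
      \<le> (\<integral>\<omega>. max 0 (s - V \<omega>) / 2 \<partial>M)" .
  have 2: "(\<integral>\<omega>. max 0 (s - V \<omega>) / 2 \<partial>M) + (\<integral>\<omega>. max 0 (V \<omega> - s) / 2 \<partial>M) = (\<integral>\<omega>. \<bar>V \<omega> - s\<bar> \<partial>M) / 2"
  proof -
    have "(\<integral>\<omega>. max 0 (s - V \<omega>) / 2 \<partial>M) + (\<integral>\<omega>. max 0 (V \<omega> - s) / 2 \<partial>M)
        = (\<integral>\<omega>. max 0 (s - V \<omega>) / 2 + max 0 (V \<omega> - s) / 2 \<partial>M)"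
      using mi by (simp only: Bochner_Integration.integral_add)
    also have "\<dots> = (\<integral>\<omega>. \<bar>V \<omega> - s\<bar> / 2 \<partial>M)"
      by (rule Bochner_Integration.integral_cong) (auto simp: max_def)
    finally show ?thesis by simp
  qed
  note 3 = char_martingale_sum_clipped[OF D s J, folded S_def V_def]
  show ?thesis
    unfolding S_def[symmetric] V_def[symmetric] 2[symmetric]
    using norm_triangle_le[OF add_mono[OF 1 3]] by simp
qed

end

section \<open>Lipschitz approximation\<close>

definition Lipschitz :: "real \<Rightarrow> (real \<Rightarrow> real) \<Rightarrow> bool" where
  "Lipschitz L f \<longleftrightarrow> 0 \<le> L \<and> (\<forall>x y. \<bar>f x - f y\<bar> \<le> L * \<bar>x - y\<bar>)"

lemma LipschitzD: "Lipschitz L f \<Longrightarrow> \<bar>f x - f y\<bar> \<le> L * \<bar>x - y\<bar>"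
  by (simp add: Lipschitz_def)

lemma Lipschitz_C_pol:
  assumes "Lipschitz L f"
  shows "f \<in> C_pol"
proof (rule C_polI)
  have "L-lipschitz_on UNIV f"
    using assms by (intro lipschitz_onI) (auto simp: Lipschitz_def dist_real_def)
  then show "continuous_on UNIV f" by (rule lipschitz_on_continuous_on)
  show "0 \<le> \<bar>f 0\<bar> + L" using assms by (simp add: Lipschitz_def)
  fix x
  have "\<bar>f x\<bar> \<le> \<bar>f 0\<bar> + L * \<bar>x\<bar>" using LipschitzD[OF assms, of x 0] by simp
  also have "\<dots> \<le> (\<bar>f 0\<bar> + L) * (1 + \<bar>x\<bar>)"
    using assms by (simp add: Lipschitz_def algebra_simps)
  finally show "\<bar>f x\<bar> \<le> (\<bar>f 0\<bar> + L) * (1 + norm x ^ 1)" by simp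
qed

text \<open>A polynomial approximation has a bounded derivative on the interval; composed with the
  projection onto the interval, which is 1-Lipschitz, it becomes globally Lipschitz.\<close>

lemma Lipschitz_approx_on_interval:
  fixes f :: "real \<Rightarrow> real"
  assumes "continuous_on UNIV f" "0 < e" "0 \<le> R"
  shows "\<exists>L g. Lipschitz L g \<and> (\<forall>x. \<bar>f (max (-R) (min R x)) - g x\<bar> < e)"
proof -
  have cf: "continuous_on {-R..R} f" by (rule continuous_on_subset[OF assms(1)]) simp
  obtain p where p: "real_polynomial_function p" "\<And>x. x \<in> {-R..R} \<Longrightarrow> \<bar>f x - p x\<bar> < e"
    by (rule Stone_Weierstrass_real_polynomial_function[OF compact_Icc cf assms(2)]) blast
  obtain p' where p': "real_polynomial_function p'" "\<And>x. (p has_real_derivative p' x) (at x)"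
    using has_real_derivative_polynomial_function[OF p(1)] by blast
  have "compact (p' ` {-R..R})"
    by (intro compact_continuous_image continuous_on_polymonial_function compact_Icc)
       (use p'(1) in \<open>simp add: real_polynomial_function_eq\<close>)
  then obtain L where L: "0 < L" "\<And>x. x \<in> {-R..R} \<Longrightarrow> \<bar>p' x\<bar> \<le> L"
    using compact_imp_bounded[of "p' ` {-R..R}"] by (auto simp: bounded_pos)
  define cl where "cl x = max (-R) (min R x)" for x :: real
  have cl: "cl x \<in> {-R..R}" "\<bar>cl x - cl y\<bar> \<le> \<bar>x - y\<bar>" for x y
    using assms(3) by (auto simp: cl_def)
  have "\<bar>p (cl x) - p (cl y)\<bar> \<le> L * \<bar>x - y\<bar>" for x y
  proof -
    have "norm (p (cl x) - p (cl y)) \<le> L * norm (cl x - cl y)"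
      by (rule field_differentiable_bound[where S="{-R..R}" and f'=p'])
         (use cl L p' in \<open>auto intro: has_field_derivative_at_within\<close>)
    also have "\<dots> \<le> L * \<bar>x - y\<bar>" using cl(2)[of x y] L by (intro mult_left_mono) auto
    finally show ?thesis by simp
  qed
  then have "Lipschitz L (\<lambda>x. p (cl x))" using L by (simp add: Lipschitz_def)
  moreover have "\<bar>f (cl x) - p (cl x)\<bar> < e" for x by (rule p(2)[OF cl(1)])
  ultimately show ?thesis unfolding cl_def by blast
qed

text \<open>The exponent depends on \<open>f\<close> alone, because it decides which moments have to
  be bounded before \<delta> is chosen. One power more than the growth of \<open>f\<close> suffices:
  outside the interval the surplus factor \<open>\<bar>x\<bar> > R\<close> turns a fixed constant
  into a small one.\<close>

lemma Lipschitz_approx: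
  fixes f :: "real \<Rightarrow> real"
  assumes "f \<in> C_pol"
  shows "\<exists>m. \<forall>\<delta>>0. \<exists>L g. Lipschitz L g \<and> (\<forall>x. \<bar>f x - g x\<bar> \<le> \<delta> * (1 + \<bar>x\<bar> ^ m))"
proof -
  from assms obtain c m where c: "c \<ge> 0" "\<And>x. \<bar>f x\<bar> \<le> c * (1 + norm x ^ m)" by (rule C_polE) blast
  have "\<exists>L g. Lipschitz L g \<and> (\<forall>x. \<bar>f x - g x\<bar> \<le> \<delta> * (1 + \<bar>x\<bar> ^ Suc m))" if \<delta>: "\<delta> > 0" for \<delta>
  proof -
    \<comment> \<open>The lower bound 1 gives \<open>1 \<le> \<bar>x\<bar> ^ m\<close> outside the
      interval. There \<open>f\<close> varies by at most \<open>4 * c * \<bar>x\<bar> ^ m\<close>,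
      and the second entry makes \<open>4 * c\<close> at most \<delta> times
      \<open>R\<close>.\<close>
    define R where "R = max 1 (4 * c / \<delta>)"
    have R: "1 \<le> R" "4 * c \<le> \<delta> * R" using \<delta> by (auto simp: R_def max_def field_simps)
    obtain L g where g: "Lipschitz L g" "\<And>x. \<bar>f (max (-R) (min R x)) - g x\<bar> < \<delta>"
      using Lipschitz_approx_on_interval[OF C_pol_continuous[OF assms] \<delta>, of R] R by auto
    have "\<bar>f x - g x\<bar> \<le> \<delta> * (1 + \<bar>x\<bar> ^ Suc m)" for x
    proof (cases "\<bar>x\<bar> \<le> R")
      case True
      then have "max (-R) (min R x) = x" by auto
      with g(2)[of x] have "\<bar>f x - g x\<bar> \<le> \<delta>" by simp
      then show ?thesis using \<delta> by (simp add: algebra_simps add_increasing2)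
    next
      case False
      let ?y = "max (-R) (min R x)"
      have y: "\<bar>?y\<bar> \<le> \<bar>x\<bar>" using False R by auto
      have x1: "1 \<le> \<bar>x\<bar> ^ m" using False R by (intro one_le_power) auto
      have "\<bar>f x - f ?y\<bar> \<le> c * (1 + \<bar>x\<bar> ^ m) + c * (1 + \<bar>?y\<bar> ^ m)"
        using c(2)[of x] c(2)[of ?y] by (simp add: abs_triangle_ineq4[THEN order_trans])
      also have "\<dots> \<le> c * (1 + \<bar>x\<bar> ^ m) + c * (1 + \<bar>x\<bar> ^ m)"
        using c(1) y by (intro add_left_mono mult_left_mono power_mono) auto
      also have "\<dots> \<le> c * (2 * \<bar>x\<bar> ^ m) + c * (2 * \<bar>x\<bar> ^ m)"
        using c(1) x1 by (intro add_mono mult_left_mono) auto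
      also have "\<dots> = (4 * c) * \<bar>x\<bar> ^ m" by simp
      also have "\<dots> \<le> (\<delta> * R) * \<bar>x\<bar> ^ m" using R by (intro mult_right_mono) auto
      also have "\<dots> \<le> (\<delta> * \<bar>x\<bar>) * \<bar>x\<bar> ^ m"
        using False \<delta> by (intro mult_right_mono mult_left_mono) auto
      finally have "\<bar>f x - f ?y\<bar> \<le> \<delta> * \<bar>x\<bar> ^ Suc m" by (simp add: mult.assoc)
      then have "\<bar>f x - g x\<bar> \<le> \<delta> * \<bar>x\<bar> ^ Suc m + \<delta>" using g(2)[of x] by linarith
      then show ?thesis by (simp add: algebra_simps)
    qed
    with g(1) show ?thesis by blast
  qed
  then show ?thesis by blast
qed

section \<open>The stationary distribution\<close>

locale bar_model_stationary = bar_model_moments +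
  fixes \<mu> :: "real measure"
  assumes stationary: "stationary_distribution (bar_Q \<alpha>\<^sub>0 \<alpha>\<^sub>1 \<beta>\<^sub>0 \<beta>\<^sub>1 \<sigma>) \<mu>"
begin

lemma prob_space_\<mu>: "prob_space \<mu>"
  using stationary by (simp add: stationary_distribution_def)

lemma sets_\<mu> [measurable_cong, simp]: "sets \<mu> = sets borel"
  using stationary by (simp add: stationary_distribution_def)

lemma space_\<mu> [simp]: "space \<mu> = UNIV"
  using sets_eq_imp_space_eq[OF sets_\<mu>] by simp

sublocale \<mu>: prob_space \<mu>
  by (rule prob_space_\<mu>)

section \<open>Stationarity as invariance under a random map\<close>

lemma daughter_measurable [measurable (raw)]:
  assumes "f \<in> borel_measurable N" "g \<in> borel_measurable N"
  shows "(\<lambda>x. daughter b (f x) (g x)) \<in> borel_measurable N"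
  using assms unfolding daughter_def by (cases b) simp_all

lemma nn_integral_normal_shift:
  fixes f :: "real \<Rightarrow> ennreal"
  assumes [measurable]: "f \<in> borel_measurable borel"
  shows "(\<integral>\<^sup>+ y. normal_density m \<sigma> y * f y \<partial>lborel) = (\<integral>\<^sup>+ w. f (m + w $ i) \<partial>\<nu>0)"
proof -
  have "(\<integral>\<^sup>+ w. f (m + w $ i) \<partial>\<nu>0) = (\<integral>\<^sup>+ y. f (m + y) \<partial>distr \<nu>0 borel (\<lambda>w. w $ i))"
    by (subst nn_integral_distr) auto
  also have "\<dots> = (\<integral>\<^sup>+ y. f (m + y) \<partial>density lborel (normal_density 0 \<sigma>))"
    unfolding \<nu>0_def using sigma_pos rho_bounds by (subst noise_marginal) auto
  also have "\<dots> = (\<integral>\<^sup>+ y. normal_density 0 \<sigma> y * f (m + y) \<partial>lborel)"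
    by (subst nn_integral_density) auto
  also have "\<dots> = (\<integral>\<^sup>+ y. normal_density m \<sigma> y * f y \<partial>lborel)"
    by (subst (2) nn_integral_real_affine[where c=1 and t=m]) (auto simp: normal_density_def)
  finally show ?thesis by simp
qed

text \<open>The mixture of two normal laws arises from a noise pair and a fair coin that selects the
  daughter. Each daughter uses one coordinate of the pair, so only the marginals of the noise
  matter.\<close>

lemma nn_integral_bar_Q:
  fixes f :: "real \<Rightarrow> ennreal"
  assumes [measurable]: "f \<in> borel_measurable borel"
  shows "(\<integral>\<^sup>+ y. f y \<partial>bar_Q \<alpha>\<^sub>0 \<alpha>\<^sub>1 \<beta>\<^sub>0 \<beta>\<^sub>1 \<sigma> x)
      = (\<integral>\<^sup>+ w. (\<integral>\<^sup>+ b. f (daughter b x w) \<partial>measure_pmf (bernoulli_pmf (1 / 2))) \<partial>\<nu>0)"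
proof -
  have half: "ennreal (1 / 2 * a + 1 / 2 * b) * c = ennreal (1 / 2) * (ennreal a * c) + ennreal (1 / 2) * (ennreal b * c)"
    if "0 \<le> a" "0 \<le> b" for a b c
  proof -
    have "ennreal (1 / 2 * a + 1 / 2 * b) = ennreal (1 / 2) * ennreal a + ennreal (1 / 2) * ennreal b"
      using that by (subst ennreal_plus, simp, simp, subst (1 2) ennreal_mult) auto
    then show ?thesis by (simp only: distrib_right mult.assoc)
  qed
  have "(\<integral>\<^sup>+ y. f y \<partial>bar_Q \<alpha>\<^sub>0 \<alpha>\<^sub>1 \<beta>\<^sub>0 \<beta>\<^sub>1 \<sigma> x)
      = (\<integral>\<^sup>+ y. ennreal (1 / 2) * (normal_density (\<alpha>\<^sub>0 * x + \<beta>\<^sub>0) \<sigma> y * f y)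
          + ennreal (1 / 2) * (normal_density (\<alpha>\<^sub>1 * x + \<beta>\<^sub>1) \<sigma> y * f y) \<partial>lborel)"
    unfolding bar_Q_def by (subst nn_integral_density) (measurable, simp only: half normal_density_nonneg)
  also have "\<dots> = ennreal (1 / 2) * (\<integral>\<^sup>+ w. f (daughter False x w) \<partial>\<nu>0) + ennreal (1 / 2) * (\<integral>\<^sup>+ w. f (daughter True x w) \<partial>\<nu>0)"
    by (subst nn_integral_add)
       (auto simp: nn_integral_cmult nn_integral_normal_shift[of f "\<alpha>\<^sub>0 * x + \<beta>\<^sub>0" 1]
         nn_integral_normal_shift[of f "\<alpha>\<^sub>1 * x + \<beta>\<^sub>1" 2] daughter_def)
  also have "\<dots> = (\<integral>\<^sup>+ w. (\<integral>\<^sup>+ b. f (daughter b x w) \<partial>measure_pmf (bernoulli_pmf (1 / 2))) \<partial>\<nu>0)"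
    by (simp add: nn_integral_add nn_integral_cmult nn_integral_multc mult.commute add.commute)
  finally show ?thesis .
qed

definition kernel_noise :: "((real ^ 2) \<times> bool) measure" where
  "kernel_noise = \<nu>0 \<Otimes>\<^sub>M measure_pmf (bernoulli_pmf (1 / 2))"

lemma sets_kernel_noise [measurable_cong]: "sets kernel_noise = sets (borel \<Otimes>\<^sub>M count_space UNIV)"
  unfolding kernel_noise_def by (intro sets_pair_measure_cong) auto

lemma prob_space_kernel_noise: "prob_space kernel_noise"
proof -
  interpret P: pair_prob_space \<nu>0 "measure_pmf (bernoulli_pmf (1 / 2))" ..
  show ?thesis unfolding kernel_noise_def by (rule P.prob_space_axioms)
qed

definition chain_step :: "real \<times> ((real ^ 2) \<times> bool) \<Rightarrow> real" where
  "chain_step p = daughter (snd (snd p)) (fst p) (fst (snd p))"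

lemma chain_step_measurable [measurable]: "chain_step \<in> borel_measurable (borel \<Otimes>\<^sub>M (borel \<Otimes>\<^sub>M count_space UNIV))"
  unfolding chain_step_def daughter_def by measurable

text \<open>Stationarity rewritten as an equality of image measures. Change of variables and Fubini
  then extend it from sets to integrable functions.\<close>

lemma distr_chain_step: "distr (\<mu> \<Otimes>\<^sub>M kernel_noise) borel chain_step = \<mu>"
proof (rule measure_eqI)
  interpret K: prob_space kernel_noise by (rule prob_space_kernel_noise)
  interpret P: pair_prob_space \<nu>0 "measure_pmf (bernoulli_pmf (1 / 2))" ..
  fix B assume "B \<in> sets (distr (\<mu> \<Otimes>\<^sub>M kernel_noise) borel chain_step)"
  then have B[measurable]: "B \<in> sets borel" by simp
  have "emeasure (distr (\<mu> \<Otimes>\<^sub>M kernel_noise) borel chain_step) B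
      = (\<integral>\<^sup>+ y. indicator B y \<partial>distr (\<mu> \<Otimes>\<^sub>M kernel_noise) borel chain_step)" by simp
  also have "\<dots> = (\<integral>\<^sup>+ p. indicator B (chain_step p) \<partial>(\<mu> \<Otimes>\<^sub>M kernel_noise))"
    by (subst nn_integral_distr) auto
  also have "\<dots> = (\<integral>\<^sup>+ x. (\<integral>\<^sup>+ q. indicator B (chain_step (x, q)) \<partial>kernel_noise) \<partial>\<mu>)"
    by (rule K.nn_integral_fst[symmetric]) measurable
  also have "\<dots> = (\<integral>\<^sup>+ x. (\<integral>\<^sup>+ w. (\<integral>\<^sup>+ b. indicator B (daughter b x w) \<partial>measure_pmf (bernoulli_pmf (1 / 2))) \<partial>\<nu>0) \<partial>\<mu>)"
  proof (rule nn_integral_cong)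
    fix x
    have "(\<lambda>q. indicator B (chain_step (x, q)) :: ennreal) \<in> borel_measurable (\<nu>0 \<Otimes>\<^sub>M measure_pmf (bernoulli_pmf (1 / 2)))"
      unfolding kernel_noise_def[symmetric] by measurable
    from measure_pmf.nn_integral_fst[OF this]
    show "(\<integral>\<^sup>+ q. indicator B (chain_step (x, q)) \<partial>kernel_noise)
        = (\<integral>\<^sup>+ w. (\<integral>\<^sup>+ b. indicator B (daughter b x w) \<partial>measure_pmf (bernoulli_pmf (1 / 2))) \<partial>\<nu>0)"
      unfolding kernel_noise_def by (simp add: chain_step_def)
  qed
  also have "\<dots> = (\<integral>\<^sup>+ x. emeasure (bar_Q \<alpha>\<^sub>0 \<alpha>\<^sub>1 \<beta>\<^sub>0 \<beta>\<^sub>1 \<sigma> x) B \<partial>\<mu>)"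
    by (subst nn_integral_bar_Q[symmetric]) (auto simp: bar_Q_def)
  also have "\<dots> = emeasure \<mu> B"
    using stationary by (simp add: stationary_distribution_def)
  finally show "emeasure (distr (\<mu> \<Otimes>\<^sub>M kernel_noise) borel chain_step) B = emeasure \<mu> B" .
qed simp

definition avg_daughters :: "(real \<Rightarrow> real) \<Rightarrow> real \<times> (real ^ 2) \<Rightarrow> real" where
  "avg_daughters f p = (f (daughter False (fst p) (snd p)) + f (daughter True (fst p) (snd p))) / 2"

text \<open>Integration of \<open>f\<close> against \<open>bar_Q\<close>, written over the noise so
  that chains from different starting points can be driven by the same noise.\<close>

definition Q_op :: "(real \<Rightarrow> real) \<Rightarrow> real \<Rightarrow> real" where
  "Q_op f x = (\<integral>w. avg_daughters f (x, w) \<partial>\<nu>0)"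

lemma integral_stationary:
  assumes [measurable]: "f \<in> borel_measurable borel" and int: "integrable \<mu> f"
  shows "(\<integral>x. f x \<partial>\<mu>) = (\<integral>x. Q_op f x \<partial>\<mu>)" "integrable \<mu> (Q_op f)"
proof -
  interpret K: prob_space kernel_noise by (rule prob_space_kernel_noise)
  interpret P: pair_prob_space \<nu>0 "measure_pmf (bernoulli_pmf (1 / 2))" ..
  interpret PK: pair_prob_space \<mu> kernel_noise ..
  have m: "(\<lambda>p. f (chain_step p)) \<in> borel_measurable (\<mu> \<Otimes>\<^sub>M kernel_noise)" by measurable
  have i: "integrable (\<mu> \<Otimes>\<^sub>M kernel_noise) (\<lambda>p. f (chain_step p))"
    using int by (subst (asm) distr_chain_step[symmetric], subst (asm) integrable_distr_eq) auto
  \<comment> \<open>Only integrability of \<open>f\<close> under \<mu> is assumed, so Fubini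
    guarantees integrable sections for almost every \<open>x\<close> only.\<close>
  have AE: "AE x in \<mu>. (\<integral>q. f (chain_step (x, q)) \<partial>kernel_noise) = Q_op f x"
    using PK.AE_integrable_fst'[OF i]
  proof eventually_elim
    case (elim x)
    have "(\<integral>q. f (chain_step (x, q)) \<partial>kernel_noise)
        = (\<integral>w. (\<integral>b. f (chain_step (x, (w, b))) \<partial>measure_pmf (bernoulli_pmf (1 / 2))) \<partial>\<nu>0)"
      using P.integral_fst'[OF elim[unfolded kernel_noise_def]] unfolding kernel_noise_def by simp
    then show ?case by (simp add: Q_op_def avg_daughters_def chain_step_def add_divide_distrib add.commute)
  qed
  have [measurable]: "Q_op f \<in> borel_measurable \<mu>"
    unfolding Q_op_def[abs_def] avg_daughters_def by measurable
  have "(\<integral>x. f x \<partial>\<mu>) = (\<integral>p. f (chain_step p) \<partial>(\<mu> \<Otimes>\<^sub>M kernel_noise))"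
    by (subst distr_chain_step[symmetric], subst integral_distr) auto
  also have "\<dots> = (\<integral>x. (\<integral>q. f (chain_step (x, q)) \<partial>kernel_noise) \<partial>\<mu>)"
    by (rule PK.integral_fst'[OF i, symmetric])
  also have "\<dots> = (\<integral>x. Q_op f x \<partial>\<mu>)"
    by (rule integral_cong_AE[OF _ _ AE]) measurable
  finally show "(\<integral>x. f x \<partial>\<mu>) = (\<integral>x. Q_op f x \<partial>\<mu>)" .
  show "integrable \<mu> (Q_op f)"
    by (rule integrable_cong_AE[THEN iffD1, OF _ _ AE PK.integrable_fst'[OF i]]) measurable
qed

end

section \<open>Sums over generations\<close>

lemma sum_double_interval:
  fixes g :: "nat \<Rightarrow> 'a::comm_monoid_add"
  assumes "a \<le> b"
  shows "(\<Sum>k\<in>{2 * a..<2 * b}. g k) = (\<Sum>i\<in>{a..<b}. g (2 * i) + g (2 * i + 1))"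
  using assms
proof (induction b rule: dec_induct)
  case (step b)
  have "{2 * a..<2 * Suc b} = insert (2 * b + 1) (insert (2 * b) {2 * a..<2 * b})"
    using step by auto
  then show ?case using step by (simp add: ac_simps)
qed simp

lemma generation_Suc_sum:
  fixes g :: "nat \<Rightarrow> 'a::comm_monoid_add"
  shows "(\<Sum>k\<in>generation (Suc q). g k) = (\<Sum>i\<in>generation q. g (2 * i) + g (2 * i + 1))"
  using sum_double_interval[of "2 ^ q" "2 ^ Suc q" g] by (simp add: generation_def)

lemma card_generation [simp]: "card (generation q) = 2 ^ q"
  by (simp add: generation_def)

lemma finite_generation [simp, intro]: "finite (generation q)"
  by (simp add: generation_def)

lemma generation_ge: "i \<in> generation q \<Longrightarrow> 2 ^ q \<le> i"
  by (simp add: generation_def)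

lemma generation_ge_1: "i \<in> generation q \<Longrightarrow> 1 \<le> i"
  using generation_ge[of i q] one_le_power[of "2::nat" q] by linarith

lemma mean_squared_le:
  assumes "finite I"
  shows "((\<Sum>i\<in>I. y i) / real (card I))\<^sup>2 \<le> (\<Sum>i\<in>I. (y i)\<^sup>2) / real (card I)"
proof (cases "I = {}")
  case False
  then have "real (card I) > 0" using assms by (simp add: card_gt_0_iff)
  then show ?thesis
    using sum_squared_le_sum_of_squares[of y I] by (simp add: power_divide power2_eq_square field_simps)
qed simp

section \<open>Moments of the stationary law\<close>

context bar_model_stationary
begin

lemma prob_UNIV [simp]: "\<nu>0.prob UNIV = 1" "\<mu>.prob UNIV = 1"
  using \<nu>0.prob_space \<mu>.prob_space by simp_all

lemma kernel_moment_le: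
  "(\<integral>w. (\<bar>daughter False x w\<bar> ^ m + \<bar>daughter True x w\<bar> ^ m) / 2 \<partial>\<nu>0) \<le> contr * \<bar>x\<bar> ^ m + noise_moment m"
proof -
  let ?g = "\<lambda>w :: real ^ 2. (1 - contr) * ((drift + norm w) / (1 - contr)) ^ m"
  have "(\<integral>w. (\<bar>daughter False x w\<bar> ^ m + \<bar>daughter True x w\<bar> ^ m) / 2 \<partial>\<nu>0)
      \<le> (\<integral>w. contr * \<bar>x\<bar> ^ m + ?g w \<partial>\<nu>0)"
  proof (rule integral_mono')
    show "integrable \<nu>0 (\<lambda>w. contr * \<bar>x\<bar> ^ m + ?g w)"
      using integrable_noise_moment[of m] by auto
    show "(\<bar>daughter False x w\<bar> ^ m + \<bar>daughter True x w\<bar> ^ m) / 2 \<le> contr * \<bar>x\<bar> ^ m + ?g w" for w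
      using daughter_power_le[of False x w m] daughter_power_le[of True x w m] by simp
    show "0 \<le> contr * \<bar>x\<bar> ^ m + ?g w" for w
      using contr_bounds drift_nonneg by simp
  qed
  also have "\<dots> = contr * \<bar>x\<bar> ^ m + noise_moment m"
    using integrable_noise_moment[of m] by (simp add: noise_moment_def \<nu>0.prob_space)
  finally show ?thesis .
qed

text \<open>Stationarity is only applicable to integrable functions, so it is applied to the truncated
  moment \<open>min (\<bar>x\<bar> ^ m) N\<close>.\<close>

lemma truncated_moment_\<mu>:
  "(\<integral>x. \<bar>x\<bar> ^ m * indicator {x. \<bar>x\<bar> ^ m \<le> real N} x \<partial>\<mu>) \<le> noise_moment m / (1 - contr)"
proof -
  let ?C = "noise_moment m"
  define V where "V x = min (\<bar>x\<bar> ^ m) (real N)" for x :: real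
  have Vm[measurable]: "V \<in> borel_measurable borel" unfolding V_def by measurable
  have V: "0 \<le> V x" "V x \<le> real N" "V x \<le> \<bar>x\<bar> ^ m" for x by (auto simp: V_def)
  have Vi: "integrable \<mu> V"
    by (rule \<mu>.integrable_const_bound[where B="real N"]) (use V in auto)
  \<comment> \<open>An upper bound for \<open>Q_op V\<close>, cut at the same level as
    \<open>V\<close>. The cut keeps it integrable and makes \<open>V - U\<close> nonnegative where
    the moment exceeds the level.\<close>
  define U where "U x = min (contr * \<bar>x\<bar> ^ m + ?C) (real N)" for x :: real
  have [measurable]: "U \<in> borel_measurable borel" unfolding U_def by measurable
  have U0: "0 \<le> U x" "U x \<le> real N" for x
    using contr_bounds noise_moment_nonneg[of m] by (auto simp: U_def)
  have Ui: "integrable \<mu> U"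
    by (rule \<mu>.integrable_const_bound[where B="real N"]) (use U0 in auto)
  have iV: "integrable \<nu>0 (\<lambda>w. avg_daughters V (x, w))" for x
  proof (rule \<nu>0.integrable_const_bound[where B="real N"], rule AE_I2)
    show "norm (avg_daughters V (x, w)) \<le> real N" for w
      using V(1,2)[of "daughter False x w"] V(1,2)[of "daughter True x w"] by (simp add: avg_daughters_def)
    show "(\<lambda>w. avg_daughters V (x, w)) \<in> borel_measurable \<nu>0"
      unfolding avg_daughters_def fst_conv snd_conv by measurable
  qed
  have QV: "Q_op V x \<le> U x" for x
  proof -
    have "Q_op V x \<le> (\<integral>w. real N \<partial>\<nu>0)"
      unfolding Q_op_def
    proof (rule integral_mono[OF iV])
      fix w show "avg_daughters V (x, w) \<le> real N"
        using V(2)[of "daughter False x w"] V(2)[of "daughter True x w"] by (simp add: avg_daughters_def)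
    qed simp
    then have 1: "Q_op V x \<le> real N" using \<nu>0.prob_space by simp
    have pi: "integrable \<nu>0 (\<lambda>w. \<bar>daughter b x w\<bar> ^ m)" for b
    proof (rule Bochner_Integration.integrable_bound)
      show "integrable \<nu>0 (\<lambda>w. contr * \<bar>x\<bar> ^ m + (1 - contr) * ((drift + norm w) / (1 - contr)) ^ m)"
        using integrable_noise_moment[of m] by auto
    qed (use daughter_power_le in \<open>auto intro!: AE_I2 order_trans[OF _ abs_ge_self]\<close>)
    have "Q_op V x \<le> (\<integral>w. (\<bar>daughter False x w\<bar> ^ m + \<bar>daughter True x w\<bar> ^ m) / 2 \<partial>\<nu>0)"
      unfolding Q_op_def
    proof (rule integral_mono[OF iV])
      fix w show "avg_daughters V (x, w) \<le> (\<bar>daughter False x w\<bar> ^ m + \<bar>daughter True x w\<bar> ^ m) / 2"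
        using V(3)[of "daughter False x w"] V(3)[of "daughter True x w"] by (simp add: avg_daughters_def)
    qed (use pi in auto)
    with 1 kernel_moment_le[of x m] show ?thesis by (simp add: U_def)
  qed
  have "(\<integral>x. V x \<partial>\<mu>) \<le> (\<integral>x. U x \<partial>\<mu>)"
    unfolding integral_stationary(1)[OF Vm Vi]
    by (intro integral_mono integral_stationary(2)[OF Vm Vi] Ui QV)
  then have neg: "(\<integral>x. V x - U x \<partial>\<mu>) \<le> 0" using Vi Ui by simp
  let ?I = "\<lambda>x. \<bar>x\<bar> ^ m * indicator {x. \<bar>x\<bar> ^ m \<le> real N} x"
  have Ii: "integrable \<mu> ?I"
    by (rule \<mu>.integrable_const_bound[where B="real N"]) (auto simp: indicator_def)
  have lower: "(1 - contr) * ?I x - ?C \<le> V x - U x" for x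
  proof (cases "\<bar>x\<bar> ^ m \<le> real N")
    case True
    then show ?thesis by (simp add: V_def U_def algebra_simps)
  next
    case False
    then show ?thesis using noise_moment_nonneg[of m] by (simp add: V_def U_def)
  qed
  have "(1 - contr) * (\<integral>x. ?I x \<partial>\<mu>) - ?C = (\<integral>x. (1 - contr) * ?I x - ?C \<partial>\<mu>)"
    using Ii \<mu>.prob_space by simp
  also have "\<dots> \<le> (\<integral>x. V x - U x \<partial>\<mu>)"
    using Ii Vi Ui lower by (intro integral_mono) auto
  finally have "(1 - contr) * (\<integral>x. ?I x \<partial>\<mu>) \<le> ?C" using neg by linarith
  then show ?thesis using contr_bounds by (simp add: field_simps)
qed

text \<open>The bound on the truncated moments does not depend on the truncation level, so Fatou's
  lemma passes it to the limit.\<close>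

lemma integrable_moment_\<mu>: "integrable \<mu> (\<lambda>x. \<bar>x\<bar> ^ m)"
proof (rule integrableI_bounded)
  let ?c = "noise_moment m / (1 - contr)"
  let ?I = "\<lambda>N x. \<bar>x\<bar> ^ m * indicator {x. \<bar>x\<bar> ^ m \<le> real N} x"
  have bound: "(\<integral>\<^sup>+ x. ennreal (?I N x) \<partial>\<mu>) \<le> ennreal ?c" for N
  proof -
    have "integrable \<mu> (?I N)"
      by (rule \<mu>.integrable_const_bound[where B="real N"]) (auto simp: indicator_def)
    then have "(\<integral>\<^sup>+ x. ennreal (?I N x) \<partial>\<mu>) = ennreal (\<integral>x. ?I N x \<partial>\<mu>)"
      by (intro nn_integral_eq_integral) auto
    also have "\<dots> \<le> ennreal ?c" by (intro ennreal_leI truncated_moment_\<mu>)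
    finally show ?thesis .
  qed
  have "(\<integral>\<^sup>+ x. ennreal (norm (\<bar>x\<bar> ^ m)) \<partial>\<mu>) \<le> (\<integral>\<^sup>+ x. liminf (\<lambda>N. ennreal (?I N x)) \<partial>\<mu>)"
  proof (rule nn_integral_mono)
    fix x :: real
    obtain N0 where N0: "\<bar>x\<bar> ^ m \<le> real N0" using real_arch_simple by blast
    have "ennreal (norm (\<bar>x\<bar> ^ m)) \<le> liminf (\<lambda>N. ennreal (?I N x))"
      by (rule Liminf_bounded, rule eventually_sequentiallyI[of N0])
         (use N0 in \<open>auto simp: indicator_def\<close>)
    then show "ennreal (norm (\<bar>x\<bar> ^ m)) \<le> liminf (\<lambda>N. ennreal (?I N x))" .
  qed
  also have "\<dots> \<le> liminf (\<lambda>N. \<integral>\<^sup>+ x. ennreal (?I N x) \<partial>\<mu>)"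
    by (rule nn_integral_liminf) measurable
  also have "\<dots> \<le> ennreal ?c"
    by (rule order_trans[OF Liminf_le_Limsup Limsup_bounded]) (auto intro!: always_eventually bound)
  also have "\<dots> < \<infinity>" by simp
  finally show "(\<integral>\<^sup>+ x. ennreal (norm (\<bar>x\<bar> ^ m)) \<partial>\<mu>) < \<infinity>" .
qed measurable

lemma integrable_\<mu>: "f \<in> C_pol \<Longrightarrow> integrable \<mu> f"
  by (rule integrable_C_pol[OF \<mu>.finite_measure_axioms sets_\<mu>]) (auto intro: integrable_moment_\<mu>)

section \<open>Law of large numbers over generations\<close>

lemma abs_daughter_le_norm: "\<bar>daughter b (fst p) (snd p)\<bar> \<le> 2 * norm p + drift"
proof -
  have "\<bar>daughter b (fst p) (snd p)\<bar> \<le> contr * \<bar>fst p\<bar> + (drift + norm (snd p))" by (rule abs_daughter_le)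
  also have "\<dots> \<le> 1 * norm p + (drift + norm p)"
    using contr_bounds norm_fst_le[of "fst p" "snd p"] norm_snd_le[of "snd p" "fst p"]
    by (intro add_mono mult_mono) auto
  finally show ?thesis by simp
qed

lemma C_pol_daughter:
  assumes "f \<in> C_pol"
  shows "(\<lambda>p. f (daughter b (fst p) (snd p))) \<in> C_pol"
proof (rule C_pol_comp[OF assms])
  show "continuous_on UNIV (\<lambda>p. daughter b (fst p) (snd p))"
    unfolding daughter_def by (cases b) (auto intro!: continuous_intros)
  fix p :: "real \<times> (real ^ 2)"
  have "\<bar>daughter b (fst p) (snd p)\<bar> \<le> 2 * norm p + drift" by (rule abs_daughter_le_norm)
  also have "\<dots> \<le> (2 + drift) * (1 + norm p)"
    using drift_nonneg by (simp add: algebra_simps)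
  finally show "norm (daughter b (fst p) (snd p)) \<le> (2 + drift) * (1 + norm p)" by simp
qed

lemma C_pol_avg_daughters: "f \<in> C_pol \<Longrightarrow> avg_daughters f \<in> C_pol"
  unfolding avg_daughters_def divide_inverse
  by (intro C_pol_mult C_pol_add C_pol_daughter C_pol_const)

lemma C_pol_Q_op: "f \<in> C_pol \<Longrightarrow> Q_op f \<in> C_pol"
  unfolding Q_op_def by (intro C_pol_integral_\<nu>0 C_pol_avg_daughters)

text \<open>The factor \<open>c\<close> carries the normalisation: \<open>1 / 2 ^ q\<close> for
  means over generations and \<open>1 / sqrt n\<close> in the central limit theorem.\<close>

lemma centered_minus_integral:
  assumes "F \<in> C_pol"
  shows "centered (\<lambda>p. c * (F p - (\<integral>w. F (fst p, w) \<partial>\<nu>0)))"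
  unfolding centered_def
proof (intro conjI allI)
  show "(\<lambda>p. c * (F p - (\<integral>w. F (fst p, w) \<partial>\<nu>0))) \<in> C_pol"
    by (intro C_pol_cmult C_pol_diff assms C_pol_fst C_pol_integral_\<nu>0)
  fix x
  have "integrable \<nu>0 (\<lambda>w. F (x, w))" by (intro integrable_\<nu>0 C_pol_section assms)
  then show "(\<integral>w. c * (F (x, w) - (\<integral>w'. F (fst (x, w), w') \<partial>\<nu>0)) \<partial>\<nu>0) = 0"
    using \<nu>0.prob_space by simp
qed

lemma X_generation_past:
  assumes "i \<in> generation q"
  shows "X i \<in> borel_measurable (past (2 ^ q))"
  using assms generation_ge_1[OF assms] by (intro X_past) (auto simp: generation_def)

text \<open>All values in generation \<open>q\<close> are known before the noise of its first vertex
  \<open>2 ^ q\<close> is drawn, so the mean of \<open>g\<close> plays the role of the starting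
  variable \<open>Y\<close>. The lemma serves twice: \<open>F\<close> is the average over two
  daughters, or a function of mother and daughters.\<close>

lemma second_moment_generation_step:
  assumes F: "F \<in> C_pol" and g: "g \<in> C_pol"
  defines "D \<equiv> \<lambda>p. F p - (\<integral>w. F (fst p, w) \<partial>\<nu>0)"
  shows "(\<integral>\<omega>. ((\<Sum>i\<in>generation q. g (X i \<omega>)) / 2 ^ q - c + (\<Sum>i\<in>generation q. D (X i \<omega>, W i \<omega>)) / 2 ^ q)\<^sup>2 \<partial>M)
    = (\<integral>\<omega>. ((\<Sum>i\<in>generation q. g (X i \<omega>)) / 2 ^ q - c)\<^sup>2 \<partial>M)
      + (\<Sum>i\<in>generation q. \<integral>\<omega>. (D (X i \<omega>, W i \<omega>))\<^sup>2 \<partial>M) / (2 ^ q)\<^sup>2"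
proof -
  define Y where "Y \<omega> = (\<Sum>i\<in>generation q. g (X i \<omega>)) / 2 ^ q - c" for \<omega>
  have Yp: "Y \<in> borel_measurable (past (2 ^ q))"
    unfolding Y_def
    by (intro borel_measurable_diff borel_measurable_divide borel_measurable_sum borel_measurable_const
        measurable_compose[OF X_generation_past C_pol_measurable[OF g]])
  have "integrable M (\<lambda>\<omega>. (Y \<omega>)\<^sup>2)"
  proof -
    have sq: "integrable M (\<lambda>\<omega>. (\<Sum>i\<in>I. g (X i \<omega>))\<^sup>2)" if "I \<subseteq> generation q" "finite I" for I
    proof -
      have "integrable M (\<lambda>\<omega>. g (X i \<omega>) * g (X j \<omega>))" if "i \<in> generation q" "j \<in> generation q" for i j
        using that[THEN generation_ge_1] integrable_X[OF C_pol_power[OF g, of 2]]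
        by (intro integrable_mult_of_squares measurable_compose[OF X_measurable C_pol_measurable[OF g]]) auto
      then show ?thesis
        using that(1) unfolding power2_eq_square sum_product
        by (intro Bochner_Integration.integrable_sum) auto
    qed
    have s1: "integrable M (\<lambda>\<omega>. \<Sum>i\<in>generation q. g (X i \<omega>))"
      by (intro Bochner_Integration.integrable_sum integrable_X[OF g] generation_ge_1)
    have "integrable M (\<lambda>\<omega>. (\<Sum>i\<in>generation q. g (X i \<omega>))\<^sup>2 / (2 ^ q)\<^sup>2 - 2 * c / 2 ^ q * (\<Sum>i\<in>generation q. g (X i \<omega>)) + c\<^sup>2)"
      using sq[of "generation q"] s1
      by (intro Bochner_Integration.integrable_add Bochner_Integration.integrable_diff integrable_divide integrable_mult_right) auto
    then show ?thesis
      unfolding Y_def by (simp add: power2_diff power_divide algebra_simps)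
  qed
  note main = second_moment_martingale_sum[OF centered_minus_integral[OF F, of "1 / 2 ^ q"] Yp this, of "generation q"]
  have "(\<integral>\<omega>. (Y \<omega> + (\<Sum>i\<in>generation q. D (X i \<omega>, W i \<omega>)) / 2 ^ q)\<^sup>2 \<partial>M)
    = (\<integral>\<omega>. (Y \<omega>)\<^sup>2 \<partial>M) + (\<Sum>i\<in>generation q. \<integral>\<omega>. (D (X i \<omega>, W i \<omega>) / 2 ^ q)\<^sup>2 \<partial>M)"
    using main generation_ge[of _ q] by (auto simp: D_def sum_divide_distrib)
  also have "(\<Sum>i\<in>generation q. \<integral>\<omega>. (D (X i \<omega>, W i \<omega>) / 2 ^ q)\<^sup>2 \<partial>M)
      = (\<Sum>i\<in>generation q. \<integral>\<omega>. (D (X i \<omega>, W i \<omega>))\<^sup>2 \<partial>M) / (2 ^ q)\<^sup>2"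
    by (simp add: power_divide sum_divide_distrib)
  finally show ?thesis unfolding Y_def .
qed

text \<open>Bounds the innovation variance of a function with Lipschitz constant 1, uniformly over
  the mother's value.\<close>

definition noise_spread :: real where
  "noise_spread = (\<integral>w. (norm w + (\<integral>w'. norm w' \<partial>\<nu>0))\<^sup>2 \<partial>\<nu>0)"

lemma Lipschitz_daughter:
  assumes "Lipschitz L f"
  shows "\<bar>f (daughter b x w) - f (daughter b y v)\<bar> \<le> L * (contr * \<bar>x - y\<bar> + norm (w - v))"
proof -
  have "\<bar>daughter b x w - daughter b y v\<bar> \<le> contr * \<bar>x - y\<bar> + norm (w - v)"
  proof -
    have t: "\<bar>a * x + c + w $ i - (a * y + c + v $ i)\<bar> \<le> contr * \<bar>x - y\<bar> + norm (w - v)"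
      if "\<bar>a\<bar> \<le> contr" for a c i
    proof -
      have "\<bar>a * x + c + w $ i - (a * y + c + v $ i)\<bar> = \<bar>a * (x - y) + (w - v) $ i\<bar>"
        by (simp add: algebra_simps)
      also have "\<dots> \<le> \<bar>a\<bar> * \<bar>x - y\<bar> + norm (w - v)"
        by (rule order_trans[OF abs_triangle_ineq]) (simp add: abs_mult component_le_norm_cart del: vector_minus_component)
      also have "\<dots> \<le> contr * \<bar>x - y\<bar> + norm (w - v)"
        using that by (intro add_right_mono mult_right_mono) auto
      finally show ?thesis .
    qed
    have "\<bar>\<alpha>\<^sub>0\<bar> \<le> contr" "\<bar>\<alpha>\<^sub>1\<bar> \<le> contr" by (simp_all add: contr_def)
    from t[OF this(1)] t[OF this(2)] show ?thesis by (cases b) (simp_all only: daughter_def if_True if_False)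
  qed
  then show ?thesis
    using assms by (intro order_trans[OF LipschitzD[OF assms]] mult_left_mono) (auto simp: Lipschitz_def)
qed

lemma Lipschitz_avg_daughters:
  assumes "Lipschitz L f"
  shows "\<bar>avg_daughters f (x, w) - avg_daughters f (y, v)\<bar> \<le> L * (contr * \<bar>x - y\<bar> + norm (w - v))"
proof -
  have "\<bar>(a + b) / 2 - (c + d) / 2\<bar> \<le> e" if "\<bar>a - c\<bar> \<le> e" "\<bar>b - d\<bar> \<le> e" for a b c d e :: real
  proof -
    have eq: "(a + b) / 2 - (c + d) / 2 = ((a - c) + (b - d)) / 2" by (simp add: field_simps)
    have "\<bar>(a - c) + (b - d)\<bar> \<le> e + e" using that by (intro order_trans[OF abs_triangle_ineq] add_mono)
    then show ?thesis unfolding eq by simp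
  qed
  from this[OF Lipschitz_daughter[OF assms] Lipschitz_daughter[OF assms]]
  show ?thesis unfolding avg_daughters_def fst_conv snd_conv .
qed

lemma integrable_avg_daughters:
  "f \<in> C_pol \<Longrightarrow> integrable \<nu>0 (\<lambda>w. avg_daughters f (x, w))"
  by (intro integrable_\<nu>0 C_pol_section C_pol_avg_daughters)

text \<open>Coupling: moved by the same noise, the daughters of \<open>x\<close> and
  \<open>y\<close> differ by at most \<open>contr\<close> times the distance of their
  mothers.\<close>

lemma Lipschitz_Q_op:
  assumes f: "Lipschitz L f"
  shows "Lipschitz (contr * L) (Q_op f)"
  unfolding Lipschitz_def
proof (intro conjI allI)
  show "0 \<le> contr * L" using f contr_bounds by (simp add: Lipschitz_def)
  fix x y
  note i = integrable_avg_daughters[OF Lipschitz_C_pol[OF f]]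
  have "\<bar>Q_op f x - Q_op f y\<bar> = norm (\<integral>w. avg_daughters f (x, w) - avg_daughters f (y, w) \<partial>\<nu>0)"
    unfolding Q_op_def using i by simp
  also have "\<dots> \<le> (\<integral>w. L * (contr * \<bar>x - y\<bar>) \<partial>\<nu>0)"
  proof (rule norm_integral_le)
    show "norm (avg_daughters f (x, w) - avg_daughters f (y, w)) \<le> L * (contr * \<bar>x - y\<bar>)" for w
      using Lipschitz_avg_daughters[OF f, of x w y w] by simp
  qed (use i in auto)
  finally show "\<bar>Q_op f x - Q_op f y\<bar> \<le> contr * L * \<bar>x - y\<bar>"
    using \<nu>0.prob_space by (simp add: ac_simps)
qed

text \<open>For a fixed mother, changing the noise from \<open>v\<close> to \<open>w\<close> moves
  the average by at most \<open>L * norm (w - v)\<close>. The bound is uniform over the vertices and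
  involves \<open>f\<close> only through \<open>L\<close>, so it shrinks along with \<open>L\<close>
  when \<open>Q_op\<close> is iterated.\<close>

lemma Lipschitz_innovation_bound:
  assumes f: "Lipschitz L f" and n: "n \<ge> 1"
  shows "(\<integral>\<omega>. (avg_daughters f (X n \<omega>, W n \<omega>) - Q_op f (X n \<omega>))\<^sup>2 \<partial>M) \<le> L\<^sup>2 * noise_spread"
proof -
  let ?e = "\<integral>w'. norm w' \<partial>\<nu>0"
  have L: "0 \<le> L" using f by (simp add: Lipschitz_def)
  note fC = Lipschitz_C_pol[OF f]
  note i = integrable_avg_daughters[OF fC]
  have ni: "integrable \<nu>0 norm" by (intro integrable_\<nu>0 C_pol_norm)
  have e0: "0 \<le> ?e" by simp
  have pt: "\<bar>avg_daughters f (x, w) - Q_op f x\<bar> \<le> L * (norm w + ?e)" for x w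
  proof -
    have "\<bar>avg_daughters f (x, w) - Q_op f x\<bar> = norm (\<integral>v. avg_daughters f (x, w) - avg_daughters f (x, v) \<partial>\<nu>0)"
      unfolding Q_op_def using i \<nu>0.prob_space by simp
    also have "\<dots> \<le> (\<integral>v. L * (norm w + norm v) \<partial>\<nu>0)"
    proof (rule norm_integral_le)
      fix v
      have "\<bar>avg_daughters f (x, w) - avg_daughters f (x, v)\<bar> \<le> L * norm (w - v)"
        using Lipschitz_avg_daughters[OF f, of x w x v] by simp
      also have "\<dots> \<le> L * (norm w + norm v)" using L by (intro mult_left_mono norm_triangle_ineq4)
      finally show "norm (avg_daughters f (x, w) - avg_daughters f (x, v)) \<le> L * (norm w + norm v)" by simp
    qed (use i ni in auto)
    also have "\<dots> = L * (norm w + ?e)" using ni \<nu>0.prob_space by simp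
    finally show ?thesis .
  qed
  have gC: "(\<lambda>w :: real ^ 2. L\<^sup>2 * (norm w + ?e)\<^sup>2) \<in> C_pol"
    by (intro C_pol_cmult C_pol_power C_pol_add C_pol_norm C_pol_const)
  have gi: "integrable M (\<lambda>\<omega>. L\<^sup>2 * (norm (W n \<omega>) + ?e)\<^sup>2)"
    by (rule integral_W_eq(2)[OF n C_pol_measurable[OF gC] integrable_\<nu>0[OF gC]])
  have "(\<integral>\<omega>. (avg_daughters f (X n \<omega>, W n \<omega>) - Q_op f (X n \<omega>))\<^sup>2 \<partial>M)
      \<le> (\<integral>\<omega>. L\<^sup>2 * (norm (W n \<omega>) + ?e)\<^sup>2 \<partial>M)"
  proof (rule integral_mono'[OF gi])
    fix \<omega>
    have "\<bar>avg_daughters f (X n \<omega>, W n \<omega>) - Q_op f (X n \<omega>)\<bar>\<^sup>2 \<le> (L * (norm (W n \<omega>) + ?e))\<^sup>2"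
      by (intro power_mono pt) auto
    then show "(avg_daughters f (X n \<omega>, W n \<omega>) - Q_op f (X n \<omega>))\<^sup>2 \<le> L\<^sup>2 * (norm (W n \<omega>) + ?e)\<^sup>2"
      by (simp add: power_mult_distrib)
  qed simp
  also have "\<dots> = (\<integral>w. L\<^sup>2 * (norm w + ?e)\<^sup>2 \<partial>\<nu>0)"
    by (rule integral_W_eq(1)[OF n C_pol_measurable[OF gC]])
  also have "\<dots> = L\<^sup>2 * noise_spread" by (simp add: noise_spread_def)
  finally show ?thesis .
qed

definition gen_error :: "(real \<Rightarrow> real) \<Rightarrow> nat \<Rightarrow> real" where
  "gen_error f q = (\<integral>\<omega>. (mean_over X (generation q) f \<omega> - (\<integral>x. f x \<partial>\<mu>))\<^sup>2 \<partial>M)"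

lemma gen_error_nonneg: "0 \<le> gen_error f q"
  by (simp add: gen_error_def)

lemma gen_error_Suc:
  assumes f: "Lipschitz L f"
  shows "gen_error f (Suc q) \<le> gen_error (Q_op f) q + L\<^sup>2 * noise_spread * (1 / 2) ^ q"
proof -
  note fC = Lipschitz_C_pol[OF f]
  define D where "D = (\<lambda>p. avg_daughters f p - (\<integral>w. avg_daughters f (fst p, w) \<partial>\<nu>0))"
  let ?c = "\<integral>x. f x \<partial>\<mu>"
  \<comment> \<open>By stationarity \<open>f\<close> and \<open>Q_op f\<close> share the centering
    constant, so the recursion keeps its target.\<close>
  have c: "?c = (\<integral>x. Q_op f x \<partial>\<mu>)"
    by (rule integral_stationary(1)[OF C_pol_measurable[OF fC] integrable_\<mu>[OF fC]])
  have "mean_over X (generation (Suc q)) f \<omega> - ?c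
      = (\<Sum>i\<in>generation q. Q_op f (X i \<omega>)) / 2 ^ q - ?c + (\<Sum>i\<in>generation q. D (X i \<omega>, W i \<omega>)) / 2 ^ q"
    if \<omega>: "\<omega> \<in> space M" for \<omega>
  proof -
    have "(\<Sum>k\<in>generation (Suc q). f (X k \<omega>)) = (\<Sum>i\<in>generation q. f (X (2 * i) \<omega>) + f (X (2 * i + 1) \<omega>))"
      by (rule generation_Suc_sum)
    also have "\<dots> = (\<Sum>i\<in>generation q. 2 * (Q_op f (X i \<omega>) + D (X i \<omega>, W i \<omega>)))"
    proof (rule sum.cong[OF refl])
      fix i assume "i \<in> generation q"
      from X_daughter[OF generation_ge_1[OF this] \<omega>]
      show "f (X (2 * i) \<omega>) + f (X (2 * i + 1) \<omega>) = 2 * (Q_op f (X i \<omega>) + D (X i \<omega>, W i \<omega>))"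
        by (simp add: D_def Q_op_def avg_daughters_def)
    qed
    also have "\<dots> = 2 * ((\<Sum>i\<in>generation q. Q_op f (X i \<omega>)) + (\<Sum>i\<in>generation q. D (X i \<omega>, W i \<omega>)))"
      by (simp add: sum_distrib_left[symmetric] sum.distrib)
    finally show ?thesis by (simp add: mean_over_def add_divide_distrib)
  qed
  then have "gen_error f (Suc q) = (\<integral>\<omega>. ((\<Sum>i\<in>generation q. Q_op f (X i \<omega>)) / 2 ^ q - ?c + (\<Sum>i\<in>generation q. D (X i \<omega>, W i \<omega>)) / 2 ^ q)\<^sup>2 \<partial>M)"
    unfolding gen_error_def by (intro Bochner_Integration.integral_cong refl) (simp only:)
  also have "\<dots> = gen_error (Q_op f) q + (\<Sum>i\<in>generation q. \<integral>\<omega>. (D (X i \<omega>, W i \<omega>))\<^sup>2 \<partial>M) / (2 ^ q)\<^sup>2"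
    unfolding D_def
    by (subst second_moment_generation_step[OF C_pol_avg_daughters[OF fC] C_pol_Q_op[OF fC]])
       (simp add: gen_error_def mean_over_def c)
  also have "(\<Sum>i\<in>generation q. \<integral>\<omega>. (D (X i \<omega>, W i \<omega>))\<^sup>2 \<partial>M) \<le> (\<Sum>i\<in>generation q. L\<^sup>2 * noise_spread)"
    using Lipschitz_innovation_bound[OF f generation_ge_1]
    by (intro sum_mono) (simp add: D_def Q_op_def)
  also have "(\<Sum>i\<in>generation q. L\<^sup>2 * noise_spread) / (2 ^ q)\<^sup>2 = L\<^sup>2 * noise_spread * (1 / 2) ^ q"
    by (simp add: power2_eq_square power_one_over field_simps)
  finally show ?thesis by (simp add: divide_right_mono)
qed

text \<open>The start of the recursion. Being proportional to the square of the Lipschitz constant,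
  the bound becomes geometrically small when applied to an iterate of \<open>Q_op\<close>.\<close>

lemma gen_error_0:
  assumes f: "Lipschitz L f"
  shows "gen_error f 0 \<le> L\<^sup>2 * (\<integral>\<omega>. (\<bar>X 1 \<omega>\<bar> + (\<integral>y. \<bar>y\<bar> \<partial>\<mu>))\<^sup>2 \<partial>M)"
proof -
  let ?m = "\<integral>y. \<bar>y\<bar> \<partial>\<mu>"
  have L: "0 \<le> L" using f by (simp add: Lipschitz_def)
  note fi = integrable_\<mu>[OF Lipschitz_C_pol[OF f]]
  have ai: "integrable \<mu> abs" using integrable_moment_\<mu>[of 1] by simp
  have pt: "\<bar>f x - (\<integral>y. f y \<partial>\<mu>)\<bar> \<le> L * (\<bar>x\<bar> + ?m)" for x
  proof -
    have "\<bar>f x - (\<integral>y. f y \<partial>\<mu>)\<bar> = norm (\<integral>y. f x - f y \<partial>\<mu>)" using fi \<mu>.prob_space by simp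
    also have "\<dots> \<le> (\<integral>y. L * (\<bar>x\<bar> + \<bar>y\<bar>) \<partial>\<mu>)"
    proof (rule norm_integral_le)
      fix y
      have "\<bar>f x - f y\<bar> \<le> L * \<bar>x - y\<bar>" by (rule LipschitzD[OF f])
      also have "\<dots> \<le> L * (\<bar>x\<bar> + \<bar>y\<bar>)" using L by (intro mult_left_mono) auto
      finally show "norm (f x - f y) \<le> L * (\<bar>x\<bar> + \<bar>y\<bar>)" by simp
    qed (use fi ai in auto)
    also have "\<dots> = L * (\<bar>x\<bar> + ?m)" using ai \<mu>.prob_space by simp
    finally show ?thesis .
  qed
  have gC: "(\<lambda>x. L\<^sup>2 * (\<bar>x\<bar> + ?m)\<^sup>2) \<in> C_pol"
    using C_pol_norm[where 'a=real] by (intro C_pol_cmult C_pol_power C_pol_add C_pol_const) (simp add: real_norm_def[abs_def])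
  have gen0: "generation 0 = {1}" by (auto simp: generation_def)
  have "gen_error f 0 \<le> (\<integral>\<omega>. L\<^sup>2 * (\<bar>X 1 \<omega>\<bar> + ?m)\<^sup>2 \<partial>M)"
    unfolding gen_error_def
  proof (rule integral_mono')
    show "integrable M (\<lambda>\<omega>. L\<^sup>2 * (\<bar>X 1 \<omega>\<bar> + ?m)\<^sup>2)" by (rule integrable_X[OF gC]) simp
    fix \<omega>
    have "\<bar>f (X 1 \<omega>) - (\<integral>y. f y \<partial>\<mu>)\<bar>\<^sup>2 \<le> (L * (\<bar>X 1 \<omega>\<bar> + ?m))\<^sup>2" by (intro power_mono pt) auto
    then show "(mean_over X (generation 0) f \<omega> - (\<integral>x. f x \<partial>\<mu>))\<^sup>2 \<le> L\<^sup>2 * (\<bar>X 1 \<omega>\<bar> + ?m)\<^sup>2"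
      by (simp add: mean_over_def gen0 power_mult_distrib)
  qed simp
  then show ?thesis by simp
qed

lemma gen_error_Lipschitz_tendsto:
  assumes "Lipschitz L f"
  shows "gen_error f \<longlonglongrightarrow> 0"
proof -
  \<comment> \<open>A rate strictly above \<open>contr\<^sup>2\<close>, below 1, and at least 1/2 so
    that it also absorbs the decay of the innovations.\<close>
  define \<gamma> where "\<gamma> = (1 + max (contr\<^sup>2) (1 / 2)) / 2"
  have c2: "contr\<^sup>2 < 1" using contr_bounds by (simp add: power_less_one_iff)
  have \<gamma>: "contr\<^sup>2 < \<gamma>" "1 / 2 \<le> \<gamma>" "\<gamma> < 1" "0 \<le> \<gamma>"
    using c2 by (auto simp: \<gamma>_def max_def)
  have C0: "0 \<le> noise_spread" by (simp add: noise_spread_def)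
  \<comment> \<open>Large enough for the root, and large enough to absorb one innovation term per
    generation: \<open>contr\<^sup>2 * K + noise_spread \<le> \<gamma> * K\<close>.\<close>
  define K where "K = max (\<integral>\<omega>. (\<bar>X 1 \<omega>\<bar> + (\<integral>y. \<bar>y\<bar> \<partial>\<mu>))\<^sup>2 \<partial>M) (noise_spread / (\<gamma> - contr\<^sup>2))"
  have K: "contr\<^sup>2 * K + noise_spread \<le> \<gamma> * K"
  proof -
    have "noise_spread / (\<gamma> - contr\<^sup>2) \<le> K" by (simp add: K_def)
    then show ?thesis using \<gamma>(1) by (simp add: field_simps)
  qed
  \<comment> \<open>Stated for all Lipschitz functions, since the induction hypothesis is applied to
    \<open>Q_op f\<close> with constant \<open>contr * L\<close>.\<close>
  have bound: "gen_error f q \<le> L\<^sup>2 * K * \<gamma> ^ q" if "Lipschitz L f" for q L f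
    using that
  proof (induction q arbitrary: L f)
    case 0
    have "gen_error f 0 \<le> L\<^sup>2 * (\<integral>\<omega>. (\<bar>X 1 \<omega>\<bar> + (\<integral>y. \<bar>y\<bar> \<partial>\<mu>))\<^sup>2 \<partial>M)" by (rule gen_error_0[OF 0])
    also have "\<dots> \<le> L\<^sup>2 * K" by (intro mult_left_mono) (auto simp: K_def)
    finally show ?case by simp
  next
    case (Suc q)
    have "gen_error f (Suc q) \<le> gen_error (Q_op f) q + L\<^sup>2 * noise_spread * (1 / 2) ^ q"
      by (rule gen_error_Suc[OF Suc.prems])
    also have "\<dots> \<le> (contr * L)\<^sup>2 * K * \<gamma> ^ q + L\<^sup>2 * noise_spread * \<gamma> ^ q"
      using \<gamma> C0 by (intro add_mono Suc.IH Lipschitz_Q_op Suc.prems mult_left_mono power_mono) auto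
    also have "\<dots> = (contr\<^sup>2 * K + noise_spread) * (L\<^sup>2 * \<gamma> ^ q)"
      by (simp add: power_mult_distrib algebra_simps)
    also have "\<dots> \<le> (\<gamma> * K) * (L\<^sup>2 * \<gamma> ^ q)" using \<gamma> by (intro mult_right_mono K) auto
    finally show ?case by (simp add: ac_simps)
  qed
  have "(\<lambda>q. L\<^sup>2 * K * \<gamma> ^ q) \<longlonglongrightarrow> L\<^sup>2 * K * 0"
    using \<gamma> by (intro tendsto_mult_left LIMSEQ_realpow_zero) auto
  then have lim: "(\<lambda>q. L\<^sup>2 * K * \<gamma> ^ q) \<longlonglongrightarrow> 0" by simp
  show ?thesis
    by (rule tendsto_sandwich[OF _ _ tendsto_const lim]) (auto intro!: always_eventually bound assms gen_error_nonneg)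
qed

end

section \<open>Averages over subtrees and random permutations\<close>

lemma contraction_tendsto_0:
  fixes s e :: "nat \<Rightarrow> real"
  assumes step: "\<And>r. s (Suc r) \<le> s r / 2 + e r" and e: "e \<longlonglongrightarrow> 0" and s: "\<And>r. 0 \<le> s r"
  shows "s \<longlonglongrightarrow> 0"
proof (rule LIMSEQ_I)
  fix \<epsilon> :: real assume \<epsilon>: "\<epsilon> > 0"
  obtain N where N: "\<And>r. r \<ge> N \<Longrightarrow> \<bar>e r\<bar> < \<epsilon> / 4"
    using LIMSEQ_D[OF e, of "\<epsilon> / 4"] \<epsilon> by auto
  have bound: "s (N + k) \<le> s N * (1 / 2) ^ k + \<epsilon> / 2" for k
  proof (induction k)
    case 0
    then show ?case using \<epsilon> by simp
  next
    case (Suc k)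
    have "s (N + Suc k) \<le> s (N + k) / 2 + e (N + k)" using step[of "N + k"] by simp
    also have "\<dots> \<le> (s N * (1 / 2) ^ k + \<epsilon> / 2) / 2 + \<epsilon> / 4"
      using Suc N[of "N + k"] by (intro add_mono divide_right_mono) (auto simp: abs_less_iff)
    also have "\<dots> = s N * (1 / 2) ^ Suc k + \<epsilon> / 2" by (simp add: field_simps)
    finally show ?case .
  qed
  have "(\<lambda>k. s N * (1 / 2) ^ k) \<longlonglongrightarrow> s N * 0"
    by (intro tendsto_mult_left LIMSEQ_realpow_zero) auto
  then have "(\<lambda>k. s N * (1 / 2) ^ k) \<longlonglongrightarrow> 0" by simp
  from LIMSEQ_D[OF this, of "\<epsilon> / 2"] \<epsilon> obtain K where K: "\<And>k. k \<ge> K \<Longrightarrow> \<bar>s N * (1 / 2) ^ k\<bar> < \<epsilon> / 2" by auto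
  have "norm (s r - 0) < \<epsilon>" if "r \<ge> N + K" for r
  proof -
    have "K \<le> r - N" using that by simp
    from K[OF this] have "s r < \<epsilon>"
      using bound[of "r - N"] that by (auto simp: abs_less_iff)
    then show ?thesis using s[of r] by simp
  qed
  then show "\<exists>no. \<forall>n\<ge>no. norm (s n - 0) < \<epsilon>" by blast
qed

section \<open>Square-integrable variables\<close>

definition sq_int :: "'a measure \<Rightarrow> ('a \<Rightarrow> real) \<Rightarrow> bool" where
  "sq_int M f \<longleftrightarrow> f \<in> borel_measurable M \<and> integrable M (\<lambda>x. (f x)\<^sup>2)"

lemma power2_add_le: "(a + b)\<^sup>2 \<le> 2 * a\<^sup>2 + 2 * (b :: real)\<^sup>2"
  using sum_squares_bound[of a b] by (simp add: power2_sum)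

lemma sq_int_add:
  assumes "sq_int M f" "sq_int M g"
  shows "sq_int M (\<lambda>x. f x + g x)"
proof -
  have [measurable]: "f \<in> borel_measurable M" "g \<in> borel_measurable M"
    using assms by (auto simp: sq_int_def)
  have "integrable M (\<lambda>x. 2 * (f x)\<^sup>2 + 2 * (g x)\<^sup>2)" using assms by (auto simp: sq_int_def)
  then have "integrable M (\<lambda>x. (f x + g x)\<^sup>2)"
    by (rule Bochner_Integration.integrable_bound)
       (auto intro!: AE_I2 order_trans[OF power2_add_le])
  then show ?thesis by (simp add: sq_int_def)
qed

lemma sq_int_cmult: "sq_int M f \<Longrightarrow> sq_int M (\<lambda>x. c * f x)"
  unfolding sq_int_def by (auto simp: power_mult_distrib)

lemma sq_int_divide: "sq_int M f \<Longrightarrow> sq_int M (\<lambda>x. f x / c)"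
  using sq_int_cmult[of M f "inverse c"] by (simp add: divide_inverse mult.commute)

lemma (in finite_measure) sq_int_const: "sq_int M (\<lambda>_. c)"
  by (simp add: sq_int_def)

lemma (in finite_measure) sq_int_sum:
  "(\<And>i. i \<in> I \<Longrightarrow> sq_int M (f i)) \<Longrightarrow> sq_int M (\<lambda>x. \<Sum>i\<in>I. f i x)"
  by (induction I rule: infinite_finite_induct) (auto intro: sq_int_const sq_int_add)

text \<open>The variance of \<open>\<bar>f\<bar>\<close> is nonnegative.\<close>

lemma (in prob_space) expectation_abs_le_sqrt:
  assumes "sq_int M f"
  shows "expectation (\<lambda>x. \<bar>f x\<bar>) \<le> sqrt (expectation (\<lambda>x. (f x)\<^sup>2))"
proof (rule real_le_rsqrt)
  have [measurable]: "f \<in> borel_measurable M" and i2: "integrable M (\<lambda>x. (f x)\<^sup>2)"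
    using assms by (auto simp: sq_int_def)
  have i1: "integrable M (\<lambda>x. \<bar>f x\<bar>)"
    using square_integrable_imp_integrable[OF _ i2] by simp
  let ?e = "expectation (\<lambda>x. \<bar>f x\<bar>)"
  have "0 \<le> expectation (\<lambda>x. (\<bar>f x\<bar> - ?e)\<^sup>2)" by simp
  also have "(\<lambda>x. (\<bar>f x\<bar> - ?e)\<^sup>2) = (\<lambda>x. (f x)\<^sup>2 - 2 * ?e * \<bar>f x\<bar> + ?e\<^sup>2)"
    by (auto simp: power2_diff)
  also have "expectation \<dots> = expectation (\<lambda>x. (f x)\<^sup>2) - ?e\<^sup>2"
    using i1 i2 by (simp add: prob_space power2_eq_square)
  finally show "?e\<^sup>2 \<le> expectation (\<lambda>x. (f x)\<^sup>2)" by simp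
qed

section \<open>Sampling without replacement from a finite set\<close>

lemma sum_permutes_exchangeable:
  fixes a :: "'i \<Rightarrow> real"
  assumes "\<tau> permutes G"
  shows "(\<Sum>p | p permutes G. a (p i) * a (p j)) = (\<Sum>p | p permutes G. a (p (\<tau> i)) * a (p (\<tau> j)))"
  using sum_permutations_compose_right[OF assms, of "\<lambda>p. a (p i) * a (p j)"] by (simp add: comp_def)

text \<open>First \<open>i\<close> is swapped with \<open>i'\<close>, then the image of
  \<open>j\<close> with \<open>j'\<close>. Neither point of the second swap is \<open>i'\<close>, so
  the first assignment survives.\<close>

lemma permutes_two_points:
  assumes "i \<in> G" "j \<in> G" "i \<noteq> j" "i' \<in> G" "j' \<in> G" "i' \<noteq> j'"
  shows "\<exists>\<tau>. \<tau> permutes G \<and> \<tau> i = i' \<and> \<tau> j = j'"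
proof -
  let ?a = "Transposition.transpose i i'"
  have a: "?a permutes G" using assms by (intro permutes_swap_id)
  then have "?a j \<in> G" using assms by (simp add: permutes_in_image)
  then have "Transposition.transpose (?a j) j' permutes G" using assms by (intro permutes_swap_id)
  moreover have "?a j \<noteq> i'" using assms by (auto simp: Transposition.transpose_def)
  ultimately show ?thesis
    using assms a
    by (intro exI[of _ "Transposition.transpose (?a j) j' \<circ> ?a"] conjI permutes_compose)
       (auto simp: Transposition.transpose_def)
qed

lemma sum_off_diagonal:
  fixes g :: "'i \<Rightarrow> 'i \<Rightarrow> real"
  assumes "finite K"
  shows "(\<Sum>i\<in>K. \<Sum>j\<in>K. g i j) = (\<Sum>i\<in>K. g i i) + (\<Sum>i\<in>K. \<Sum>j\<in>K - {i}. g i j)"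
  using assms by (simp add: sum.remove[of K] sum.distrib[symmetric] cong: sum.cong)

text \<open>Sampling without replacement: the cross terms of the sampled sum are a fraction of those of
  the full sum, because all pairs of distinct sampled points have the same law.\<close>

lemma sum_permutes_square_le:
  fixes a :: "'i \<Rightarrow> real"
  assumes G: "finite G" "G \<noteq> {}" and K: "K \<subseteq> G"
  shows "(\<Sum>p | p permutes G. (\<Sum>i\<in>K. a (p i))\<^sup>2)
    \<le> fact (card G) * (real (card K) / real (card G) * (\<Sum>i\<in>G. (a i)\<^sup>2) + (\<Sum>i\<in>G. a i)\<^sup>2)"
proof -
  let ?P = "{p. p permutes G}" and ?N = "card G"
  let ?S = "\<Sum>i\<in>G. a i" and ?Q = "\<Sum>i\<in>G. (a i)\<^sup>2"
  have N: "?N > 0" using G by (simp add: card_gt_0_iff)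
  have fK: "finite K" using K G finite_subset by blast
  have cP: "card ?P = fact ?N" by (rule card_permutations[OF refl G(1)])
  \<comment> \<open>Up to the factor \<open>fact ?N\<close> these are the second moments of a
    uniform permutation; by exchangeability one value occurs on the diagonal and one off it.\<close>
  define A where "A i j = (\<Sum>p\<in>?P. a (p i) * a (p j))" for i j
  have reidx: "(\<Sum>i\<in>G. h (p i)) = (\<Sum>i\<in>G. h i)" if "p permutes G" for p and h :: "'i \<Rightarrow> real"
    using sum.permute[OF that, of h] by (simp add: comp_def)
  obtain g where g: "g \<in> G" using G by blast
  have diag: "A i i = A g g" if "i \<in> G" for i
    unfolding A_def using sum_permutes_exchangeable[OF permutes_swap_id[OF that g], of a i i] by simp
  have diag_sum: "real ?N * A g g = fact ?N * ?Q"
  proof -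
    have "real ?N * A g g = (\<Sum>i\<in>G. A i i)" using diag by simp
    also have "\<dots> = (\<Sum>p\<in>?P. \<Sum>i\<in>G. (a (p i))\<^sup>2)"
      unfolding A_def by (subst sum.swap) (simp add: power2_eq_square)
    also have "\<dots> = (\<Sum>p\<in>?P. ?Q)" by (rule sum.cong[OF refl]) (use reidx[of _ "\<lambda>x. (a x)\<^sup>2"] in simp)
    finally show ?thesis by (simp add: cP)
  qed
  have expand: "(\<Sum>p\<in>?P. (\<Sum>i\<in>I. a (p i))\<^sup>2) = (\<Sum>i\<in>I. A i i) + (\<Sum>i\<in>I. \<Sum>j\<in>I - {i}. A i j)"
    if "finite I" for I
  proof -
    have "(\<Sum>p\<in>?P. (\<Sum>i\<in>I. a (p i))\<^sup>2) = (\<Sum>p\<in>?P. \<Sum>i\<in>I. \<Sum>j\<in>I. a (p i) * a (p j))"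
      by (simp add: power2_eq_square sum_product)
    also have "\<dots> = (\<Sum>i\<in>I. \<Sum>p\<in>?P. \<Sum>j\<in>I. a (p i) * a (p j))" by (rule sum.swap)
    also have "\<dots> = (\<Sum>i\<in>I. \<Sum>j\<in>I. A i j)"
      unfolding A_def by (intro sum.cong refl sum.swap)
    finally show ?thesis by (simp add: sum_off_diagonal[OF that])
  qed
  have off: "(\<Sum>i\<in>K. \<Sum>j\<in>K - {i}. A i j) \<le> fact ?N * ?S\<^sup>2"
  proof (cases "\<exists>i\<in>K. \<exists>j\<in>K. i \<noteq> j")
    case False
    then have "(\<Sum>i\<in>K. \<Sum>j\<in>K - {i}. A i j) = 0" by (intro sum.neutral ballI) auto
    then show ?thesis by simp
  next
    case True
    then obtain i0 j0 where ij: "i0 \<in> K" "j0 \<in> K" "i0 \<noteq> j0" by blast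
    define B where "B = A i0 j0"
    have AB: "A i j = B" if ij': "i \<in> G" "j \<in> G" "i \<noteq> j" for i j
    proof -
      obtain \<tau> where "\<tau> permutes G" "\<tau> i0 = i" "\<tau> j0 = j"
        using permutes_two_points[of i0 G j0 i j] ij K ij' by blast
      then show ?thesis unfolding B_def A_def using sum_permutes_exchangeable[of \<tau> G a i0 j0] by simp
    qed
    have offI: "(\<Sum>i\<in>I. \<Sum>j\<in>I - {i}. A i j) = real (card I * (card I - 1)) * B" if "I \<subseteq> G" for I
    proof -
      have fI: "finite I" using that G finite_subset by blast
      have "(\<Sum>j\<in>I - {i}. A i j) = real (card I - 1) * B" if "i \<in> I" for i
      proof -
        have "(\<Sum>j\<in>I - {i}. A i j) = (\<Sum>j\<in>I - {i}. B)"
          using \<open>I \<subseteq> G\<close> that by (intro sum.cong refl AB) auto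
        then show ?thesis using fI that by simp
      qed
      then show ?thesis by simp
    qed
    \<comment> \<open>The sum over all of \<open>G\<close> is the same for every permutation; taking
      \<open>K = G\<close> therefore bounds the common off-diagonal value \<open>B\<close> by the
      square of the full sum.\<close>
    have "fact ?N * ?S\<^sup>2 = (\<Sum>p\<in>?P. (\<Sum>i\<in>G. a (p i))\<^sup>2)"
      using reidx[of _ a] by (simp add: cP)
    also have "\<dots> = (\<Sum>i\<in>G. A i i) + real (?N * (?N - 1)) * B"
      using expand[OF G(1)] offI[of G] by simp
    finally have full: "real (?N * (?N - 1)) * B \<le> fact ?N * ?S\<^sup>2"
      by (simp add: A_def sum_nonneg)
    have kN: "card K * (card K - 1) \<le> ?N * (?N - 1)"
      using card_mono[OF G(1) K] by (intro mult_mono) auto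
    have "real (card K * (card K - 1)) * B \<le> fact ?N * ?S\<^sup>2"
    \<comment> \<open>A negative \<open>B\<close> makes the cross terms of the sample negative as
      well; a nonnegative one is compared with the larger number of pairs in
      \<open>G\<close>.\<close>
    proof (cases "B \<ge> 0")
      case True
      have "real (card K * (card K - 1)) * B \<le> real (?N * (?N - 1)) * B"
        using kN True by (intro mult_right_mono) (auto simp only: of_nat_le_iff)
      then show ?thesis using full by linarith
    next
      case False
      then have "real (card K * (card K - 1)) * B \<le> 0" by (intro mult_nonneg_nonpos) auto
      then show ?thesis by (rule order_trans) simp
    qed
    then show ?thesis using offI[OF K] by simp
  qed
  have "(\<Sum>i\<in>K. A i i) = real (card K) * A g g" using diag K by (simp add: subset_iff)
  also have "\<dots> = fact ?N * (real (card K) / real ?N * ?Q)"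
    using diag_sum N by (simp add: field_simps)
  finally show ?thesis using expand[OF fK] off by (simp add: distrib_left)
qed

lemma (in finite_measure) sq_int_integrable:
  assumes "sq_int M f"
  shows "integrable M f"
  by (rule square_integrable_imp_integrable) (use assms in \<open>simp_all add: sq_int_def\<close>)

lemma sq_int_cong: "(\<And>x. x \<in> space M \<Longrightarrow> f x = g x) \<Longrightarrow> sq_int M f \<longleftrightarrow> sq_int M g"
  unfolding sq_int_def
  by (intro arg_cong2[where f="(\<and>)"] measurable_cong Bochner_Integration.integrable_cong) auto

section \<open>The vertex sets selected by a random permutation\<close>

lemma interval_eq_generations: "{1..<2 ^ r} = (\<Union>q<r. generation q)"
proof (induction r)
  case (Suc r)
  have "{1..<2 ^ Suc r} = {1..<2 ^ r} \<union> generation r"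
    using one_le_power[of "2 :: nat" r] by (auto simp: generation_def)
  then show ?case unfolding Suc lessThan_Suc UN_insert by (simp only: Un_commute)
qed auto

lemma subtree_eq: "subtree r = {1..<2 ^ Suc r}"
  unfolding subtree_def interval_eq_generations by (simp add: lessThan_Suc_atMost)

lemma card_subtree: "card (subtree r) = 2 ^ Suc r - 1"
  by (simp add: subtree_eq)

text \<open>The tree is represented only by a sigma-algebra \<open>FX\<close> independent of the
  permutation, so that averaging over permutations applies to every family of
  \<open>FX\<close>-measurable variables.\<close>

locale permuted_family = generation_permutation +
  fixes FX :: "'a measure"
  assumes FX: "subalgebra M FX"
    and perm_measurable: "(\<lambda>\<omega>. \<lambda>n\<in>{1..}. \<pi> \<omega> n) \<in> measurable M (\<Pi>\<^sub>M n\<in>{1..}. count_space UNIV)"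
    and perm_indep: "\<And>A B. A \<in> sets FX \<Longrightarrow> B \<in> sets (\<Pi>\<^sub>M n\<in>{1..}. count_space UNIV) \<Longrightarrow>
      prob (A \<inter> ((\<lambda>\<omega>. \<lambda>n\<in>{1..}. \<pi> \<omega> n) -` B \<inter> space M))
        = prob A * prob ((\<lambda>\<omega>. \<lambda>n\<in>{1..}. \<pi> \<omega> n) -` B \<inter> space M)"
begin

text \<open>For \<open>n\<close> in generation \<open>r\<close> this is the set of the first
  \<open>n\<close> visited vertices: all earlier generations and the image of the initial piece of
  generation \<open>r\<close>. It depends only on how the permutation acts on that one
  generation.\<close>

definition selected :: "nat \<Rightarrow> nat \<Rightarrow> (nat \<Rightarrow> nat) \<Rightarrow> nat set" where
  "selected r n p = {1..<2 ^ r} \<union> p ` {2 ^ r..n}"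

definition perm_event :: "nat \<Rightarrow> (nat \<Rightarrow> nat) \<Rightarrow> 'a set" where
  "perm_event r p = {\<omega> \<in> space M. restrict_id (\<pi> \<omega>) (generation r) = p}"

lemma inj_perm: "\<omega> \<in> space M \<Longrightarrow> A \<subseteq> {1..} \<Longrightarrow> inj_on (\<pi> \<omega>) A"
  using permutation[of \<omega>] inj_on_subset unfolding bij_betw_def by blast

lemma restrict_permutes:
  assumes "\<omega> \<in> space M"
  shows "restrict_id (\<pi> \<omega>) (generation r) permutes generation r"
proof (rule permutes_restrict_id)
  show "bij_betw (\<pi> \<omega>) (generation r) (generation r)"
    unfolding bij_betw_def using generation_invariant[OF assms]
    by (intro conjI inj_perm[OF assms]) (use generation_ge_1 in auto)
qed

lemma image_perm:
  assumes \<omega>: "\<omega> \<in> space M" and n: "2 ^ r \<le> n" "n < 2 ^ (r + 1)"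
  shows "\<pi> \<omega> ` {1..n} = selected r n (restrict_id (\<pi> \<omega>) (generation r))"
proof -
  have "{1..n} = {1..<2 ^ r} \<union> {2 ^ r..n}" using n one_le_power[of "2 :: nat" r] by auto
  moreover have "\<pi> \<omega> ` {1..<2 ^ r} = {1..<2 ^ r}"
    unfolding interval_eq_generations image_UN using generation_invariant[OF \<omega>] by simp
  moreover have "\<pi> \<omega> ` {2 ^ r..n} = restrict_id (\<pi> \<omega>) (generation r) ` {2 ^ r..n}"
    using n by (intro image_cong refl) (auto simp: generation_def)
  ultimately show ?thesis by (simp add: selected_def image_Un)
qed

lemma sum_perm:
  assumes "\<omega> \<in> space M"
  shows "(\<Sum>i=1..n. h (\<pi> \<omega> i)) = (\<Sum>j\<in>\<pi> \<omega> ` {1..n}. h j)"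
  using inj_perm[OF assms, of "{1..n}"] by (subst sum.reindex) auto

lemma selected_subset:
  assumes "p permutes generation r" "2 ^ r \<le> n" "n < 2 ^ (r + 1)"
  shows "finite (selected r n p)" "selected r n p \<subseteq> {1..}"
proof -
  have "p ` {2 ^ r..n} \<subseteq> p ` generation r" using assms by (intro image_mono) (auto simp: generation_def)
  then have "p ` {2 ^ r..n} \<subseteq> generation r" using permutes_image[OF assms(1)] by simp
  then show "selected r n p \<subseteq> {1..}" using generation_ge_1 by (auto simp: selected_def)
qed (simp add: selected_def)

lemma sum_selected:
  fixes h :: "nat \<Rightarrow> 'z::comm_monoid_add"
  assumes "p permutes generation r" "2 ^ r \<le> n" "n < 2 ^ (r + 1)"
  shows "(\<Sum>j\<in>selected r n p. h j) = (\<Sum>j\<in>{1..<2 ^ r}. h j) + (\<Sum>i\<in>{2 ^ r..n}. h (p i))"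
proof -
  have K: "{2 ^ r..n} \<subseteq> generation r" using assms by (auto simp: generation_def)
  then have "p ` {2 ^ r..n} \<subseteq> generation r" using permutes_image[OF assms(1)] by (metis image_mono)
  then have "{1..<2 ^ r} \<inter> p ` {2 ^ r..n} = {}" by (auto simp: generation_def)
  then show ?thesis
    unfolding selected_def
    by (subst sum.union_disjoint) (auto simp: sum.reindex[OF permutes_inj_on[OF assms(1)]])
qed

lemma card_selected:
  assumes "p permutes generation r" "2 ^ r \<le> n" "n < 2 ^ (r + 1)"
  shows "card (selected r n p) = n"
  using sum_selected[OF assms, of "\<lambda>_. 1 :: nat"] assms by (simp add: Suc_leI) 

lemma perm_event_props:
  assumes p: "p permutes generation r"
  shows "perm_event r p \<in> events" "prob (perm_event r p) = 1 / fact (2 ^ r)"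
    "A \<in> sets FX \<Longrightarrow> prob (A \<inter> perm_event r p) = prob A * prob (perm_event r p)"
proof -
  let ?R = "\<lambda>\<omega>. restrict_id (\<pi> \<omega>) (generation r)"
  have R: "?R \<in> measurable M (count_space UNIV)"
    using generations_indep by (auto simp: indep_vars_def)
  have ev: "perm_event r p = ?R -` {p} \<inter> space M" by (auto simp: perm_event_def)
  show "perm_event r p \<in> events" unfolding ev by (rule measurable_sets[OF R]) simp
  have "prob (perm_event r p) = measure (distr M (count_space UNIV) ?R) {p}"
    unfolding ev by (subst measure_distr[OF R]) auto
  also have "\<dots> = pmf (pmf_of_set {p. p permutes generation r}) p"
    by (simp add: uniform_on_generation pmf.rep_eq)
  also have "\<dots> = 1 / fact (2 ^ r)"
    using p by (subst pmf_of_set) (auto simp: finite_permutations card_permutations[OF card_generation])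
  finally show "prob (perm_event r p) = 1 / fact (2 ^ r)" .
  \<comment> \<open>Independence from \<open>FX\<close> is stated for the permutation as one
    sequence, so the event has to be exhibited as a cylinder in finitely many coordinates.\<close>
  let ?C = "\<Inter>i\<in>generation r. (\<lambda>x. x i) -` {p i} \<inter> space (\<Pi>\<^sub>M n\<in>{1..}. count_space UNIV :: nat measure)"
  have C: "?C \<in> sets (\<Pi>\<^sub>M n\<in>{1..}. count_space UNIV)"
    using generation_ge_1
    by (intro sets.finite_INT measurable_sets[OF measurable_component_singleton]) (auto simp: generation_def)
  have "restrict_id (\<pi> \<omega>) (generation r) = p \<longleftrightarrow> (\<forall>i\<in>generation r. \<pi> \<omega> i = p i)" for \<omega>
    using p by (auto simp: fun_eq_iff restrict_id_def permutes_not_in)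
  moreover have "generation r \<noteq> {}" by (simp add: generation_def)
  ultimately have "perm_event r p = (\<lambda>\<omega>. \<lambda>n\<in>{1..}. \<pi> \<omega> n) -` ?C \<inter> space M"
    using generation_ge_1[of _ r] by (auto simp: perm_event_def space_PiM)
  then show "prob (A \<inter> perm_event r p) = prob A * prob (perm_event r p)" if "A \<in> sets FX"
    using perm_indep[OF that C] by simp
qed

text \<open>The space splits into the events fixing the action on generation \<open>r\<close>, each
  of probability \<open>1 / fact (2 ^ r)\<close> and independent of \<open>FX\<close>. An
  expectation involving the random permutation becomes a finite average over deterministic vertex
  sets.\<close>

lemma
  fixes H :: "nat set \<Rightarrow> 'a \<Rightarrow> 'c::{banach, second_countable_topology}"
  assumes n: "2 ^ r \<le> n" "n < 2 ^ (r + 1)"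
    and H: "\<And>p. p permutes generation r \<Longrightarrow> H (selected r n p) \<in> borel_measurable FX"
      "\<And>p. p permutes generation r \<Longrightarrow> integrable M (H (selected r n p))"
  shows integral_perm: "(\<integral>\<omega>. H (\<pi> \<omega> ` {1..n}) \<omega> \<partial>M)
      = (\<Sum>p | p permutes generation r. \<integral>\<omega>. H (selected r n p) \<omega> \<partial>M) /\<^sub>R fact (2 ^ r)"
    and integrable_perm: "integrable M (\<lambda>\<omega>. H (\<pi> \<omega> ` {1..n}) \<omega>)"
proof -
  let ?P = "{p. p permutes generation r}"
  have fP: "finite ?P" by (rule finite_permutations) simp
  have eq: "H (\<pi> \<omega> ` {1..n}) \<omega> = (\<Sum>p\<in>?P. indicator (perm_event r p) \<omega> *\<^sub>R H (selected r n p) \<omega>)"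
    if \<omega>: "\<omega> \<in> space M" for \<omega>
  proof -
    let ?q = "restrict_id (\<pi> \<omega>) (generation r)"
    have "(\<Sum>p\<in>?P. indicator (perm_event r p) \<omega> *\<^sub>R H (selected r n p) \<omega>)
        = (\<Sum>p\<in>?P. if p = ?q then H (selected r n p) \<omega> else 0)"
      using \<omega> by (intro sum.cong refl) (auto simp: perm_event_def indicator_def)
    also have "\<dots> = H (selected r n ?q) \<omega>"
      using fP restrict_permutes[OF \<omega>, of r] by (simp add: sum.delta)
    finally show ?thesis unfolding image_perm[OF \<omega> n] by (rule sym)
  qed
  have i: "integrable M (\<lambda>\<omega>. indicator (perm_event r p) \<omega> *\<^sub>R H (selected r n p) \<omega>)"
    if "p \<in> ?P" for p
    using that by (intro integrable_mult_indicator perm_event_props H) auto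
  have "integrable M (\<lambda>\<omega>. \<Sum>p\<in>?P. indicator (perm_event r p) \<omega> *\<^sub>R H (selected r n p) \<omega>)"
    by (intro Bochner_Integration.integrable_sum i)
  then show "integrable M (\<lambda>\<omega>. H (\<pi> \<omega> ` {1..n}) \<omega>)"
    by (subst Bochner_Integration.integrable_cong[OF refl eq])
  have "(\<integral>\<omega>. H (\<pi> \<omega> ` {1..n}) \<omega> \<partial>M)
      = (\<integral>\<omega>. (\<Sum>p\<in>?P. indicator (perm_event r p) \<omega> *\<^sub>R H (selected r n p) \<omega>) \<partial>M)"
    by (intro Bochner_Integration.integral_cong refl eq)
  also have "\<dots> = (\<Sum>p\<in>?P. \<integral>\<omega>. indicator (perm_event r p) \<omega> *\<^sub>R H (selected r n p) \<omega> \<partial>M)"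
    by (intro Bochner_Integration.integral_sum i)
  also have "\<dots> = (\<Sum>p\<in>?P. (1 / fact (2 ^ r)) *\<^sub>R (\<integral>\<omega>. H (selected r n p) \<omega> \<partial>M))"
  proof (rule sum.cong[OF refl])
    fix p assume "p \<in> ?P"
    then have p: "p permutes generation r" by simp
    show "(\<integral>\<omega>. indicator (perm_event r p) \<omega> *\<^sub>R H (selected r n p) \<omega> \<partial>M)
        = (1 / fact (2 ^ r)) *\<^sub>R (\<integral>\<omega>. H (selected r n p) \<omega> \<partial>M)"
      using integral_indicator_independent[OF FX perm_event_props(1)[OF p] perm_event_props(3)[OF p] H[OF p]]
      by (simp add: perm_event_props(2)[OF p])
  qed
  also have "\<dots> = (\<Sum>p\<in>?P. \<integral>\<omega>. H (selected r n p) \<omega> \<partial>M) /\<^sub>R fact (2 ^ r)"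
    by (simp add: scaleR_sum_right[symmetric] divide_inverse)
  finally show "(\<integral>\<omega>. H (\<pi> \<omega> ` {1..n}) \<omega> \<partial>M)
      = (\<Sum>p\<in>?P. \<integral>\<omega>. H (selected r n p) \<omega> \<partial>M) /\<^sub>R fact (2 ^ r)" .
qed

end

text \<open>The variable at vertex \<open>i\<close> will be the value of a test function there minus
  its limit, for functions of a vertex as well as of a vertex with its daughters.\<close>

locale L2_bounded_family = permuted_family +
  fixes \<xi> :: "nat \<Rightarrow> 'a \<Rightarrow> real" and C :: real
  assumes \<xi>_FX: "\<And>i. 1 \<le> i \<Longrightarrow> \<xi> i \<in> borel_measurable FX"
    and \<xi>_sq: "\<And>i. 1 \<le> i \<Longrightarrow> integrable M (\<lambda>\<omega>. (\<xi> i \<omega>)\<^sup>2)"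
    and \<xi>_bound: "\<And>i. 1 \<le> i \<Longrightarrow> (\<integral>\<omega>. (\<xi> i \<omega>)\<^sup>2 \<partial>M) \<le> C"
    and generation_tendsto: "(\<lambda>q. \<integral>\<omega>. ((\<Sum>i\<in>generation q. \<xi> i \<omega>) / 2 ^ q)\<^sup>2 \<partial>M) \<longlonglongrightarrow> 0"
begin

lemma sq_int_\<xi>: "1 \<le> i \<Longrightarrow> sq_int M (\<xi> i)"
  using \<xi>_sq \<xi>_FX measurable_from_subalg[OF FX] by (auto simp: sq_int_def)

lemma sq_int_sum_\<xi>: "I \<subseteq> {1..} \<Longrightarrow> sq_int M (\<lambda>\<omega>. \<Sum>i\<in>I. \<xi> i \<omega>)"
  by (intro sq_int_sum sq_int_\<xi>) auto

lemma C_nonneg: "0 \<le> C"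
  by (rule order_trans[OF _ \<xi>_bound[of 1]]) auto

definition e_gen :: "nat \<Rightarrow> real" where
  "e_gen q = (\<integral>\<omega>. ((\<Sum>i\<in>generation q. \<xi> i \<omega>) / 2 ^ q)\<^sup>2 \<partial>M)"

text \<open>Dividing by \<open>2 ^ r\<close>, although there are \<open>2 ^ r - 1\<close> vertices,
  makes the next normalised sum exactly the midpoint of this one and the mean over generation
  \<open>r\<close>.\<close>

definition e_tree :: "nat \<Rightarrow> real" where
  "e_tree r = (\<integral>\<omega>. ((\<Sum>i\<in>{1..<2 ^ r}. \<xi> i \<omega>) / 2 ^ r)\<^sup>2 \<partial>M)"

lemma e_gen_tendsto: "e_gen \<longlonglongrightarrow> 0"
  using generation_tendsto unfolding e_gen_def .

text \<open>Convexity of the square at this midpoint leaves half of the old error plus half of the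
  error of one generation, a contraction with vanishing perturbation.\<close>

lemma e_tree_tendsto: "e_tree \<longlonglongrightarrow> 0"
proof (rule contraction_tendsto_0[OF _ e_gen_tendsto])
  fix r
  let ?S = "\<lambda>\<omega>. (\<Sum>i\<in>{1..<2 ^ r}. \<xi> i \<omega>) / 2 ^ r" and ?G = "\<lambda>\<omega>. (\<Sum>i\<in>generation r. \<xi> i \<omega>) / 2 ^ r"
  have S: "sq_int M ?S" by (intro sq_int_divide sq_int_sum_\<xi>) auto
  have G: "sq_int M ?G" by (intro sq_int_divide sq_int_sum_\<xi>) (use generation_ge_1 in auto)
  have split: "(\<Sum>i\<in>{1..<2 ^ Suc r}. \<xi> i \<omega>) / 2 ^ Suc r = (?S \<omega> + ?G \<omega>) / 2" for \<omega>
  proof -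
    have "{1..<2 ^ Suc r} = {1..<2 ^ r} \<union> generation r"
      using one_le_power[of "2 :: nat" r] by (auto simp: generation_def)
    then have "(\<Sum>i\<in>{1..<2 ^ Suc r}. \<xi> i \<omega>) = (\<Sum>i\<in>{1..<2 ^ r}. \<xi> i \<omega>) + (\<Sum>i\<in>generation r. \<xi> i \<omega>)"
      by (simp add: sum.union_disjoint generation_def)
    then show ?thesis by (simp add: add_divide_distrib)
  qed
  have "e_tree (Suc r) \<le> (\<integral>\<omega>. (?S \<omega>)\<^sup>2 / 2 + (?G \<omega>)\<^sup>2 / 2 \<partial>M)"
    unfolding e_tree_def
  proof (rule integral_mono')
    show "integrable M (\<lambda>\<omega>. (?S \<omega>)\<^sup>2 / 2 + (?G \<omega>)\<^sup>2 / 2)"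
      using S G by (auto simp: sq_int_def)
    fix \<omega>
    show "((\<Sum>i\<in>{1..<2 ^ Suc r}. \<xi> i \<omega>) / 2 ^ Suc r)\<^sup>2 \<le> (?S \<omega>)\<^sup>2 / 2 + (?G \<omega>)\<^sup>2 / 2"
      unfolding split using power2_add_le[of "?S \<omega>" "?G \<omega>"] by (simp add: power_divide del: times_divide_eq_right)
  qed simp
  also have "\<dots> = e_tree r / 2 + e_gen r / 2"
    using S G by (simp add: e_tree_def e_gen_def sq_int_def)
  also have "\<dots> \<le> e_tree r / 2 + e_gen r" by (simp add: e_gen_def)
  finally show "e_tree (Suc r) \<le> e_tree r / 2 + e_gen r" .
qed (simp add: e_tree_def)

text \<open>The subtree has at least half of \<open>2 ^ Suc r\<close> vertices, so changing the
  normalisation costs a factor 4 in the square.\<close>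

lemma subtree_tendsto:
  "(\<lambda>r. \<integral>\<omega>. ((\<Sum>i\<in>subtree r. \<xi> i \<omega>) / real (card (subtree r)))\<^sup>2 \<partial>M) \<longlonglongrightarrow> 0"
proof (rule tendsto_sandwich[OF _ _ tendsto_const])
  show "(\<lambda>r. 4 * e_tree (Suc r)) \<longlonglongrightarrow> 0"
    using tendsto_mult_left[OF LIMSEQ_Suc[OF e_tree_tendsto], of 4] by simp
  show "\<forall>\<^sub>F r in sequentially. (\<integral>\<omega>. ((\<Sum>i\<in>subtree r. \<xi> i \<omega>) / real (card (subtree r)))\<^sup>2 \<partial>M) \<le> 4 * e_tree (Suc r)"
  proof (rule always_eventually, rule allI)
    fix r
    let ?E = "\<integral>\<omega>. (\<Sum>i\<in>{1..<2 ^ Suc r}. \<xi> i \<omega>)\<^sup>2 \<partial>M"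
    have "(2 :: nat) ^ r \<le> 2 ^ Suc r - 1" using one_le_power[of "2 :: nat" r] by simp
    then have c: "(2 :: real) ^ r \<le> real (card (subtree r))"
      unfolding card_subtree by (metis of_nat_le_iff of_nat_numeral of_nat_power)
    have c0: "0 < card (subtree r)" using less_le_trans[OF _ c, of 0] by simp
    have "(\<integral>\<omega>. ((\<Sum>i\<in>subtree r. \<xi> i \<omega>) / real (card (subtree r)))\<^sup>2 \<partial>M) = ?E / (real (card (subtree r)))\<^sup>2"
      by (simp add: power_divide subtree_eq)
    also have "\<dots> \<le> ?E / (2 ^ r)\<^sup>2"
      using c by (intro divide_left_mono power_mono mult_pos_pos zero_less_power) (auto intro: c0)
    also have "\<dots> = 4 * e_tree (Suc r)" by (simp add: e_tree_def power_divide power_mult_distrib)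
    finally show "(\<integral>\<omega>. ((\<Sum>i\<in>subtree r. \<xi> i \<omega>) / real (card (subtree r)))\<^sup>2 \<partial>M) \<le> 4 * e_tree (Suc r)" .
  qed
qed auto

lemma sq_int_perm: "sq_int M (\<lambda>\<omega>. (\<Sum>i=1..n. \<xi> (\<pi> \<omega> i) \<omega>))"
proof (cases "n = 0")
  case True
  then show ?thesis by (simp add: sq_int_def)
next
  case False
  then obtain r where n: "2 ^ r \<le> n" "n < 2 ^ (r + 1)" using ex_power_ivl1[of 2 n] by auto
  have sel: "sq_int M (\<lambda>\<omega>. \<Sum>j\<in>selected r n p. \<xi> j \<omega>)" if "p permutes generation r" for p
    by (rule sq_int_sum_\<xi>[OF selected_subset(2)[OF that n]])
  have selm: "(\<lambda>\<omega>. \<Sum>j\<in>selected r n p. \<xi> j \<omega>) \<in> borel_measurable FX" if "p permutes generation r" for p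
    using selected_subset(2)[OF that n] by (intro borel_measurable_sum \<xi>_FX) auto
  have seli: "integrable M (\<lambda>\<omega>. \<Sum>j\<in>selected r n p. \<xi> j \<omega>)" if "p permutes generation r" for p
    by (rule sq_int_integrable[OF sel[OF that]])
  have selm2: "(\<lambda>\<omega>. (\<Sum>j\<in>selected r n p. \<xi> j \<omega>)\<^sup>2) \<in> borel_measurable FX" if "p permutes generation r" for p
    by (rule borel_measurable_power[OF selm[OF that]])
  have seli2: "integrable M (\<lambda>\<omega>. (\<Sum>j\<in>selected r n p. \<xi> j \<omega>)\<^sup>2)" if "p permutes generation r" for p
    using sel[OF that] by (simp add: sq_int_def)
  have "integrable M (\<lambda>\<omega>. \<Sum>j\<in>\<pi> \<omega> ` {1..n}. \<xi> j \<omega>)"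
    by (rule integrable_perm[where H="\<lambda>J \<omega>. \<Sum>j\<in>J. \<xi> j \<omega>", OF n selm seli])
  moreover have "integrable M (\<lambda>\<omega>. (\<Sum>j\<in>\<pi> \<omega> ` {1..n}. \<xi> j \<omega>)\<^sup>2)"
    by (rule integrable_perm[where H="\<lambda>J \<omega>. (\<Sum>j\<in>J. \<xi> j \<omega>)\<^sup>2", OF n selm2 seli2])
  ultimately have "sq_int M (\<lambda>\<omega>. \<Sum>j\<in>\<pi> \<omega> ` {1..n}. \<xi> j \<omega>)"
    unfolding sq_int_def by (blast dest: borel_measurable_integrable)
  moreover have "(\<Sum>i=1..n. \<xi> (\<pi> \<omega> i) \<omega>) = (\<Sum>j\<in>\<pi> \<omega> ` {1..n}. \<xi> j \<omega>)" if "\<omega> \<in> space M" for \<omega>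
    by (rule sum_perm[OF that, of "\<lambda>j. \<xi> j \<omega>"])
  ultimately show ?thesis by (subst sq_int_cong) assumption+
qed

text \<open>The complete generations contribute \<open>e_tree\<close>. The visited part of
  generation \<open>r\<close> is a sample without replacement: its cross terms are controlled by the
  full generation, hence by \<open>e_gen\<close>, and its diagonal by \<open>C / n\<close>.\<close>

lemma second_moment_perm_le:
  assumes n: "2 ^ r \<le> n" "n < 2 ^ (r + 1)"
  shows "(\<integral>\<omega>. ((\<Sum>i=1..n. \<xi> (\<pi> \<omega> i) \<omega>) / real n)\<^sup>2 \<partial>M) \<le> 2 * e_tree r + 2 * e_gen r + 2 * C / real n"
proof -
  let ?P = "{p. p permutes generation r}" and ?K = "{2 ^ r..n}"
  have n0: "real n > 0" using less_le_trans[OF _ n(1), of 0] by simp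
  have K: "?K \<subseteq> generation r" "generation r \<noteq> {}" using n by (auto simp: generation_def)
  let ?S = "\<lambda>\<omega>. \<Sum>j\<in>{1..<2 ^ r}. \<xi> j \<omega>" and ?G = "\<lambda>\<omega>. \<Sum>j\<in>generation r. \<xi> j \<omega>"
  have S: "sq_int M ?S" by (intro sq_int_sum_\<xi>) auto
  have G: "sq_int M ?G" by (intro sq_int_sum_\<xi>) (use generation_ge_1 in auto)
  have selm: "(\<lambda>\<omega>. (\<Sum>j\<in>selected r n p. \<xi> j \<omega>)\<^sup>2) \<in> borel_measurable FX" if "p permutes generation r" for p
    using selected_subset(2)[OF that n] by (intro borel_measurable_power borel_measurable_sum \<xi>_FX) auto
  have seli: "integrable M (\<lambda>\<omega>. (\<Sum>j\<in>selected r n p. \<xi> j \<omega>)\<^sup>2)" if "p permutes generation r" for p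
    using sq_int_sum_\<xi>[OF selected_subset(2)[OF that n]] by (simp add: sq_int_def)
  \<comment> \<open>The bound for the average over all permutations with the tree held fixed; it is
    integrated afterwards.\<close>
  let ?b = "\<lambda>\<omega>. 2 * (?S \<omega>)\<^sup>2 + 2 * (real (card ?K) / 2 ^ r * (\<Sum>j\<in>generation r. (\<xi> j \<omega>)\<^sup>2) + (?G \<omega>)\<^sup>2)"
  have bi: "integrable M ?b"
    using S G \<xi>_sq[OF generation_ge_1]
    by (intro Bochner_Integration.integrable_add integrable_mult_right Bochner_Integration.integrable_sum) (auto simp: sq_int_def)
  have pointwise: "(\<Sum>p\<in>?P. (\<Sum>j\<in>selected r n p. \<xi> j \<omega>)\<^sup>2) / fact (2 ^ r) \<le> ?b \<omega>" for \<omega>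
  proof -
    have cP: "card ?P = fact (2 ^ r)" by (rule card_permutations) auto
    have "(\<Sum>p\<in>?P. (\<Sum>j\<in>selected r n p. \<xi> j \<omega>)\<^sup>2) \<le> (\<Sum>p\<in>?P. 2 * (?S \<omega>)\<^sup>2 + 2 * (\<Sum>i\<in>?K. \<xi> (p i) \<omega>)\<^sup>2)"
      using sum_selected[OF _ n, of _ "\<lambda>j. \<xi> j \<omega>"] by (intro sum_mono) (auto intro: power2_add_le)
    also have "\<dots> = fact (2 ^ r) * (2 * (?S \<omega>)\<^sup>2) + 2 * (\<Sum>p\<in>?P. (\<Sum>i\<in>?K. \<xi> (p i) \<omega>)\<^sup>2)"
      by (simp add: sum.distrib sum_distrib_left cP)
    also have "\<dots> \<le> fact (2 ^ r) * (2 * (?S \<omega>)\<^sup>2)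
        + 2 * (fact (2 ^ r) * (real (card ?K) / 2 ^ r * (\<Sum>j\<in>generation r. (\<xi> j \<omega>)\<^sup>2) + (?G \<omega>)\<^sup>2))"
      using sum_permutes_square_le[OF finite_generation K(2,1), of "\<lambda>j. \<xi> j \<omega>"]
      by (intro add_left_mono mult_left_mono) auto
    also have "\<dots> = ?b \<omega> * fact (2 ^ r)" by (simp add: algebra_simps)
    finally show ?thesis by (simp add: pos_divide_le_eq)
  qed
  have "(\<integral>\<omega>. ((\<Sum>i=1..n. \<xi> (\<pi> \<omega> i) \<omega>))\<^sup>2 \<partial>M) = (\<integral>\<omega>. (\<Sum>j\<in>\<pi> \<omega> ` {1..n}. \<xi> j \<omega>)\<^sup>2 \<partial>M)"
  proof (rule Bochner_Integration.integral_cong[OF refl])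
    fix \<omega> assume "\<omega> \<in> space M"
    from sum_perm[OF this, of "\<lambda>j. \<xi> j \<omega>"]
    show "(\<Sum>i=1..n. \<xi> (\<pi> \<omega> i) \<omega>)\<^sup>2 = (\<Sum>j\<in>\<pi> \<omega> ` {1..n}. \<xi> j \<omega>)\<^sup>2" by (simp only:)
  qed
  also have "\<dots> = (\<Sum>p\<in>?P. \<integral>\<omega>. (\<Sum>j\<in>selected r n p. \<xi> j \<omega>)\<^sup>2 \<partial>M) /\<^sub>R fact (2 ^ r)"
    by (rule integral_perm[where H="\<lambda>J \<omega>. (\<Sum>j\<in>J. \<xi> j \<omega>)\<^sup>2", OF n selm seli])
  also have "\<dots> = (\<integral>\<omega>. (\<Sum>p\<in>?P. (\<Sum>j\<in>selected r n p. \<xi> j \<omega>)\<^sup>2) / fact (2 ^ r) \<partial>M)"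
    using seli by (simp add: divide_inverse mult.commute)
  also have "\<dots> \<le> (\<integral>\<omega>. ?b \<omega> \<partial>M)"
    by (intro integral_mono'[OF bi pointwise]) (auto intro!: add_nonneg_nonneg divide_nonneg_nonneg mult_nonneg_nonneg sum_nonneg)
  also have "\<dots> = 2 * (\<integral>\<omega>. (?S \<omega>)\<^sup>2 \<partial>M)
      + 2 * (real (card ?K) / 2 ^ r * (\<Sum>j\<in>generation r. \<integral>\<omega>. (\<xi> j \<omega>)\<^sup>2 \<partial>M) + (\<integral>\<omega>. (?G \<omega>)\<^sup>2 \<partial>M))"
    using S G \<xi>_sq[OF generation_ge_1] by (simp add: sq_int_def)
  also have "(\<integral>\<omega>. (?S \<omega>)\<^sup>2 \<partial>M) = (2 ^ r)\<^sup>2 * e_tree r" by (simp add: e_tree_def power_divide)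
  also have "(\<integral>\<omega>. (?G \<omega>)\<^sup>2 \<partial>M) = (2 ^ r)\<^sup>2 * e_gen r" by (simp add: e_gen_def power_divide)
  also have "2 * ((2 ^ r)\<^sup>2 * e_tree r) + 2 * (real (card ?K) / 2 ^ r * (\<Sum>j\<in>generation r. \<integral>\<omega>. (\<xi> j \<omega>)\<^sup>2 \<partial>M) + (2 ^ r)\<^sup>2 * e_gen r)
      \<le> 2 * ((real n)\<^sup>2 * e_tree r) + 2 * (real n * C + (real n)\<^sup>2 * e_gen r)"
  proof -
    have rn: "(2 ^ r :: real) \<le> real n" using n(1) by (metis of_nat_le_iff of_nat_numeral of_nat_power)
    have "(\<Sum>j\<in>generation r. \<integral>\<omega>. (\<xi> j \<omega>)\<^sup>2 \<partial>M) \<le> (\<Sum>j\<in>generation r. C)"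
      by (intro sum_mono \<xi>_bound generation_ge_1)
    then have "real (card ?K) / 2 ^ r * (\<Sum>j\<in>generation r. \<integral>\<omega>. (\<xi> j \<omega>)\<^sup>2 \<partial>M) \<le> real (card ?K) / 2 ^ r * (2 ^ r * C)"
      by (intro mult_left_mono) auto
    also have "\<dots> = real (card ?K) * C" by simp
    also have "\<dots> \<le> real n * C" using C_nonneg n by (intro mult_right_mono) auto
    finally show ?thesis
      using rn by (intro add_mono mult_left_mono mult_right_mono power_mono) (auto simp: e_tree_def e_gen_def)
  qed
  finally have "(\<integral>\<omega>. (\<Sum>i=1..n. \<xi> (\<pi> \<omega> i) \<omega>)\<^sup>2 \<partial>M) / (real n)\<^sup>2
      \<le> (2 * ((real n)\<^sup>2 * e_tree r) + 2 * (real n * C + (real n)\<^sup>2 * e_gen r)) / (real n)\<^sup>2"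
    by (intro divide_right_mono) auto
  also have "\<dots> = 2 * e_tree r + 2 * e_gen r + 2 * C / real n"
    using n0 by (simp add: field_simps power2_eq_square)
  finally show ?thesis by (simp add: power_divide)
qed

lemma perm_tendsto: "(\<lambda>n. \<integral>\<omega>. ((\<Sum>i=1..n. \<xi> (\<pi> \<omega> i) \<omega>) / real n)\<^sup>2 \<partial>M) \<longlonglongrightarrow> 0"
proof (rule LIMSEQ_I)
  fix \<epsilon> :: real assume \<epsilon>: "\<epsilon> > 0"
  have "(\<lambda>r. 2 * e_tree r + 2 * e_gen r) \<longlonglongrightarrow> 2 * 0 + 2 * 0"
    by (intro tendsto_intros e_tree_tendsto e_gen_tendsto)
  then obtain R where R: "\<And>r. r \<ge> R \<Longrightarrow> \<bar>2 * e_tree r + 2 * e_gen r\<bar> < \<epsilon> / 2"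
    using LIMSEQ_D[of "\<lambda>r. 2 * e_tree r + 2 * e_gen r" 0 "\<epsilon> / 2"] \<epsilon> by auto
  have "(\<lambda>n. 2 * C / real n) \<longlonglongrightarrow> 0" by (rule lim_const_over_n)
  then obtain N where N: "\<And>n. n \<ge> N \<Longrightarrow> \<bar>2 * C / real n\<bar> < \<epsilon> / 2"
    using LIMSEQ_D[of "\<lambda>n. 2 * C / real n" 0 "\<epsilon> / 2"] \<epsilon> by auto
  have "norm ((\<integral>\<omega>. ((\<Sum>i=1..n. \<xi> (\<pi> \<omega> i) \<omega>) / real n)\<^sup>2 \<partial>M) - 0) < \<epsilon>" if n: "n \<ge> max N (2 ^ R)" for n
  proof -
    have "1 \<le> n" using n one_le_power[of "2 :: nat" R] by linarith
    then obtain r where r: "2 ^ r \<le> n" "n < 2 ^ (r + 1)" using ex_power_ivl1[of 2 n] by auto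
    have "(2 :: nat) ^ R < 2 ^ (r + 1)" using n r(2) by linarith
    then have "R < r + 1" by (rule power_less_imp_less_exp[rotated]) simp
    then have "R \<le> r" by simp
    from R[OF this] N[of n] n second_moment_perm_le[OF r]
    have "(\<integral>\<omega>. ((\<Sum>i=1..n. \<xi> (\<pi> \<omega> i) \<omega>) / real n)\<^sup>2 \<partial>M) < \<epsilon>" by linarith
    then show ?thesis by simp
  qed
  then show "\<exists>no. \<forall>n\<ge>no. norm ((\<integral>\<omega>. ((\<Sum>i=1..n. \<xi> (\<pi> \<omega> i) \<omega>) / real n)\<^sup>2 \<partial>M) - 0) < \<epsilon>" by blast
qed

end

section \<open>Means over generations for functions of polynomial growth\<close>

context bar_model_stationary
begin

lemma mean_X_sq_int:
  assumes "f \<in> C_pol"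
  shows "sq_int M (\<lambda>\<omega>. mean_over X (generation q) f \<omega> - c)"
proof -
  have "sq_int M (\<lambda>\<omega>. f (X i \<omega>))" if "i \<in> generation q" for i
    using integrable_X[OF C_pol_power[OF assms, of 2] generation_ge_1[OF that]]
      measurable_compose[OF X_measurable[OF generation_ge_1[OF that]] C_pol_measurable[OF assms]]
    by (simp add: sq_int_def)
  then have "sq_int M (\<lambda>\<omega>. mean_over X (generation q) f \<omega>)"
    unfolding mean_over_def by (intro sq_int_divide sq_int_sum)
  from sq_int_add[OF this sq_int_const[of "- c"]] show ?thesis by simp
qed

text \<open>The error of \<open>f\<close> splits into that of \<open>g\<close>, the mean of
  \<open>f - g\<close> over the generation, and the difference of the two limits. The last two are
  controlled by weighted moments that are uniform in the generation; splitting the square twice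
  produces the factor 4.\<close>

lemma gen_error_approx:
  assumes f: "f \<in> C_pol" and g: "g \<in> C_pol" and \<delta>: "\<delta> \<ge> 0"
    and fg: "\<And>x. \<bar>f x - g x\<bar> \<le> \<delta> * (1 + \<bar>x\<bar> ^ m)"
    and K: "\<And>n. 1 \<le> n \<Longrightarrow> (\<integral>\<omega>. (1 + \<bar>X n \<omega>\<bar> ^ m)\<^sup>2 \<partial>M) \<le> K"
  shows "gen_error f q \<le> 4 * gen_error g q + 4 * \<delta>\<^sup>2 * (K + (\<integral>x. 1 + \<bar>x\<bar> ^ m \<partial>\<mu>)\<^sup>2)"
proof -
  let ?a = "\<integral>x. 1 + \<bar>x\<bar> ^ m \<partial>\<mu>" and ?w = "\<lambda>x :: real. 1 + \<bar>x\<bar> ^ m"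
  let ?A = "\<lambda>\<omega>. mean_over X (generation q) g \<omega> - (\<integral>x. g x \<partial>\<mu>)"
  let ?B = "\<lambda>\<omega>. (\<Sum>i\<in>generation q. (?w (X i \<omega>))\<^sup>2) / 2 ^ q"
  have wC: "?w \<in> C_pol"
    using C_pol_norm[where 'a=real] by (intro C_pol_add C_pol_const C_pol_power) (simp add: real_norm_def[abs_def])
  have A: "sq_int M ?A" by (rule mean_X_sq_int[OF g])
  have Bi: "integrable M (\<lambda>\<omega>. (?w (X i \<omega>))\<^sup>2)" if "1 \<le> i" for i
    by (rule integrable_X[OF C_pol_power[OF wC] that])
  have mu: "\<bar>(\<integral>x. g x \<partial>\<mu>) - (\<integral>x. f x \<partial>\<mu>)\<bar> \<le> \<delta> * ?a"
  proof -
    have "\<bar>(\<integral>x. g x \<partial>\<mu>) - (\<integral>x. f x \<partial>\<mu>)\<bar> = norm (\<integral>x. g x - f x \<partial>\<mu>)"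
      using integrable_\<mu>[OF f] integrable_\<mu>[OF g] by simp
    also have "\<dots> \<le> (\<integral>x. \<delta> * ?w x \<partial>\<mu>)"
      using integrable_\<mu>[OF f] integrable_\<mu>[OF g] integrable_\<mu>[OF wC] fg
      by (intro norm_integral_le) (auto simp: abs_minus_commute)
    finally show ?thesis by simp
  qed
  have comb: "y \<le> 4 * a + (4 * t * b + 4 * c)"
    if "y \<le> 2 * a + 2 * (2 * d + 2 * e)" "d \<le> t * b" "e \<le> c" "0 \<le> a" for y a b c d e t :: real
  proof -
    have "y \<le> 2 * a + (4 * d + 4 * e)" using that(1) by (simp add: algebra_simps)
    moreover have "4 * d \<le> 4 * t * b" using that(2) by (simp add: mult.assoc)
    ultimately show ?thesis using that(3,4) by linarith
  qed
  have pt: "(mean_over X (generation q) f \<omega> - (\<integral>x. f x \<partial>\<mu>))\<^sup>2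
      \<le> 4 * (?A \<omega>)\<^sup>2 + (4 * \<delta>\<^sup>2 * ?B \<omega> + 4 * (\<delta> * ?a)\<^sup>2)" for \<omega>
  proof -
    let ?d = "(\<Sum>i\<in>generation q. f (X i \<omega>) - g (X i \<omega>)) / real (card (generation q))"
    have eq: "mean_over X (generation q) f \<omega> - (\<integral>x. f x \<partial>\<mu>)
        = ?A \<omega> + (?d + ((\<integral>x. g x \<partial>\<mu>) - (\<integral>x. f x \<partial>\<mu>)))"
      by (simp add: mean_over_def sum_subtractf diff_divide_distrib)
    have "(mean_over X (generation q) f \<omega> - (\<integral>x. f x \<partial>\<mu>))\<^sup>2
        \<le> 2 * (?A \<omega>)\<^sup>2 + 2 * (2 * ?d\<^sup>2 + 2 * ((\<integral>x. g x \<partial>\<mu>) - (\<integral>x. f x \<partial>\<mu>))\<^sup>2)"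
      unfolding eq by (intro order_trans[OF power2_add_le] add_left_mono mult_left_mono power2_add_le) simp
    moreover have "?d\<^sup>2 \<le> \<delta>\<^sup>2 * ?B \<omega>"
    proof -
      have "?d\<^sup>2 \<le> (\<Sum>i\<in>generation q. (f (X i \<omega>) - g (X i \<omega>))\<^sup>2) / real (card (generation q))"
        by (rule mean_squared_le) simp
      also have "\<dots> \<le> (\<Sum>i\<in>generation q. (\<delta> * ?w (X i \<omega>))\<^sup>2) / real (card (generation q))"
      proof (intro divide_right_mono sum_mono)
        fix i
        show "(f (X i \<omega>) - g (X i \<omega>))\<^sup>2 \<le> (\<delta> * ?w (X i \<omega>))\<^sup>2"
          using power_mono[OF fg[of "X i \<omega>"], of 2] by simp
      qed simp
      also have "\<dots> = \<delta>\<^sup>2 * ?B \<omega>"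
        by (simp only: power_mult_distrib sum_distrib_left[symmetric] card_generation of_nat_power
            of_nat_numeral times_divide_eq_right)
      finally show ?thesis .
    qed
    moreover have "((\<integral>x. g x \<partial>\<mu>) - (\<integral>x. f x \<partial>\<mu>))\<^sup>2 \<le> (\<delta> * ?a)\<^sup>2"
      using power_mono[OF mu, of 2] by simp
    ultimately show ?thesis by (rule comb) simp
  qed
  have i: "integrable M (\<lambda>\<omega>. 4 * (?A \<omega>)\<^sup>2)" "integrable M (\<lambda>\<omega>. 4 * \<delta>\<^sup>2 * ?B \<omega>)"
    using A Bi[OF generation_ge_1] by (auto simp: sq_int_def simp del: power_mult_distrib)
  have "gen_error f q \<le> (\<integral>\<omega>. 4 * (?A \<omega>)\<^sup>2 + (4 * \<delta>\<^sup>2 * ?B \<omega> + 4 * (\<delta> * ?a)\<^sup>2) \<partial>M)"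
    unfolding gen_error_def
  proof (rule integral_mono'[OF _ pt])
    show "integrable M (\<lambda>\<omega>. 4 * (?A \<omega>)\<^sup>2 + (4 * \<delta>\<^sup>2 * ?B \<omega> + 4 * (\<delta> * ?a)\<^sup>2))"
      by (intro Bochner_Integration.integrable_add i integrable_const)
    show "0 \<le> 4 * (?A \<omega>)\<^sup>2 + (4 * \<delta>\<^sup>2 * ?B \<omega> + 4 * (\<delta> * ?a)\<^sup>2)" for \<omega>
      by (intro add_nonneg_nonneg mult_nonneg_nonneg divide_nonneg_nonneg sum_nonneg) auto
  qed
  also have "\<dots> = (\<integral>\<omega>. 4 * (?A \<omega>)\<^sup>2 \<partial>M) + ((\<integral>\<omega>. 4 * \<delta>\<^sup>2 * ?B \<omega> \<partial>M) + (\<integral>\<omega>. 4 * (\<delta> * ?a)\<^sup>2 \<partial>M))"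
    by (simp only: Bochner_Integration.integral_add[OF i(1) Bochner_Integration.integrable_add[OF i(2) integrable_const]]
        Bochner_Integration.integral_add[OF i(2) integrable_const])
  also have "(\<integral>\<omega>. 4 * (\<delta> * ?a)\<^sup>2 \<partial>M) = 4 * \<delta>\<^sup>2 * ?a\<^sup>2"
    by (simp add: prob_space power_mult_distrib)
  also have "(\<integral>\<omega>. 4 * (?A \<omega>)\<^sup>2 \<partial>M) = 4 * gen_error g q" by (simp add: gen_error_def)
  also have "(\<integral>\<omega>. 4 * \<delta>\<^sup>2 * ?B \<omega> \<partial>M) = 4 * \<delta>\<^sup>2 * ((\<Sum>i\<in>generation q. \<integral>\<omega>. (?w (X i \<omega>))\<^sup>2 \<partial>M) / 2 ^ q)"
    using Bi[OF generation_ge_1] by (simp add: Bochner_Integration.integral_sum)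
  also have "4 * gen_error g q + (4 * \<delta>\<^sup>2 * ((\<Sum>i\<in>generation q. \<integral>\<omega>. (?w (X i \<omega>))\<^sup>2 \<partial>M) / 2 ^ q) + 4 * \<delta>\<^sup>2 * ?a\<^sup>2)
      \<le> 4 * gen_error g q + (4 * \<delta>\<^sup>2 * K + 4 * \<delta>\<^sup>2 * ?a\<^sup>2)"
  proof (intro add_left_mono add_right_mono mult_left_mono)
    have "(\<Sum>i\<in>generation q. \<integral>\<omega>. (?w (X i \<omega>))\<^sup>2 \<partial>M) / 2 ^ q \<le> (\<Sum>i\<in>generation q. K) / 2 ^ q"
      by (intro divide_right_mono sum_mono K generation_ge_1) auto
    then show "(\<Sum>i\<in>generation q. \<integral>\<omega>. (?w (X i \<omega>))\<^sup>2 \<partial>M) / 2 ^ q \<le> K" by simp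
  qed simp
  finally show ?thesis by (simp add: algebra_simps)
qed

lemma gen_error_tendsto:
  assumes f: "f \<in> C_pol"
  shows "gen_error f \<longlonglongrightarrow> 0"
proof (rule LIMSEQ_I)
  fix e :: real assume e: "e > 0"
  obtain m where m: "\<And>\<delta>. \<delta> > 0 \<Longrightarrow> \<exists>L g. Lipschitz L g \<and> (\<forall>x. \<bar>f x - g x\<bar> \<le> \<delta> * (1 + \<bar>x\<bar> ^ m))"
    using Lipschitz_approx[OF f] by blast
  have wC: "(\<lambda>x :: real. (1 + \<bar>x\<bar> ^ m)\<^sup>2) \<in> C_pol"
    using C_pol_norm[where 'a=real] by (intro C_pol_add C_pol_const C_pol_power) (simp add: real_norm_def[abs_def])
  obtain K where K: "\<And>n. 1 \<le> n \<Longrightarrow> (\<integral>\<omega>. (1 + \<bar>X n \<omega>\<bar> ^ m)\<^sup>2 \<partial>M) \<le> K"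
    using C_pol_X_bound[OF wC] by auto
  have K0: "0 \<le> K" by (rule order_trans[OF _ K[of 1]]) auto
  let ?k = "K + (\<integral>x. 1 + \<bar>x\<bar> ^ m \<partial>\<mu>)\<^sup>2"
  have k: "?k \<ge> 0" using K0 by simp
  \<comment> \<open>Chosen so that the approximation terms add up to at most \<open>e / 2\<close>;
    the summand 1 avoids a division by zero.\<close>
  define \<delta> where "\<delta> = sqrt (e / (8 * (?k + 1)))"
  have \<delta>: "\<delta> > 0" "4 * \<delta>\<^sup>2 * ?k \<le> e / 2"
  proof -
    show "\<delta> > 0" using e k by (simp add: \<delta>_def add_nonneg_pos)
    have "4 * \<delta>\<^sup>2 * ?k = (e / 2) * (?k / (?k + 1))"
      using e k by (simp add: \<delta>_def field_simps)
    also have "\<dots> \<le> (e / 2) * 1" using e k by (intro mult_left_mono) auto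
    finally show "4 * \<delta>\<^sup>2 * ?k \<le> e / 2" by simp
  qed
  obtain L g where g: "Lipschitz L g" "\<And>x. \<bar>f x - g x\<bar> \<le> \<delta> * (1 + \<bar>x\<bar> ^ m)"
    using m[OF \<delta>(1)] by blast
  obtain N where N: "\<And>q. q \<ge> N \<Longrightarrow> gen_error g q < e / 8"
    using LIMSEQ_D[OF gen_error_Lipschitz_tendsto[OF g(1)], of "e / 8"] e by (auto simp: gen_error_nonneg)
  have "norm (gen_error f q - 0) < e" if "q \<ge> N" for q
    using gen_error_approx[OF f Lipschitz_C_pol[OF g(1)] less_imp_le[OF \<delta>(1)] g(2) K, of q] N[OF that] \<delta>(2)
      gen_error_nonneg[of f q] by simp
  then show "\<exists>no. \<forall>n\<ge>no. norm (gen_error f n - 0) < e" by blast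
qed

section \<open>Functions of a vertex and its daughters\<close>

abbreviation P :: "(real \<times> real \<times> real \<Rightarrow> real) \<Rightarrow> real \<Rightarrow> real" where
  "P \<equiv> apply_P (bar_P \<alpha>\<^sub>0 \<alpha>\<^sub>1 \<beta>\<^sub>0 \<beta>\<^sub>1 \<sigma> \<rho>)"

definition lift :: "(real \<times> real \<times> real \<Rightarrow> real) \<Rightarrow> real \<times> (real ^ 2) \<Rightarrow> real" where
  "lift f p = f (fst p, daughter False (fst p) (snd p), daughter True (fst p) (snd p))"

lemma family_triple_lift:
  assumes "i \<ge> 1" "\<omega> \<in> space M"
  shows "f (family_triple X i \<omega>) = lift f (X i \<omega>, W i \<omega>)"
  using X_daughter[OF assms] by (simp add: family_triple_def lift_def)

lemma C_pol_lift:
  assumes "f \<in> C_pol"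
  shows "lift f \<in> C_pol"
  unfolding lift_def
proof (rule C_pol_comp[OF assms])
  let ?g = "\<lambda>p. (fst p, daughter False (fst p) (snd p), daughter True (fst p) (snd p))"
  show "continuous_on UNIV ?g"
    unfolding daughter_def by (auto intro!: continuous_intros)
  fix p :: "real \<times> (real ^ 2)"
  have "norm (?g p) \<le> norm (fst p) + (norm (daughter False (fst p) (snd p)) + norm (daughter True (fst p) (snd p)))"
    by (intro order_trans[OF norm_Pair_le] add_left_mono norm_Pair_le)
  also have "\<dots> \<le> norm p + ((2 * norm p + drift) + (2 * norm p + drift))"
    using abs_daughter_le_norm[of _ p] norm_fst_le[of "fst p" "snd p"] by (intro add_mono) auto
  also have "\<dots> \<le> (5 + 2 * drift) * (1 + norm p)"
    using drift_nonneg by (simp add: algebra_simps)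
  finally show "norm (?g p) \<le> (5 + 2 * drift) * (1 + norm p)" .
qed

text \<open>The matrix chosen by \<open>SOME\<close> depends on the covariance alone, so the law
  with mean and the centered law use the same square root. The mean is then absorbed into
  \<open>daughter\<close>.\<close>

lemma P_eq:
  assumes "f \<in> C_pol"
  shows "P f x = (\<integral>w. lift f (x, w) \<partial>\<nu>0)"
proof -
  define A where "A = (SOME A :: real ^ 2 ^ 2. A ** transpose A = noise_cov \<sigma> \<rho>)"
  let ?m = "vector [\<alpha>\<^sub>0 * x + \<beta>\<^sub>0, \<alpha>\<^sub>1 * x + \<beta>\<^sub>1] :: real ^ 2"
  have [measurable]: "(\<lambda>w :: real ^ 2. f (x, w $ 1, w $ 2)) \<in> borel_measurable borel"
    by (intro borel_measurable_continuous_onI continuous_on_compose2[OF C_pol_continuous[OF assms]] continuous_intros) auto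
  have "P f x = (\<integral>z. f (x, (?m + A *v z) $ 1, (?m + A *v z) $ 2) \<partial>std_normal_vec)"
    unfolding apply_P_def bar_P_def multi_normal_def Let_def A_def[symmetric]
    by (subst integral_distr) auto
  also have "\<dots> = (\<integral>z. lift f (x, 0 + A *v z) \<partial>std_normal_vec)"
    by (simp add: lift_def daughter_def)
  also have "\<dots> = (\<integral>w. lift f (x, w) \<partial>\<nu>0)"
    unfolding \<nu>0_def multi_normal_def Let_def A_def[symmetric]
    by (subst integral_distr) (use C_pol_measurable[OF C_pol_section[OF C_pol_lift[OF assms], of x]] in auto)
  finally show ?thesis .
qed

lemma C_pol_P:
  assumes "f \<in> C_pol"
  shows "P f \<in> C_pol"
proof -
  have "P f = (\<lambda>x. \<integral>w. lift f (x, w) \<partial>\<nu>0)" by (rule ext, rule P_eq[OF assms])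
  then show ?thesis using C_pol_integral_\<nu>0[OF C_pol_lift[OF assms]] by simp
qed

text \<open>Given the values in generation \<open>q\<close>, the mean of \<open>f\<close> over the
  triples has conditional expectation the mean of \<open>P f\<close>. The fluctuation around it has
  variance at most \<open>K / 2 ^ q\<close>, and the mean of \<open>P f\<close> is covered by the
  result for functions of one vertex.\<close>

lemma generation_triple_tendsto:
  assumes f: "f \<in> C_pol"
  shows "(\<lambda>q. \<integral>\<omega>. (mean_over (family_triple X) (generation q) f \<omega> - (\<integral>x. P f x \<partial>\<mu>))\<^sup>2 \<partial>M) \<longlonglongrightarrow> 0"
proof -
  let ?c = "\<integral>x. P f x \<partial>\<mu>"
  define D where "D = (\<lambda>p. lift f p - (\<integral>w. lift f (fst p, w) \<partial>\<nu>0))"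
  have DC: "D \<in> C_pol"
    unfolding D_def by (intro C_pol_diff C_pol_lift f C_pol_fst C_pol_integral_\<nu>0)
  obtain K where K: "\<And>n. 1 \<le> n \<Longrightarrow> (\<integral>\<omega>. (D (X n \<omega>, W n \<omega>))\<^sup>2 \<partial>M) \<le> K"
    using C_pol_XW_bound[OF C_pol_power[OF DC, of 2]] by auto
  have eq: "(\<integral>\<omega>. (mean_over (family_triple X) (generation q) f \<omega> - ?c)\<^sup>2 \<partial>M)
      = gen_error (P f) q + (\<Sum>i\<in>generation q. \<integral>\<omega>. (D (X i \<omega>, W i \<omega>))\<^sup>2 \<partial>M) / (2 ^ q)\<^sup>2" for q
  proof -
    have "mean_over (family_triple X) (generation q) f \<omega> - ?c
        = (\<Sum>i\<in>generation q. P f (X i \<omega>)) / 2 ^ q - ?c + (\<Sum>i\<in>generation q. D (X i \<omega>, W i \<omega>)) / 2 ^ q"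
      if \<omega>: "\<omega> \<in> space M" for \<omega>
    proof -
      have "(\<Sum>i\<in>generation q. f (family_triple X i \<omega>)) = (\<Sum>i\<in>generation q. P f (X i \<omega>) + D (X i \<omega>, W i \<omega>))"
        by (intro sum.cong refl) (simp add: family_triple_lift[OF generation_ge_1 \<omega>] D_def P_eq[OF f])
      then show ?thesis by (simp add: mean_over_def sum.distrib add_divide_distrib)
    qed
    then have "(\<integral>\<omega>. (mean_over (family_triple X) (generation q) f \<omega> - ?c)\<^sup>2 \<partial>M)
      = (\<integral>\<omega>. ((\<Sum>i\<in>generation q. P f (X i \<omega>)) / 2 ^ q - ?c + (\<Sum>i\<in>generation q. D (X i \<omega>, W i \<omega>)) / 2 ^ q)\<^sup>2 \<partial>M)"
      by (intro Bochner_Integration.integral_cong refl) (simp only:)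
    also have "\<dots> = gen_error (P f) q + (\<Sum>i\<in>generation q. \<integral>\<omega>. (D (X i \<omega>, W i \<omega>))\<^sup>2 \<partial>M) / (2 ^ q)\<^sup>2"
      unfolding D_def
      by (subst second_moment_generation_step[OF C_pol_lift[OF f] C_pol_P[OF f]])
         (simp add: gen_error_def mean_over_def)
    finally show ?thesis .
  qed
  have le: "(\<Sum>i\<in>generation q. \<integral>\<omega>. (D (X i \<omega>, W i \<omega>))\<^sup>2 \<partial>M) / (2 ^ q)\<^sup>2 \<le> K * (1 / 2) ^ q" for q
  proof -
    have "(\<Sum>i\<in>generation q. \<integral>\<omega>. (D (X i \<omega>, W i \<omega>))\<^sup>2 \<partial>M) / (2 ^ q)\<^sup>2 \<le> (\<Sum>i\<in>generation q. K) / (2 ^ q)\<^sup>2"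
      by (intro divide_right_mono sum_mono K generation_ge_1) auto
    also have "\<dots> = K * (1 / 2) ^ q" by (simp add: power2_eq_square power_one_over field_simps)
    finally show ?thesis .
  qed
  have "(\<lambda>q. K * (1 / 2) ^ q) \<longlonglongrightarrow> K * 0" by (intro tendsto_mult_left LIMSEQ_realpow_zero) auto
  then have Kz: "(\<lambda>q. K * (1 / 2) ^ q) \<longlonglongrightarrow> 0" by simp
  have "(\<lambda>q. (\<Sum>i\<in>generation q. \<integral>\<omega>. (D (X i \<omega>, W i \<omega>))\<^sup>2 \<partial>M) / (2 ^ q)\<^sup>2) \<longlonglongrightarrow> 0"
    by (rule tendsto_sandwich[OF _ _ tendsto_const Kz])
       (auto intro!: always_eventually le divide_nonneg_nonneg sum_nonneg)
  from tendsto_add[OF gen_error_tendsto[OF C_pol_P[OF f]] this] show ?thesis unfolding eq by simp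
qed

end

section \<open>From second moments to convergence in mean square\<close>

lemma converges_in_L2_const:
  assumes "finite_measure M" and sq: "\<And>n. sq_int M (Z n)"
    and lim: "(\<lambda>n. \<integral>\<omega>. (Z n \<omega> - c)\<^sup>2 \<partial>M) \<longlonglongrightarrow> 0"
  shows "converges_in_L2 M Z (\<lambda>_. c)"
proof -
  interpret finite_measure M by fact
  show ?thesis using sq lim by (simp add: converges_in_L2_def sq_int_def)
qed

context L2_bounded_family
begin

lemma L2_convergence:
  assumes \<xi>: "\<And>i \<omega>. 1 \<le> i \<Longrightarrow> \<omega> \<in> space M \<Longrightarrow> \<xi> i \<omega> = f (V i \<omega>) - c"
  shows "converges_in_L2 M (\<lambda>q. mean_over V (generation q) f) (\<lambda>_. c)"
    "converges_in_L2 M (\<lambda>r. mean_over V (subtree r) f) (\<lambda>_. c)"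
    "converges_in_L2 M (\<lambda>n. perm_mean V \<pi> n f) (\<lambda>_. c)"
proof -
  have mean_eq: "mean_over V I f \<omega> = (\<Sum>i\<in>I. \<xi> i \<omega>) / real (card I) + c"
    if "\<omega> \<in> space M" "I \<subseteq> {1..}" "finite I" "I \<noteq> {}" for \<omega> I
  proof -
    have "(\<Sum>i\<in>I. f (V i \<omega>)) = (\<Sum>i\<in>I. \<xi> i \<omega> + c)"
    proof (rule sum.cong[OF refl])
      fix i assume "i \<in> I"
      then have "1 \<le> i" using that(2) by auto
      from \<xi>[OF this that(1)] show "f (V i \<omega>) = \<xi> i \<omega> + c" by simp
    qed
    then have "(\<Sum>i\<in>I. f (V i \<omega>)) = (\<Sum>i\<in>I. \<xi> i \<omega>) + real (card I) * c"
      by (simp add: sum.distrib)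
    then show ?thesis using that by (simp add: mean_over_def add_divide_distrib)
  qed
  have mean_sq: "sq_int M (mean_over V I f)" if "I \<subseteq> {1..}" "finite I" "I \<noteq> {}" for I
  proof -
    have "sq_int M (\<lambda>\<omega>. (\<Sum>i\<in>I. \<xi> i \<omega>) / real (card I) + c)"
      by (intro sq_int_add sq_int_divide sq_int_sum_\<xi> sq_int_const that)
    then show ?thesis by (subst sq_int_cong[OF mean_eq[OF _ that]])
  qed
  have mean_int: "(\<integral>\<omega>. (mean_over V I f \<omega> - c)\<^sup>2 \<partial>M) = (\<integral>\<omega>. ((\<Sum>i\<in>I. \<xi> i \<omega>) / real (card I))\<^sup>2 \<partial>M)"
    if "I \<subseteq> {1..}" "finite I" "I \<noteq> {}" for I
    by (intro Bochner_Integration.integral_cong refl) (simp add: mean_eq[OF _ that])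
  have gen: "generation q \<subseteq> {1..}" "finite (generation q)" "generation q \<noteq> {}" for q
    using generation_ge_1 by (auto simp: generation_def)
  have sub: "subtree r \<subseteq> {1..}" "finite (subtree r)" "subtree r \<noteq> {}" for r
    using one_less_power[of "2 :: nat" "Suc r"] by (auto simp: subtree_eq simp del: power_Suc)
  show "converges_in_L2 M (\<lambda>q. mean_over V (generation q) f) (\<lambda>_. c)"
    by (rule converges_in_L2_const[OF finite_measure_axioms mean_sq[OF gen]])
       (use generation_tendsto in \<open>simp add: mean_int[OF gen]\<close>)
  show "converges_in_L2 M (\<lambda>r. mean_over V (subtree r) f) (\<lambda>_. c)"
    by (rule converges_in_L2_const[OF finite_measure_axioms mean_sq[OF sub]])
       (use subtree_tendsto in \<open>simp add: mean_int[OF sub]\<close>)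
  have perm_eq: "perm_sum V \<pi> n f \<omega> = (\<Sum>i=1..n. \<xi> (\<pi> \<omega> i) \<omega>) + real n * c" if \<omega>: "\<omega> \<in> space M" for n \<omega>
  proof -
    have "f (V (\<pi> \<omega> i) \<omega>) = \<xi> (\<pi> \<omega> i) \<omega> + c" if "i \<in> {1..n}" for i
    proof -
      have "\<pi> \<omega> i \<in> {1..}" using permutation[OF \<omega>] that by (auto simp: bij_betw_def)
      then show ?thesis using \<xi>[OF _ \<omega>] by simp
    qed
    then show ?thesis by (simp add: perm_sum_def sum.distrib)
  qed
  have perm_sq: "sq_int M (perm_mean V \<pi> n f)" for n
  proof -
    have "sq_int M (\<lambda>\<omega>. ((\<Sum>i=1..n. \<xi> (\<pi> \<omega> i) \<omega>) + real n * c) / real n)"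
      by (intro sq_int_add sq_int_divide sq_int_perm sq_int_const)
    then show ?thesis
      by (subst sq_int_cong[where g="\<lambda>\<omega>. ((\<Sum>i=1..n. \<xi> (\<pi> \<omega> i) \<omega>) + real n * c) / real n"])
         (simp_all only: perm_mean_def perm_eq)
  qed
  have perm_int: "(\<integral>\<omega>. (perm_mean V \<pi> n f \<omega> - c)\<^sup>2 \<partial>M) = (\<integral>\<omega>. ((\<Sum>i=1..n. \<xi> (\<pi> \<omega> i) \<omega>) / real n)\<^sup>2 \<partial>M)"
    if "n > 0" for n
    using that by (intro Bochner_Integration.integral_cong refl) (simp add: perm_mean_def perm_eq add_divide_distrib)
  \<comment> \<open>At \<open>n = 0\<close> both quotients are 0 by convention and the centered
    identity breaks unless \<open>c = 0\<close>; hence the comparison is only eventual.\<close>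
  have "(\<lambda>n. \<integral>\<omega>. (perm_mean V \<pi> n f \<omega> - c)\<^sup>2 \<partial>M) \<longlonglongrightarrow> 0"
    by (rule Lim_transform_eventually[OF perm_tendsto])
       (use perm_int in \<open>auto intro!: eventually_sequentiallyI[of 1]\<close>)
  then show "converges_in_L2 M (\<lambda>n. perm_mean V \<pi> n f) (\<lambda>_. c)"
    by (rule converges_in_L2_const[OF finite_measure_axioms perm_sq])
qed

end

locale bar_permuted =
  bar_model_stationary M \<alpha>\<^sub>0 \<alpha>\<^sub>1 \<beta>\<^sub>0 \<beta>\<^sub>1 \<sigma> \<rho> \<nu> X \<epsilon> \<mu> + generation_permutation M \<pi>
  for M :: "'w measure" and \<alpha>\<^sub>0 \<alpha>\<^sub>1 \<beta>\<^sub>0 \<beta>\<^sub>1 \<sigma> \<rho> :: real and \<nu> :: "real measure"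
    and X \<epsilon> :: "nat \<Rightarrow> 'w \<Rightarrow> real" and \<mu> :: "real measure" and \<pi> :: "'w \<Rightarrow> nat \<Rightarrow> nat" +
  assumes X_perm_indep: "indep_rv
     (\<Pi>\<^sub>M n\<in>{1..}. borel) (\<lambda>\<omega>. \<lambda>n\<in>{1..}. X n \<omega>)
     (\<Pi>\<^sub>M n\<in>{1..}. count_space UNIV) (\<lambda>\<omega>. \<lambda>n\<in>{1..}. \<pi> \<omega> n)"
begin

definition sigma_X :: "'w measure" where
  "sigma_X = vimage_algebra (space M) (\<lambda>\<omega>. \<lambda>n\<in>{1..}. X n \<omega>) (\<Pi>\<^sub>M n\<in>{1..}. borel)"

lemma sets_sigma_X:
  "sets sigma_X = {(\<lambda>\<omega>. \<lambda>n\<in>{1..}. X n \<omega>) -` A \<inter> space M | A. A \<in> sets (\<Pi>\<^sub>M n\<in>{1..}. borel)}"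
  unfolding sigma_X_def by (rule sets_vimage_algebra2) (auto simp: space_PiM)

sublocale permuted_family M \<pi> sigma_X
proof
  show "subalgebra M sigma_X"
    using X_perm_indep unfolding subalgebra_def sets_sigma_X indep_rv_def
    by (auto simp: sigma_X_def intro: measurable_sets)
  show "(\<lambda>\<omega>. \<lambda>n\<in>{1..}. \<pi> \<omega> n) \<in> measurable M (\<Pi>\<^sub>M n\<in>{1..}. count_space UNIV)"
    using X_perm_indep unfolding indep_rv_def by blast
  fix A :: "'w set" and B :: "(nat \<Rightarrow> nat) set"
  assume "A \<in> sets sigma_X" "B \<in> sets (\<Pi>\<^sub>M n\<in>{1..}. count_space UNIV :: nat measure)"
  then show "prob (A \<inter> ((\<lambda>\<omega>. \<lambda>n\<in>{1..}. \<pi> \<omega> n) -` B \<inter> space M))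
        = prob A * prob ((\<lambda>\<omega>. \<lambda>n\<in>{1..}. \<pi> \<omega> n) -` B \<inter> space M)"
    using X_perm_indep unfolding indep_rv_def sets_sigma_X by (intro indep_setD[where A="{(\<lambda>\<omega>. \<lambda>n\<in>{1..}. X n \<omega>) -` A \<inter> space M | A. A \<in> sets (\<Pi>\<^sub>M n\<in>{1..}. borel)}"]) auto
qed

lemma X_sigma_X: "1 \<le> n \<Longrightarrow> X n \<in> borel_measurable sigma_X"
proof -
  assume n: "1 \<le> n"
  have "(\<lambda>\<omega>. \<lambda>n\<in>{1..}. X n \<omega>) \<in> measurable sigma_X (\<Pi>\<^sub>M n\<in>{1..}. borel)"
    unfolding sigma_X_def by (rule measurable_vimage_algebra1) (auto simp: space_PiM)
  from measurable_compose[OF this measurable_component_singleton[of n]] n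
  show ?thesis by simp
qed

lemma family_triple_sigma_X:
  assumes "f \<in> C_pol" "1 \<le> i"
  shows "(\<lambda>\<omega>. f (family_triple X i \<omega>)) \<in> borel_measurable sigma_X"
  unfolding family_triple_def
  by (rule measurable_compose[OF _ C_pol_measurable[OF assms(1)]])
     (use assms(2) in \<open>intro borel_measurable_Pair X_sigma_X; simp\<close>)

text \<open>The last two clauses are the form in which the law of large numbers is applied to the
  conditional variance in the central limit theorem.\<close>

lemma L2_convergence_X:
  assumes f: "f \<in> C_pol"
  shows "converges_in_L2 M (\<lambda>q. mean_over X (generation q) f) (\<lambda>_. \<integral>x. f x \<partial>\<mu>)"
    "converges_in_L2 M (\<lambda>r. mean_over X (subtree r) f) (\<lambda>_. \<integral>x. f x \<partial>\<mu>)"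
    "converges_in_L2 M (\<lambda>n. perm_mean X \<pi> n f) (\<lambda>_. \<integral>x. f x \<partial>\<mu>)"
    "(\<lambda>n. \<integral>\<omega>. ((\<Sum>i=1..n. f (X (\<pi> \<omega> i) \<omega>) - (\<integral>x. f x \<partial>\<mu>)) / real n)\<^sup>2 \<partial>M) \<longlonglongrightarrow> 0"
    "sq_int M (\<lambda>\<omega>. \<Sum>i=1..n. f (X (\<pi> \<omega> i) \<omega>) - (\<integral>x. f x \<partial>\<mu>))"
proof -
  let ?c = "\<integral>x. f x \<partial>\<mu>"
  have fC: "(\<lambda>x. (f x - ?c)\<^sup>2) \<in> C_pol" by (intro C_pol_power C_pol_diff f C_pol_const)
  obtain K where K: "\<And>i. 1 \<le> i \<Longrightarrow> (\<integral>\<omega>. (f (X i \<omega>) - ?c)\<^sup>2 \<partial>M) \<le> K"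
    using C_pol_X_bound[OF fC] by auto
  interpret L2_bounded_family M \<pi> sigma_X "\<lambda>i \<omega>. f (X i \<omega>) - ?c" K
  proof
    show "(\<lambda>\<omega>. f (X i \<omega>) - ?c) \<in> borel_measurable sigma_X" if "1 \<le> i" for i
      by (intro borel_measurable_diff borel_measurable_const measurable_compose[OF X_sigma_X[OF that] C_pol_measurable[OF f]])
    show "integrable M (\<lambda>\<omega>. (f (X i \<omega>) - ?c)\<^sup>2)" if "1 \<le> i" for i
      by (rule integrable_X[OF fC that])
    have "(\<Sum>i\<in>generation q. f (X i \<omega>) - ?c) / 2 ^ q = mean_over X (generation q) f \<omega> - ?c" for q \<omega>
      by (simp add: mean_over_def sum_subtractf diff_divide_distrib)
    then show "(\<lambda>q. \<integral>\<omega>. ((\<Sum>i\<in>generation q. f (X i \<omega>) - ?c) / 2 ^ q)\<^sup>2 \<partial>M) \<longlonglongrightarrow> 0"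
      using gen_error_tendsto[OF f] by (simp add: gen_error_def[abs_def])
  qed (rule K)
  show "converges_in_L2 M (\<lambda>q. mean_over X (generation q) f) (\<lambda>_. ?c)"
    "converges_in_L2 M (\<lambda>r. mean_over X (subtree r) f) (\<lambda>_. ?c)"
    "converges_in_L2 M (\<lambda>n. perm_mean X \<pi> n f) (\<lambda>_. ?c)"
    by (rule L2_convergence, rule refl)+
  show "(\<lambda>n. \<integral>\<omega>. ((\<Sum>i=1..n. f (X (\<pi> \<omega> i) \<omega>) - ?c) / real n)\<^sup>2 \<partial>M) \<longlonglongrightarrow> 0"
    by (rule perm_tendsto)
  show "sq_int M (\<lambda>\<omega>. \<Sum>i=1..n. f (X (\<pi> \<omega> i) \<omega>) - ?c)"
    by (rule sq_int_perm)
qed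

lemma L2_convergence_triple:
  assumes f: "f \<in> C_pol"
  shows "converges_in_L2 M (\<lambda>q. mean_over (family_triple X) (generation q) f) (\<lambda>_. \<integral>x. P f x \<partial>\<mu>)"
    "converges_in_L2 M (\<lambda>r. mean_over (family_triple X) (subtree r) f) (\<lambda>_. \<integral>x. P f x \<partial>\<mu>)"
    "converges_in_L2 M (\<lambda>n. perm_mean (family_triple X) \<pi> n f) (\<lambda>_. \<integral>x. P f x \<partial>\<mu>)"
proof -
  let ?c = "\<integral>x. P f x \<partial>\<mu>"
  have fC: "(\<lambda>p. (lift f p - ?c)\<^sup>2) \<in> C_pol" by (intro C_pol_power C_pol_diff C_pol_lift f C_pol_const)
  have eq: "(f (family_triple X i \<omega>) - ?c)\<^sup>2 = (lift f (X i \<omega>, W i \<omega>) - ?c)\<^sup>2"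
    if "1 \<le> i" "\<omega> \<in> space M" for i \<omega>
    by (simp add: family_triple_lift[OF that])
  obtain K where K: "\<And>i. 1 \<le> i \<Longrightarrow> (\<integral>\<omega>. (lift f (X i \<omega>, W i \<omega>) - ?c)\<^sup>2 \<partial>M) \<le> K"
    using C_pol_XW_bound[OF fC] by auto
  interpret L2_bounded_family M \<pi> sigma_X "\<lambda>i \<omega>. f (family_triple X i \<omega>) - ?c" K
  proof
    show "(\<lambda>\<omega>. f (family_triple X i \<omega>) - ?c) \<in> borel_measurable sigma_X" if "1 \<le> i" for i
      by (intro borel_measurable_diff borel_measurable_const family_triple_sigma_X f that)
    show "integrable M (\<lambda>\<omega>. (f (family_triple X i \<omega>) - ?c)\<^sup>2)" if "1 \<le> i" for i
      by (subst Bochner_Integration.integrable_cong[OF refl eq[OF that]]) (assumption, rule integrable_XW[OF fC that])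
    show "(\<integral>\<omega>. (f (family_triple X i \<omega>) - ?c)\<^sup>2 \<partial>M) \<le> K" if "1 \<le> i" for i
      by (subst Bochner_Integration.integral_cong[OF refl eq[OF that]]) (assumption, rule K[OF that])
    have "(\<Sum>i\<in>generation q. f (family_triple X i \<omega>) - ?c) / 2 ^ q = mean_over (family_triple X) (generation q) f \<omega> - ?c" for q \<omega>
      by (simp add: mean_over_def sum_subtractf diff_divide_distrib)
    then show "(\<lambda>q. \<integral>\<omega>. ((\<Sum>i\<in>generation q. f (family_triple X i \<omega>) - ?c) / 2 ^ q)\<^sup>2 \<partial>M) \<longlonglongrightarrow> 0"
      using generation_triple_tendsto[OF f] by simp
  qed
  show "converges_in_L2 M (\<lambda>q. mean_over (family_triple X) (generation q) f) (\<lambda>_. ?c)"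
    "converges_in_L2 M (\<lambda>r. mean_over (family_triple X) (subtree r) f) (\<lambda>_. ?c)"
    "converges_in_L2 M (\<lambda>n. perm_mean (family_triple X) \<pi> n f) (\<lambda>_. ?c)"
    by (rule L2_convergence, rule refl)+
qed

section \<open>The central limit theorem\<close>

definition innovation :: "(real \<times> real \<times> real \<Rightarrow> real) \<Rightarrow> real \<times> (real ^ 2) \<Rightarrow> real" where
  "innovation g p = lift g p - P g (fst p)"

lemma C_pol_innovation: "g \<in> C_pol \<Longrightarrow> innovation g \<in> C_pol"
  unfolding innovation_def by (intro C_pol_diff C_pol_lift C_pol_fst C_pol_P)

lemma centered_innovation:
  assumes "g \<in> C_pol"
  shows "centered (\<lambda>p. c * innovation g p)"
  using centered_minus_integral[OF C_pol_lift[OF assms], of c]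
  by (simp add: innovation_def P_eq[OF assms])

text \<open>For each possible set of visited vertices the sum runs in increasing order, whatever the
  order of visit, and the martingale bound applies. The characteristic function and the error of the
  conditional variance are averages of their values over these sets with the same weights, and the
  remaining terms depend on the set only through its size \<open>n\<close>; so the bound survives
  averaging.\<close>

lemma char_perm_sum_bound:
  assumes g: "g \<in> C_pol" and s: "s = (\<integral>x. cond_var (innovation g) x \<partial>\<mu>)"
    and K3: "\<And>i. 1 \<le> i \<Longrightarrow> (\<integral>\<omega>. cond_abs3 (innovation g) (X i \<omega>) \<partial>M) \<le> K3"
    and K4: "\<And>i. 1 \<le> i \<Longrightarrow> (\<integral>\<omega>. (cond_var (innovation g) (X i \<omega>))\<^sup>2 \<partial>M) \<le> K4"
    and n: "n \<ge> 1"
  shows "cmod ((\<integral>\<omega>. cis ((\<Sum>i=1..n. g (family_triple X (\<pi> \<omega> i) \<omega>) - P g (X (\<pi> \<omega> i) \<omega>)) / sqrt (real n)) \<partial>M)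
        - of_real (exp (- s / 2)))
    \<le> (\<integral>\<omega>. \<bar>(\<Sum>i=1..n. cond_var (innovation g) (X (\<pi> \<omega> i) \<omega>) - s) / real n\<bar> \<partial>M) / 2
      + (K3 / sqrt (real n) / 6 + K4 / real n / 8)"
proof -
  obtain r where r: "2 ^ r \<le> n" "n < 2 ^ (r + 1)" using ex_power_ivl1[of 2 n] n by auto
  let ?P = "{p. p permutes generation r}"
  let ?D = "innovation g" and ?a = "1 / sqrt (real n)"
  let ?h = "cond_var ?D"
  have DC: "?D \<in> C_pol" by (rule C_pol_innovation[OF g])
  have hC: "?h \<in> C_pol" by (rule C_pol_cond_var[OF DC])
  have s0: "0 \<le> s" unfolding s by (rule Bochner_Integration.integral_nonneg) (rule cond_var_nonneg)
  define z where "z j \<omega> = g (family_triple X j \<omega>) - P g (X j \<omega>)" for j \<omega>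
  have zD: "z j \<omega> = ?D (X j \<omega>, W j \<omega>)" if "1 \<le> j" "\<omega> \<in> space M" for j \<omega>
    by (simp add: z_def innovation_def family_triple_lift[OF that])
  have zm: "z j \<in> borel_measurable sigma_X" if "1 \<le> j" for j
    unfolding z_def
    by (intro borel_measurable_diff family_triple_sigma_X g that
        measurable_compose[OF X_sigma_X[OF that] C_pol_measurable[OF C_pol_P[OF g]]])
  let ?C = "\<lambda>J \<omega>. cis ((\<Sum>j\<in>J. z j \<omega>) / sqrt (real n))"
  let ?V = "\<lambda>J \<omega>. \<bar>(\<Sum>j\<in>J. ?h (X j \<omega>) - s) / real n\<bar>"
  have Cm: "?C (selected r n p) \<in> borel_measurable sigma_X" if "p permutes generation r" for p
    using selected_subset(2)[OF that r]
    by (intro measurable_compose[OF _ cis_measurable] borel_measurable_divide borel_measurable_sum zm borel_measurable_const) auto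
  have Ci: "integrable M (?C (selected r n p))" if "p permutes generation r" for p
    by (rule integrable_const_bound[where B=1]) (use measurable_from_subalg[OF FX Cm[OF that]] in auto)
  have Vm: "?V (selected r n p) \<in> borel_measurable sigma_X" if "p permutes generation r" for p
    using selected_subset(2)[OF that r]
    by (intro borel_measurable_abs borel_measurable_divide borel_measurable_sum borel_measurable_diff
        borel_measurable_const measurable_compose[OF X_sigma_X C_pol_measurable[OF hC]]) auto
  have Vi: "integrable M (?V (selected r n p))" if "p permutes generation r" for p
    using selected_subset(2)[OF that r]
    by (intro integrable_abs integrable_divide Bochner_Integration.integrable_sum Bochner_Integration.integrable_diff
        integrable_const integrable_X hC) auto
  have sel: "cmod ((\<integral>\<omega>. ?C (selected r n p) \<omega> \<partial>M) - of_real (exp (- s / 2)))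
      \<le> (\<integral>\<omega>. ?V (selected r n p) \<omega> \<partial>M) / 2 + (K3 / sqrt (real n) / 6 + K4 / real n / 8)"
    if p: "p permutes generation r" for p
  proof -
    let ?J = "selected r n p"
    note J = selected_subset[OF p r] and cJ = card_selected[OF p r]
    let ?E = "\<lambda>q. ?a * ?D q"
    have cv: "cond_var ?E x = ?h x / real n" for x
      using n by (simp add: cond_var_def power_mult_distrib power_divide)
    have c3: "cond_abs3 ?E x = cond_abs3 ?D x * (?a / real n)" for x
    proof -
      have "\<bar>?a\<bar> ^ 3 = ?a / real n"
        using n by (simp add: power_divide power3_eq_cube real_sqrt_mult_self)
      then have "\<bar>?E (x, w)\<bar> ^ 3 = (?a / real n) * \<bar>?D (x, w)\<bar> ^ 3" for w
        by (simp only: abs_mult power_mult_distrib)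
      then show ?thesis by (simp only: cond_abs3_def integral_mult_right_zero mult.commute)
    qed
    have C_eq: "(\<integral>\<omega>. ?C ?J \<omega> \<partial>M) = (\<integral>\<omega>. cis (\<Sum>j\<in>?J. ?E (X j \<omega>, W j \<omega>)) \<partial>M)"
    proof (rule Bochner_Integration.integral_cong[OF refl])
      fix \<omega> assume \<omega>: "\<omega> \<in> space M"
      have "(\<Sum>j\<in>?J. z j \<omega>) / sqrt (real n) = (\<Sum>j\<in>?J. ?E (X j \<omega>, W j \<omega>))"
        unfolding sum_divide_distrib using J(2) zD[OF _ \<omega>] by (intro sum.cong refl) auto
      then show "?C ?J \<omega> = cis (\<Sum>j\<in>?J. ?E (X j \<omega>, W j \<omega>))" by simp
    qed
    have V_eq: "\<bar>(\<Sum>j\<in>?J. cond_var ?E (X j \<omega>)) - s\<bar> = ?V ?J \<omega>" for \<omega>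
    proof -
      have "(\<Sum>j\<in>?J. cond_var ?E (X j \<omega>)) - s = (\<Sum>j\<in>?J. ?h (X j \<omega>) - s) / real n"
        unfolding cv using n by (simp add: sum_divide_distrib[symmetric] sum_subtractf cJ diff_divide_distrib)
      then show ?thesis by simp
    qed
    have "(\<Sum>j\<in>?J. \<integral>\<omega>. cond_abs3 ?E (X j \<omega>) / 6 + (cond_var ?E (X j \<omega>))\<^sup>2 / 8 \<partial>M)
        \<le> (\<Sum>j\<in>?J. K3 * (?a / real n) / 6 + K4 / (real n)\<^sup>2 / 8)"
    proof (rule sum_mono)
      fix j assume "j \<in> ?J"
      then have j: "1 \<le> j" using J(2) by auto
      have i3: "integrable M (\<lambda>\<omega>. cond_abs3 ?D (X j \<omega>))" by (rule integrable_X[OF C_pol_cond_abs3[OF DC] j])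
      have i4: "integrable M (\<lambda>\<omega>. (?h (X j \<omega>))\<^sup>2)" by (rule integrable_X[OF C_pol_power[OF hC] j])
      have "(\<integral>\<omega>. cond_abs3 ?E (X j \<omega>) / 6 + (cond_var ?E (X j \<omega>))\<^sup>2 / 8 \<partial>M)
          = (\<integral>\<omega>. cond_abs3 ?D (X j \<omega>) * (?a / real n) / 6 + (?h (X j \<omega>))\<^sup>2 / (real n)\<^sup>2 / 8 \<partial>M)"
        by (simp only: c3 cv power_divide)
      also have "\<dots> = (\<integral>\<omega>. cond_abs3 ?D (X j \<omega>) \<partial>M) * (?a / real n) / 6
          + (\<integral>\<omega>. (?h (X j \<omega>))\<^sup>2 \<partial>M) / (real n)\<^sup>2 / 8"
        using i3 i4 by (subst Bochner_Integration.integral_add) (auto intro: integrable_mult_left)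
      also have "\<dots> \<le> K3 * (?a / real n) / 6 + K4 / (real n)\<^sup>2 / 8"
        by (intro add_mono divide_right_mono mult_right_mono K3 K4 j) auto
      finally show "(\<integral>\<omega>. cond_abs3 ?E (X j \<omega>) / 6 + (cond_var ?E (X j \<omega>))\<^sup>2 / 8 \<partial>M)
          \<le> K3 * (?a / real n) / 6 + K4 / (real n)\<^sup>2 / 8" .
    qed
    also have "\<dots> = K3 / sqrt (real n) / 6 + K4 / real n / 8"
      using n by (simp add: cJ distrib_left power2_eq_square)
    finally have small: "(\<Sum>j\<in>?J. \<integral>\<omega>. cond_abs3 ?E (X j \<omega>) / 6 + (cond_var ?E (X j \<omega>))\<^sup>2 / 8 \<partial>M)
        \<le> K3 / sqrt (real n) / 6 + K4 / real n / 8" .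
    show ?thesis
      using char_martingale_sum[OF centered_innovation[OF g, of ?a] s0 J] small
      unfolding C_eq V_eq by linarith
  qed
  have cP: "card ?P = fact (2 ^ r)" by (rule card_permutations) auto
  have "(\<integral>\<omega>. cis ((\<Sum>i=1..n. g (family_triple X (\<pi> \<omega> i) \<omega>) - P g (X (\<pi> \<omega> i) \<omega>)) / sqrt (real n)) \<partial>M)
      = (\<integral>\<omega>. ?C (\<pi> \<omega> ` {1..n}) \<omega> \<partial>M)"
  proof (rule Bochner_Integration.integral_cong[OF refl])
    fix \<omega> assume "\<omega> \<in> space M"
    from sum_perm[OF this, of "\<lambda>j. z j \<omega>" n]
    show "cis ((\<Sum>i=1..n. g (family_triple X (\<pi> \<omega> i) \<omega>) - P g (X (\<pi> \<omega> i) \<omega>)) / sqrt (real n)) = ?C (\<pi> \<omega> ` {1..n}) \<omega>"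
      by (simp only: z_def)
  qed
  also have "\<dots> = (\<Sum>p\<in>?P. \<integral>\<omega>. ?C (selected r n p) \<omega> \<partial>M) /\<^sub>R fact (2 ^ r)"
    by (rule integral_perm[where H="?C", OF r Cm Ci])
  finally have C_avg: "(\<integral>\<omega>. cis ((\<Sum>i=1..n. g (family_triple X (\<pi> \<omega> i) \<omega>) - P g (X (\<pi> \<omega> i) \<omega>)) / sqrt (real n)) \<partial>M)
      = (\<Sum>p\<in>?P. \<integral>\<omega>. ?C (selected r n p) \<omega> \<partial>M) /\<^sub>R fact (2 ^ r)" .
  have "(\<integral>\<omega>. \<bar>(\<Sum>i=1..n. ?h (X (\<pi> \<omega> i) \<omega>) - s) / real n\<bar> \<partial>M) = (\<integral>\<omega>. ?V (\<pi> \<omega> ` {1..n}) \<omega> \<partial>M)"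
  proof (rule Bochner_Integration.integral_cong[OF refl])
    fix \<omega> assume "\<omega> \<in> space M"
    from sum_perm[OF this, of "\<lambda>j. ?h (X j \<omega>) - s" n]
    show "\<bar>(\<Sum>i=1..n. ?h (X (\<pi> \<omega> i) \<omega>) - s) / real n\<bar> = ?V (\<pi> \<omega> ` {1..n}) \<omega>" by (simp only:)
  qed
  also have "\<dots> = (\<Sum>p\<in>?P. \<integral>\<omega>. ?V (selected r n p) \<omega> \<partial>M) /\<^sub>R fact (2 ^ r)"
    by (rule integral_perm[where H="?V", OF r Vm Vi])
  finally have V_avg: "(\<integral>\<omega>. \<bar>(\<Sum>i=1..n. ?h (X (\<pi> \<omega> i) \<omega>) - s) / real n\<bar> \<partial>M)
      = (\<Sum>p\<in>?P. \<integral>\<omega>. ?V (selected r n p) \<omega> \<partial>M) /\<^sub>R fact (2 ^ r)" .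
  have avg_affine: "(\<Sum>p\<in>A. v p / 2 + k) /\<^sub>R F = (\<Sum>p\<in>A. v p) /\<^sub>R F / 2 + k"
    if "real (card A) = F" "F \<noteq> 0" for v and A :: "(nat \<Rightarrow> nat) set" and k F :: real
  proof -
    have "(\<Sum>p\<in>A. v p / 2 + k) = (\<Sum>p\<in>A. v p) / 2 + F * k"
      by (simp only: sum.distrib sum_divide_distrib[symmetric] sum_constant that)
    then show ?thesis using that(2) by (simp add: distrib_left)
  qed
  let ?k = "K3 / sqrt (real n) / 6 + K4 / real n / 8" and ?e = "complex_of_real (exp (- s / 2))"
  have eq: "(\<Sum>p\<in>?P. \<integral>\<omega>. ?C (selected r n p) \<omega> \<partial>M) /\<^sub>R fact (2 ^ r) - ?e
      = (\<Sum>p\<in>?P. (\<integral>\<omega>. ?C (selected r n p) \<omega> \<partial>M) - ?e) /\<^sub>R fact (2 ^ r)"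
    by (simp add: sum_subtractf cP scaleR_conv_of_real algebra_simps)
  have "cmod ((\<Sum>p\<in>?P. \<integral>\<omega>. ?C (selected r n p) \<omega> \<partial>M) /\<^sub>R fact (2 ^ r) - ?e)
      \<le> (\<Sum>p\<in>?P. (\<integral>\<omega>. ?V (selected r n p) \<omega> \<partial>M) / 2 + ?k) /\<^sub>R fact (2 ^ r)"
    unfolding eq norm_scaleR real_scaleR_def
  proof (rule mult_mono)
    show "cmod (\<Sum>p\<in>?P. (\<integral>\<omega>. ?C (selected r n p) \<omega> \<partial>M) - ?e)
        \<le> (\<Sum>p\<in>?P. (\<integral>\<omega>. ?V (selected r n p) \<omega> \<partial>M) / 2 + ?k)"
      by (intro order_trans[OF norm_sum] sum_mono sel) simp
    show "\<bar>inverse (fact (2 ^ r) :: real)\<bar> \<le> inverse (fact (2 ^ r))"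
      by (simp only: abs_inverse abs_of_nonneg[OF fact_ge_zero] order_refl)
    show "0 \<le> inverse (fact (2 ^ r) :: real)"
      by (rule inverse_nonnegative_iff_nonnegative[THEN iffD2], rule fact_ge_zero)
  qed (rule norm_ge_zero)
  also have "\<dots> = (\<Sum>p\<in>?P. \<integral>\<omega>. ?V (selected r n p) \<omega> \<partial>M) /\<^sub>R fact (2 ^ r) / 2 + ?k"
    by (rule avg_affine[of ?P "fact (2 ^ r)" "\<lambda>p. \<integral>\<omega>. ?V (selected r n p) \<omega> \<partial>M" ?k])
       (unfold cP, rule of_nat_fact, rule fact_nonzero)
  finally show ?thesis unfolding C_avg V_avg .
qed

end

lemma perm_sum_eq: "perm_sum V \<pi> n f = (\<lambda>\<omega>. real n * perm_mean V \<pi> n f \<omega>)"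
  by (cases "n = 0") (auto simp: perm_mean_def perm_sum_def)

context bar_permuted
begin

text \<open>The \<open>L\<^sup>1\<close> error of the conditional variance is at most the root of
  its \<open>L\<^sup>2\<close> error, which vanishes by the law of large numbers for permuted means;
  the third-order terms are of order \<open>1 / sqrt n\<close>.\<close>

lemma char_perm_sum_tendsto:
  assumes g: "g \<in> C_pol"
  shows "(\<lambda>n. \<integral>\<omega>. cis ((\<Sum>i=1..n. g (family_triple X (\<pi> \<omega> i) \<omega>) - P g (X (\<pi> \<omega> i) \<omega>)) / sqrt (real n)) \<partial>M)
    \<longlonglongrightarrow> of_real (exp (- (\<integral>x. cond_var (innovation g) x \<partial>\<mu>) / 2))"
proof -
  let ?h = "cond_var (innovation g)" and ?s = "\<integral>x. cond_var (innovation g) x \<partial>\<mu>"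
  let ?\<phi> = "\<lambda>n. \<integral>\<omega>. cis ((\<Sum>i=1..n. g (family_triple X (\<pi> \<omega> i) \<omega>) - P g (X (\<pi> \<omega> i) \<omega>)) / sqrt (real n)) \<partial>M"
  let ?e = "complex_of_real (exp (- ?s / 2))"
  have DC: "innovation g \<in> C_pol" by (rule C_pol_innovation[OF g])
  have hC: "?h \<in> C_pol" by (rule C_pol_cond_var[OF DC])
  obtain K3 where K3: "\<And>i. 1 \<le> i \<Longrightarrow> (\<integral>\<omega>. \<bar>cond_abs3 (innovation g) (X i \<omega>)\<bar> \<partial>M) \<le> K3"
    using C_pol_X_bound[OF C_pol_cond_abs3[OF DC]] by auto
  have K3': "(\<integral>\<omega>. cond_abs3 (innovation g) (X i \<omega>) \<partial>M) \<le> K3" if "1 \<le> i" for i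
    using K3[OF that] by (simp add: cond_abs3_def)
  obtain K4 where K4: "\<And>i. 1 \<le> i \<Longrightarrow> (\<integral>\<omega>. (?h (X i \<omega>))\<^sup>2 \<partial>M) \<le> K4"
    using C_pol_X_bound[OF C_pol_power[OF hC, of 2]] by auto
  define v where "v n = (\<integral>\<omega>. ((\<Sum>i=1..n. ?h (X (\<pi> \<omega> i) \<omega>) - ?s) / real n)\<^sup>2 \<partial>M)" for n
  have v: "v \<longlonglongrightarrow> 0" unfolding v_def by (rule L2_convergence_X(4)[OF hC])
  let ?b = "\<lambda>n. sqrt (v n) / 2 + (K3 / sqrt (real n) / 6 + K4 / real n / 8)"
  have bound: "cmod (?\<phi> n - ?e) \<le> ?b n" if n: "n \<ge> 1" for n
  proof -
    have "(\<integral>\<omega>. \<bar>(\<Sum>i=1..n. ?h (X (\<pi> \<omega> i) \<omega>) - ?s) / real n\<bar> \<partial>M) \<le> sqrt (v n)"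
      unfolding v_def
      by (rule expectation_abs_le_sqrt[OF sq_int_divide[OF L2_convergence_X(5)[OF hC]]])
    with char_perm_sum_bound[OF g refl K3' K4 n] show ?thesis by linarith
  qed
  have k3: "(\<lambda>n. K3 / sqrt (real n)) \<longlonglongrightarrow> 0"
    by (rule tendsto_divide_0[OF tendsto_const])
       (intro filterlim_at_top_imp_at_infinity filterlim_compose[OF sqrt_at_top filterlim_real_sequentially])
  have k4: "(\<lambda>n. K4 / real n) \<longlonglongrightarrow> 0" by (rule lim_const_over_n)
  have "?b \<longlonglongrightarrow> sqrt 0 / 2 + (0 / 6 + 0 / 8)"
    by (rule tendsto_add[OF tendsto_divide[OF tendsto_real_sqrt[OF v] tendsto_const]
          tendsto_add[OF tendsto_divide[OF k3 tendsto_const] tendsto_divide[OF k4 tendsto_const]]]) simp_all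
  then have b0: "?b \<longlonglongrightarrow> 0" by simp
  have "(\<lambda>n. cmod (?\<phi> n - ?e)) \<longlonglongrightarrow> 0"
  proof (rule tendsto_sandwich[OF _ _ tendsto_const b0])
    show "\<forall>\<^sub>F n in sequentially. cmod (?\<phi> n - ?e) \<le> ?b n"
      by (rule eventually_sequentiallyI[OF bound])
  qed (rule always_eventually, rule allI, rule norm_ge_zero)
  then show ?thesis by (rule LIM_zero_cancel[OF tendsto_norm_zero_cancel])
qed

section \<open>Identification of the limiting covariance\<close>

lemma lift_integrable: "f \<in> C_pol \<Longrightarrow> integrable \<nu>0 (\<lambda>w. lift f (x, w))"
  by (intro integrable_\<nu>0 C_pol_section C_pol_lift)

lemma P_sum:
  assumes "\<And>i. i \<in> I \<Longrightarrow> f i \<in> C_pol"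
  shows "P (\<lambda>t. \<Sum>i\<in>I. c i * f i t) x = (\<Sum>i\<in>I. c i * P (f i) x)"
proof -
  have "(\<lambda>t. \<Sum>i\<in>I. c i * f i t) \<in> C_pol" using assms by (intro C_pol_sum C_pol_cmult)
  then have "P (\<lambda>t. \<Sum>i\<in>I. c i * f i t) x = (\<integral>w. (\<Sum>i\<in>I. c i * lift (f i) (x, w)) \<partial>\<nu>0)"
    by (subst P_eq) (simp_all add: lift_def)
  also have "\<dots> = (\<Sum>i\<in>I. \<integral>w. c i * lift (f i) (x, w) \<partial>\<nu>0)"
    using assms by (intro Bochner_Integration.integral_sum integrable_mult_right lift_integrable)
  also have "\<dots> = (\<Sum>i\<in>I. c i * P (f i) x)"
    using assms by (intro sum.cong refl) (simp add: P_eq)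
  finally show ?thesis .
qed

lemma cond_var_innovation:
  assumes g: "g \<in> C_pol"
  shows "cond_var (innovation g) x = P (\<lambda>t. g t * g t) x - P g x * P g x"
proof -
  have gg: "(\<lambda>t. g t * g t) \<in> C_pol" by (intro C_pol_mult g)
  have i: "integrable \<nu>0 (\<lambda>w. lift g (x, w))" "integrable \<nu>0 (\<lambda>w. lift (\<lambda>t. g t * g t) (x, w))"
    by (intro lift_integrable g gg)+
  have "cond_var (innovation g) x
      = (\<integral>w. lift (\<lambda>t. g t * g t) (x, w) - (2 * P g x * lift g (x, w) - P g x * P g x) \<partial>\<nu>0)"
    unfolding cond_var_def
    by (intro Bochner_Integration.integral_cong refl)
       (simp add: innovation_def lift_def power2_eq_square algebra_simps)
  also have "\<dots> = P (\<lambda>t. g t * g t) x - (2 * P g x * P g x - P g x * P g x)"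
    using i by (simp add: P_eq[OF g] P_eq[OF gg])
  finally show ?thesis by simp
qed

text \<open>The limiting variance of the linear combination with weights \<open>u\<close> is the
  quadratic form of the claimed covariance at \<open>u\<close>, which reduces the vector case to the
  scalar one.\<close>

lemma integral_cond_var_innovation:
  fixes f :: "'d::finite \<Rightarrow> real \<times> real \<times> real \<Rightarrow> real" and u :: "real ^ 'd"
  assumes f: "\<And>i. f i \<in> C_pol"
  defines "S \<equiv> \<chi> i j. (\<integral>x. P (\<lambda>t. f i t * f j t) x \<partial>\<mu>) - (\<integral>x. P (f i) x * P (f j) x \<partial>\<mu>)"
  shows "(\<integral>x. cond_var (innovation (\<lambda>t. \<Sum>i\<in>UNIV. u $ i * f i t)) x \<partial>\<mu>) = u \<bullet> (S *v u)"
proof -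
  let ?g = "\<lambda>t. \<Sum>i\<in>UNIV. u $ i * f i t"
  have gC: "?g \<in> C_pol" by (intro C_pol_sum C_pol_cmult f)
  have ff: "(\<lambda>t. f i t * f j t) \<in> C_pol" for i j by (intro C_pol_mult f)
  have gg: "(\<lambda>t. ?g t * ?g t) = (\<lambda>t. \<Sum>i\<in>UNIV. u $ i * (\<Sum>j\<in>UNIV. u $ j * (f i t * f j t)))"
    by (auto simp: sum_product sum_distrib_left ac_simps intro!: sum.cong)
  have ggP: "P (\<lambda>t. ?g t * ?g t) x = (\<Sum>i\<in>UNIV. u $ i * (\<Sum>j\<in>UNIV. u $ j * P (\<lambda>t. f i t * f j t) x))" for x
    unfolding gg by (subst P_sum, intro C_pol_sum C_pol_cmult ff) (simp add: P_sum[OF ff])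
  have gP: "P ?g x * P ?g x = (\<Sum>i\<in>UNIV. u $ i * (\<Sum>j\<in>UNIV. u $ j * (P (f i) x * P (f j) x)))" for x
    unfolding P_sum[OF f] by (auto simp: sum_product sum_distrib_left ac_simps intro!: sum.cong)
  have iP: "integrable \<mu> (P (\<lambda>t. f i t * f j t))" "integrable \<mu> (\<lambda>x. P (f i) x * P (f j) x)" for i j
    by (intro integrable_\<mu> C_pol_P C_pol_mult f)+
  have "(\<integral>x. cond_var (innovation ?g) x \<partial>\<mu>)
      = (\<integral>x. (\<Sum>i\<in>UNIV. u $ i * (\<Sum>j\<in>UNIV. u $ j * (P (\<lambda>t. f i t * f j t) x - P (f i) x * P (f j) x))) \<partial>\<mu>)"
    by (simp add: cond_var_innovation[OF gC] ggP gP sum_subtractf right_diff_distrib)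
  also have "\<dots> = (\<Sum>i\<in>UNIV. u $ i * (\<Sum>j\<in>UNIV. u $ j * S $ i $ j))"
    using iP by (simp add: S_def)
  also have "\<dots> = u \<bullet> (S *v u)"
    by (simp add: inner_vec_def matrix_vector_mult_def mult.commute)
  finally show ?thesis .
qed

text \<open>Sums over randomly chosen vertices are measurable as part of what
  \<open>converges_in_L2\<close> asserts; the factor \<open>n\<close> is harmless even for
  \<open>n = 0\<close>, where the sum is empty.\<close>

lemma perm_sum_measurable:
  assumes "f \<in> C_pol"
  shows "perm_sum (family_triple X) \<pi> n f \<in> borel_measurable M"
    "perm_sum X \<pi> n (P f) \<in> borel_measurable M"
proof -
  have "perm_mean (family_triple X) \<pi> n f \<in> borel_measurable M" "perm_mean X \<pi> n (P f) \<in> borel_measurable M"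
    using L2_convergence_triple(3)[OF assms] L2_convergence_X(3)[OF C_pol_P[OF assms]]
    by (simp_all add: converges_in_L2_def)
  then show "perm_sum (family_triple X) \<pi> n f \<in> borel_measurable M"
    "perm_sum X \<pi> n (P f) \<in> borel_measurable M"
    unfolding perm_sum_eq
    by (auto intro!: borel_measurable_times)
qed

lemma central_limit_theorem:
  fixes f :: "'d::finite \<Rightarrow> real \<times> real \<times> real \<Rightarrow> real"
  assumes f: "\<And>i. f i \<in> C_pol"
  shows "converges_in_distribution M
    (\<lambda>n \<omega>. (1 / sqrt (real n)) *\<^sub>R
       (\<chi> i. perm_sum (family_triple X) \<pi> n (f i) \<omega> - perm_sum X \<pi> n (P (f i)) \<omega>))
    (multi_normal 0
       (\<chi> i j. (\<integral>x. P (\<lambda>t. f i t * f j t) x \<partial>\<mu>) - (\<integral>x. P (f i) x * P (f j) x \<partial>\<mu>)))"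
proof -
  define S where "S = (\<chi> i j. (\<integral>x. P (\<lambda>t. f i t * f j t) x \<partial>\<mu>) - (\<integral>x. P (f i) x * P (f j) x \<partial>\<mu>))"
  define Z where "Z n \<omega> = (1 / sqrt (real n)) *\<^sub>R
       (\<chi> i. perm_sum (family_triple X) \<pi> n (f i) \<omega> - perm_sum X \<pi> n (P (f i)) \<omega>)" for n \<omega>
  let ?g = "\<lambda>u t. \<Sum>i\<in>UNIV. u $ i * f i t"
  have gC: "?g u \<in> C_pol" for u by (intro C_pol_sum C_pol_cmult f)
  have Sq: "(\<integral>x. cond_var (innovation (?g u)) x \<partial>\<mu>) = u \<bullet> (S *v u)" for u
    unfolding S_def by (rule integral_cond_var_innovation[OF f])
  \<comment> \<open>As an integral of conditional variances the form is nonnegative, so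
    \<open>multi_normal 0 S\<close> has the characteristic function expected of a normal
    law.\<close>
  have Spsd: "0 \<le> u \<bullet> (S *v u)" for u
    unfolding Sq[symmetric] by (rule Bochner_Integration.integral_nonneg) (rule cond_var_nonneg)
  have Ssym: "transpose S = S"
    by (simp add: S_def transpose_def vec_eq_iff mult.commute)
  have Zm: "Z n \<in> borel_measurable M" for n
  proof -
    have "(\<lambda>\<omega>. Z n \<omega> \<bullet> b) \<in> borel_measurable M" if bB: "b \<in> Basis" for b
    proof -
      obtain i where b: "b = axis i 1" using bB by (auto simp: Basis_vec_def)
      note [measurable] = perm_sum_measurable[OF f[of i]]
      show ?thesis unfolding b Z_def by (simp add: inner_axis)
    qed
    then show ?thesis by (simp add: borel_measurable_euclidean_space[of "Z n"])
  qed
  have uZ: "u \<bullet> Z n \<omega> = (\<Sum>i=1..n. ?g u (family_triple X (\<pi> \<omega> i) \<omega>) - P (?g u) (X (\<pi> \<omega> i) \<omega>)) / sqrt (real n)" for u n \<omega>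
  proof -
    have "(\<Sum>i=1..n. ?g u (family_triple X (\<pi> \<omega> i) \<omega>) - P (?g u) (X (\<pi> \<omega> i) \<omega>))
        = (\<Sum>i=1..n. \<Sum>k\<in>UNIV. u $ k * (f k (family_triple X (\<pi> \<omega> i) \<omega>) - P (f k) (X (\<pi> \<omega> i) \<omega>)))"
      unfolding P_sum[OF f] by (simp add: sum_subtractf right_diff_distrib)
    also have "\<dots> = (\<Sum>k\<in>UNIV. u $ k * (perm_sum (family_triple X) \<pi> n (f k) \<omega> - perm_sum X \<pi> n (P (f k)) \<omega>))"
      by (subst sum.swap) (simp add: perm_sum_def sum_subtractf sum_distrib_left[symmetric])
    finally show ?thesis
      by (simp add: Z_def inner_vec_def sum_divide_distrib)
  qed
  have "(\<lambda>n. \<integral>\<omega>. h (Z n \<omega>) \<partial>M) \<longlonglongrightarrow> (\<integral>x. h x \<partial>multi_normal 0 S)"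
    if h: "continuous_on UNIV h" "bounded (range h)" for h :: "real ^ 'd \<Rightarrow> real"
  proof -
    have hm: "h \<in> borel_measurable borel" by (rule borel_measurable_continuous_onI[OF h(1)])
    have "(\<lambda>n. \<integral>x. h x \<partial>distr M borel (Z n)) \<longlonglongrightarrow> (\<integral>x. h x \<partial>multi_normal 0 S)"
    proof (rule levy_continuity_vec[OF _ _ prob_space_multi_normal sets_multi_normal _ h])
      show "prob_space (distr M borel (Z n))" for n by (rule prob_space_distr[OF Zm])
      fix u
      have "(\<integral>x. cis (u \<bullet> x) \<partial>distr M borel (Z n)) = (\<integral>\<omega>. cis (u \<bullet> Z n \<omega>) \<partial>M)" for n
        using Zm by (subst integral_distr) auto
      moreover have "(\<integral>x. cis (u \<bullet> x) \<partial>multi_normal 0 S) = of_real (exp (- (u \<bullet> (S *v u)) / 2))"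
        by (simp add: integral_cis_multi_normal[OF Ssym Spsd])
      ultimately show "(\<lambda>n. \<integral>x. cis (u \<bullet> x) \<partial>distr M borel (Z n)) \<longlonglongrightarrow> (\<integral>x. cis (u \<bullet> x) \<partial>multi_normal 0 S)"
        using char_perm_sum_tendsto[OF gC[of u]] unfolding uZ Sq by simp
    qed simp
    moreover have "(\<integral>x. h x \<partial>distr M borel (Z n)) = (\<integral>\<omega>. h (Z n \<omega>) \<partial>M)" for n
      by (rule integral_distr[OF Zm hm])
    ultimately show ?thesis by simp
  qed
  then show ?thesis
    unfolding converges_in_distribution_def Z_def[symmetric] S_def[symmetric] using Zm by blast
qed

end

theorem proposition27:
  fixes M :: "'w measure"
    and \<alpha>\<^sub>0 \<alpha>\<^sub>1 \<beta>\<^sub>0 \<beta>\<^sub>1 \<sigma> \<rho> :: real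
    and \<nu> \<mu> :: "real measure"
    and X \<epsilon> :: "nat \<Rightarrow> 'w \<Rightarrow> real"
    and \<pi> :: "'w \<Rightarrow> nat \<Rightarrow> nat"
  assumes "bar_model M \<alpha>\<^sub>0 \<alpha>\<^sub>1 \<beta>\<^sub>0 \<beta>\<^sub>1 \<sigma> \<rho> \<nu> X \<epsilon>"
    and "\<And>k::nat. integrable \<nu> (\<lambda>x. \<bar>x\<bar> ^ k)"
    and "generation_permutation M \<pi>"
    and "prob_space.indep_rv M
           (\<Pi>\<^sub>M n\<in>{1..}. borel) (\<lambda>\<omega>. \<lambda>n\<in>{1..}. X n \<omega>)
           (\<Pi>\<^sub>M n\<in>{1..}. count_space UNIV) (\<lambda>\<omega>. \<lambda>n\<in>{1..}. \<pi> \<omega> n)"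
    and "stationary_distribution (bar_Q \<alpha>\<^sub>0 \<alpha>\<^sub>1 \<beta>\<^sub>0 \<beta>\<^sub>1 \<sigma>) \<mu>"
  shows
    "let P = apply_P (bar_P \<alpha>\<^sub>0 \<alpha>\<^sub>1 \<beta>\<^sub>0 \<beta>\<^sub>1 \<sigma> \<rho>); \<Delta> = family_triple X in
     (\<forall>f\<in>C_pol.
        converges_in_L2 M (\<lambda>q. mean_over X (generation q) f) (\<lambda>_. \<integral>x. f x \<partial>\<mu>) \<and>
        converges_in_L2 M (\<lambda>r. mean_over X (subtree r) f) (\<lambda>_. \<integral>x. f x \<partial>\<mu>) \<and>
        converges_in_L2 M (\<lambda>n. perm_mean X \<pi> n f) (\<lambda>_. \<integral>x. f x \<partial>\<mu>)) \<and>
     (\<forall>f\<in>C_pol.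
        converges_in_L2 M (\<lambda>q. mean_over \<Delta> (generation q) f) (\<lambda>_. \<integral>x. P f x \<partial>\<mu>) \<and>
        converges_in_L2 M (\<lambda>r. mean_over \<Delta> (subtree r) f) (\<lambda>_. \<integral>x. P f x \<partial>\<mu>) \<and>
        converges_in_L2 M (\<lambda>n. perm_mean \<Delta> \<pi> n f) (\<lambda>_. \<integral>x. P f x \<partial>\<mu>)) \<and>
     (\<forall>f :: 'd::finite \<Rightarrow> real \<times> real \<times> real \<Rightarrow> real. (\<forall>i. f i \<in> C_pol) \<longrightarrow>
        converges_in_distribution M
          (\<lambda>n \<omega>. (1 / sqrt (real n)) *\<^sub>R
             (\<chi> i. perm_sum \<Delta> \<pi> n (f i) \<omega> - perm_sum X \<pi> n (P (f i)) \<omega>))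
          (multi_normal 0
             (\<chi> i j. (\<integral>x. P (\<lambda>t. f i t * f j t) x \<partial>\<mu>) - (\<integral>x. P (f i) x * P (f j) x \<partial>\<mu>))))"
proof -
  interpret bar_permuted M \<alpha>\<^sub>0 \<alpha>\<^sub>1 \<beta>\<^sub>0 \<beta>\<^sub>1 \<sigma> \<rho> \<nu> X \<epsilon> \<mu> \<pi>
    using assms
    by (intro bar_permuted.intro bar_model_stationary.intro bar_model_moments.intro
        bar_model_moments_axioms.intro bar_model_stationary_axioms.intro bar_permuted_axioms.intro)
  show ?thesis
    unfolding Let_def
    by (intro conjI ballI allI impI L2_convergence_X(1-3) L2_convergence_triple central_limit_theorem) blast+
qed

end
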